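(* Let $J=\left(\frac{\partial\mathbb H}{\partial a_0},\dots,\frac{\partial\mathbb H}{\partial a_5}\right)\subseteq R=\mathbf C[a_0,\dots,a_5]$ be the Jacobian ideal of the Hermite invariant $\mathbb H$ of binary quintics. For one of the three triples $$\tau\in\{(0,0,0),\ (2/5,\,14/75,\,-2/5),\ (1/6,\,2/45,\,-1/3)\}$$ we have the equality $\mathfrak b_\tau=J$. In particular $J$ is also perfect.
   Context: The base field is $\mathbf C$. For binary forms $A,B$ in $x_1,x_2$ of orders (homogeneous degrees) $m,n$ the $r$-th transvectant is $$(A,B)_r=\frac{(m-r)!\,(n-r)!}{m!\,n!}\sum_{i=0}^r(-1)^i\binom ri\frac{\partial^rA}{\partial x_1^{r-i}\partial x_2^i}\,\frac{\partial^rB}{\partial x_1^i\partial x_2^{r-i}},$$ and $(A,B)_r=0$ if $r>\min(m,n)$. $\mathbb F=\sum_{i=0}^5\binom5i a_i x_1^{5-i}x_2^i$ is the generic binary quintic and $R=\mathbf C[a_0,\dots,a_5]$. The covariants used are $\vartheta_{22}=(\mathbb F,\mathbb F)_4$, $\vartheta_{26}=(\mathbb F,\mathbb F)_2$, $\vartheta_{33}=(\vartheta_{22},\mathbb F)_2$, $\vartheta_{39}=(\mathbb F,\vartheta_{26})_1$, $\vartheta_{40}=(\vartheta_{22},\vartheta_{22})_2$, $\vartheta_{51}=(\vartheta_{22}^2,\mathbb F)_4$, $\vartheta_{80}=(\vartheta_{22}^3,\vartheta_{26})_6$. The Hermite invariant is the degree $18$ invariant $\mathbb H=(\vartheta_{22}^7,\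 \mathbb F\,\vartheta_{39})_{14}\in R$. The Wronskian of binary forms $A_1,\dots,A_m$ of order $n$ (with $m\le n+1$) is $W(A_1,\dots,A_m)=\det\big(\partial^{m-1}A_i/\partial x_1^{m-j}\partial x_2^{j-1}\big)_{1\le i,j\le m}$. For $\tau=(\alpha,\beta,\gamma)\in\mathbf Q^3$ put $\mathcal U=\vartheta_{33}\vartheta_{22}-\alpha\,\vartheta_{40}\,\mathbb F$, $\mathcal V=\vartheta_{51}\vartheta_{22}^2-\beta\,\vartheta_{40}^2\,\mathbb F-\gamma\,\vartheta_{80}\,\mathbb F$, and $\Gamma_\tau=W\big((x_1^2,\mathbb F)_1,(x_1x_2,\mathbb F)_1,(x_2^2,\mathbb F)_1,\mathcal U,\mathcal V\big)$, a form of order $5$ in $x_1,x_2$ with coefficients of degree $17$ in the $a_i$. $\mathfrak b_\tau\subseteq R$ is the ideal generated by the coefficients of $\Gamma_\tau$. *)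

theory Defs
  imports
    Complex_Main
    "HOL-Library.Poly_Mapping"
    "HOL-Library.Numeral_Type"
    "HOL-Library.Extended_Nat"
    "Jordan_Normal_Form.Determinant"
begin

section \<open>Polynomials and partial derivatives\<close>

type_synonym ('v, 'a) mpoly = "('v \<Rightarrow>\<^sub>0 nat) \<Rightarrow>\<^sub>0 'a"

definition mconst :: "'a \<Rightarrow> ('v, 'a::zero) mpoly" where
  "mconst c = Poly_Mapping.single 0 c"

definition mvar :: "'v \<Rightarrow> ('v, 'a::zero_neq_one) mpoly" where
  "mvar v = Poly_Mapping.single (Poly_Mapping.single v 1) 1"

definition mpderiv :: "'v \<Rightarrow> ('v, 'a::comm_semiring_1) mpoly \<Rightarrow> ('v, 'a) mpoly" where
  "mpderiv v p =
     (\<Sum>m\<in>Poly_Mapping.keys p.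
        Poly_Mapping.single (m - Poly_Mapping.single v 1)
          (of_nat (Poly_Mapping.lookup m v) * Poly_Mapping.lookup p m))"


section \<open>Binary forms over \<open>\<complex>[a\<^sub>0, \<dots>, a\<^sub>5]\<close>\<close>

text \<open>The six elements \<open>0, \<dots>, 5\<close> of the type \<open>6\<close> index the variables \<open>a\<^sub>0, \<dots>, a\<^sub>5\<close>.
  The elements \<open>0\<close> and \<open>1\<close> of the type \<open>2\<close> index the variables \<open>x\<^sub>1\<close> and \<open>x\<^sub>2\<close>, in this order.\<close>

type_synonym R = "(6, complex) mpoly"

type_synonym form = "(2, R) mpoly"

definition x1 :: form where "x1 = mvar 0"

definition x2 :: form where "x2 = mvar 1"

definition scalar :: "complex \<Rightarrow> form" where
  "scalar c = mconst (mconst c)"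

definition D1 :: "form \<Rightarrow> form" where "D1 = mpderiv 0"

definition D2 :: "form \<Rightarrow> form" where "D2 = mpderiv 1"

text \<open>The order of a form is not determined by the polynomial when the latter is zero, so
  \<open>transvectant m n r A B\<close>, that is \<open>(A, B)\<^sub>r\<close>, takes the orders \<open>m\<close> of \<open>A\<close> and \<open>n\<close> of \<open>B\<close> as
  arguments. The result has order \<open>m + n - 2 * r\<close>.\<close>

definition transvectant :: "nat \<Rightarrow> nat \<Rightarrow> nat \<Rightarrow> form \<Rightarrow> form \<Rightarrow> form" where
  "transvectant m n r A B =
     (if r > min m n then 0
      else scalar (fact (m - r) * fact (n - r) / (fact m * fact n)) *
        (\<Sum>i=0..r. (- 1) ^ i * of_nat (r choose i) *
           (D1 ^^ (r - i)) ((D2 ^^ i) A) * (D1 ^^ i) ((D2 ^^ (r - i)) B)))"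

text \<open>Rows and columns are numbered from \<open>0\<close> here, so the entry for the row \<open>i\<close> and the
  column \<open>j\<close> is the derivative of order \<open>m - 1 - j\<close> in \<open>x\<^sub>1\<close> and of order \<open>j\<close> in \<open>x\<^sub>2\<close>.\<close>

definition wronskian :: "form list \<Rightarrow> form" where
  "wronskian As =
     (let m = length As in
      det (mat m m (\<lambda>(i, j). (D1 ^^ (m - 1 - j)) ((D2 ^^ j) (As ! i)))))"


section \<open>Covariants of the generic binary quintic\<close>

definition quintic :: form where
  "quintic = (\<Sum>i=0..5. of_nat (5 choose i) * mconst (mvar (of_nat i)) * x1 ^ (5 - i) * x2 ^ i)"

text \<open>Orders: \<open>\<theta>22\<close> has order 2, \<open>\<theta>26\<close> 6, \<open>\<theta>33\<close> 3, \<open>\<theta>39\<close> 9, \<open>\<theta>51\<close> 1, and \<open>\<theta>40\<close>, \<open>\<theta>80\<close> have order 0.\<close>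

definition \<theta>22 :: form where "\<theta>22 = transvectant 5 5 4 quintic quintic"

definition \<theta>26 :: form where "\<theta>26 = transvectant 5 5 2 quintic quintic"

definition \<theta>33 :: form where "\<theta>33 = transvectant 2 5 2 \<theta>22 quintic"

definition \<theta>39 :: form where "\<theta>39 = transvectant 5 6 1 quintic \<theta>26"

definition \<theta>40 :: form where "\<theta>40 = transvectant 2 2 2 \<theta>22 \<theta>22"

definition \<theta>51 :: form where "\<theta>51 = transvectant 4 5 4 (\<theta>22 ^ 2) quintic"

definition \<theta>80 :: form where "\<theta>80 = transvectant 6 6 6 (\<theta>22 ^ 3) \<theta>26"

text \<open>A form of order \<open>0\<close> is identified with its constant coefficient.\<close>

definition hermite_invariant :: R where
  "hermite_invariant =
     Poly_Mapping.lookup (transvectant 14 14 14 (\<theta>22 ^ 7) (quintic * \<theta>39)) 0"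

definition form_U :: "rat \<Rightarrow> form" where
  "form_U \<alpha> = \<theta>33 * \<theta>22 - scalar (of_rat \<alpha>) * \<theta>40 * quintic"

definition form_V :: "rat \<Rightarrow> rat \<Rightarrow> form" where
  "form_V \<beta> \<gamma> = \<theta>51 * \<theta>22 ^ 2 - scalar (of_rat \<beta>) * \<theta>40 ^ 2 * quintic
     - scalar (of_rat \<gamma>) * \<theta>80 * quintic"

definition form_Gamma :: "rat \<times> rat \<times> rat \<Rightarrow> form" where
  "form_Gamma = (\<lambda>(\<alpha>, \<beta>, \<gamma>).
     wronskian
       [transvectant 2 5 1 (x1 ^ 2) quintic,
        transvectant 2 5 1 (x1 * x2) quintic,
        transvectant 2 5 1 (x2 ^ 2) quintic,
        form_U \<alpha>, form_V \<beta> \<gamma>])"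


section \<open>Ideals\<close>

text \<open>An ideal of a commutative ring is a submodule (\<open>module.subspace\<close>) of the ring, viewed as
  a module over itself. The type-class modules of HOL are meant, not the record-based
  \<open>Module.module\<close> of HOL-Algebra.\<close>

lemma module_ring: "Modules.module ((*) :: 'a \<Rightarrow> 'a \<Rightarrow> 'a::comm_ring_1)"
  by unfold_locales (simp_all add: algebra_simps)

definition ideal_gen :: "'a::comm_ring_1 set \<Rightarrow> 'a set" where
  "ideal_gen S = Modules.module.span (*) S"

definition ideal_b :: "rat \<times> rat \<times> rat \<Rightarrow> R set" where
  "ideal_b \<tau> = ideal_gen {Poly_Mapping.lookup (form_Gamma \<tau>) m | m. True}"

definition jacobian_ideal :: "R \<Rightarrow> R set" where
  "jacobian_ideal h = ideal_gen {mpderiv i h | i. True}"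


section \<open>Perfect ideals\<close>

definition regular_sequence :: "'a::comm_ring_1 list \<Rightarrow> bool" where
  "regular_sequence xs \<longleftrightarrow>
     (\<forall>i<length xs. \<forall>r. r * xs ! i \<in> ideal_gen (set (take i xs))
        \<longrightarrow> r \<in> ideal_gen (set (take i xs))) \<and>
     ideal_gen (set xs) \<noteq> UNIV"

definition grade :: "'a::comm_ring_1 set \<Rightarrow> enat" where
  "grade I = (SUP xs\<in>{xs. regular_sequence xs \<and> set xs \<subseteq> I}. enat (length xs))"

text \<open>The free module of countable rank over \<open>'a\<close> is \<open>nat \<Rightarrow>\<^sub>0 'a\<close>.\<close>

definition fscale :: "'a::comm_ring_1 \<Rightarrow> (nat \<Rightarrow>\<^sub>0 'a) \<Rightarrow> (nat \<Rightarrow>\<^sub>0 'a)" where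
  "fscale c x = Poly_Mapping.map ((*) c) x"

lemma lookup_fscale: "Poly_Mapping.lookup (fscale c x) k = c * Poly_Mapping.lookup x k"
  by (simp add: fscale_def map.rep_eq when_def)

lemma module_fscale: "Modules.module (fscale :: 'a \<Rightarrow> _ \<Rightarrow> (nat \<Rightarrow>\<^sub>0 'a::comm_ring_1))"
  by unfold_locales
    (simp_all add: poly_mapping_eq_iff fun_eq_iff lookup_fscale lookup_add algebra_simps)

text \<open>Projective modules are represented as direct summands of the free module of countable
  rank. Up to isomorphism these are all the countably generated projective modules.\<close>

definition projective_summand :: "(nat \<Rightarrow>\<^sub>0 'a::comm_ring_1) set \<Rightarrow> bool" where
  "projective_summand P \<longleftrightarrow>
     Modules.module.subspace fscale P \<and>
     (\<exists>Q. Modules.module.subspace fscale Q \<and> P \<inter> Q = {0} \<and> {p + q | p q. p \<in> P \<and> q \<in> Q} = UNIV)"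

definition linear_on :: "(nat \<Rightarrow>\<^sub>0 'a::comm_ring_1) set \<Rightarrow> ((nat \<Rightarrow>\<^sub>0 'a) \<Rightarrow> (nat \<Rightarrow>\<^sub>0 'a)) \<Rightarrow> bool" where
  "linear_on P d \<longleftrightarrow>
     (\<forall>x\<in>P. \<forall>y\<in>P. d (x + y) = d x + d y) \<and> (\<forall>c. \<forall>x\<in>P. d (fscale c x) = fscale c (d x))"

text \<open>A map from \<open>P\<close> to the quotient of the ring by \<open>I\<close> is given by a function choosing a
  representative of each value; linearity then holds modulo \<open>I\<close>.\<close>

definition linear_on_mod ::
    "'a::comm_ring_1 set \<Rightarrow> (nat \<Rightarrow>\<^sub>0 'a) set \<Rightarrow> ((nat \<Rightarrow>\<^sub>0 'a) \<Rightarrow> 'a) \<Rightarrow> bool" where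
  "linear_on_mod I P e \<longleftrightarrow>
     (\<forall>x\<in>P. \<forall>y\<in>P. e (x + y) - (e x + e y) \<in> I) \<and> (\<forall>c. \<forall>x\<in>P. e (fscale c x) - c * e x \<in> I)"

text \<open>\<open>quotient_resolution I n P d e\<close>: the sequence
    \<open>0 \<rightarrow> P n \<rightarrow> \<dots> \<rightarrow> P 1 \<rightarrow> P 0 \<rightarrow> R/I \<rightarrow> 0\<close>,
  with the maps \<open>d k : P (k + 1) \<rightarrow> P k\<close> and \<open>e : P 0 \<rightarrow> R/I\<close>, is a projective resolution.
  Since \<open>P k = 0\<close> for \<open>k > n\<close>, exactness at \<open>P n\<close> says that the leftmost map is injective.\<close>

definition quotient_resolution ::
    "'a::comm_ring_1 set \<Rightarrow> nat \<Rightarrow> (nat \<Rightarrow> (nat \<Rightarrow>\<^sub>0 'a) set) \<Rightarrow>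
      (nat \<Rightarrow> (nat \<Rightarrow>\<^sub>0 'a) \<Rightarrow> (nat \<Rightarrow>\<^sub>0 'a)) \<Rightarrow> ((nat \<Rightarrow>\<^sub>0 'a) \<Rightarrow> 'a) \<Rightarrow> bool" where
  "quotient_resolution I n P d e \<longleftrightarrow>
     (\<forall>k. projective_summand (P k)) \<and> (\<forall>k>n. P k = {0}) \<and>
     (\<forall>k. linear_on (P (Suc k)) (d k)) \<and> linear_on_mod I (P 0) e \<and>
     (\<forall>r. \<exists>x\<in>P 0. e x - r \<in> I) \<and>
     d 0 ` P 1 = {x \<in> P 0. e x \<in> I} \<and>
     (\<forall>k. d (Suc k) ` P (Suc (Suc k)) = {x \<in> P (Suc k). d k x = 0})"

text \<open>The projective dimension of the quotient of the ring by \<open>I\<close>. Resolutions by countably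
  generated projective modules suffice to compute it over a Noetherian ring; the infimum of the
  empty set is \<open>\<infinity>\<close>.\<close>

definition projective_dimension_quotient :: "'a::comm_ring_1 set \<Rightarrow> enat" where
  "projective_dimension_quotient I = (INF n\<in>{n. \<exists>P d e. quotient_resolution I n P d e}. enat n)"

definition perfect_ideal :: "'a::comm_ring_1 set \<Rightarrow> bool" where
  "perfect_ideal I \<longleftrightarrow>
     Modules.module.subspace (*) I \<and> I \<noteq> UNIV \<and> projective_dimension_quotient I = grade I"

end

theory Submission
  imports
    Defs
    "HOL-Computational_Algebra.Field_as_Ring"
    "Jordan_Normal_Form.Char_Poly"
begin

text \<open>Let \<open>H\<close> be the Hermite invariant and \<open>F\<close> the quintic. A quintic form \<open>U\<close> with normalized coefficients
  \<open>U\<^sub>0, \<dots>, U\<^sub>5\<close> in \<open>R\<close> is also a vector field: the derivation \<open>D\<^sub>U\<close> of \<open>R\<close> sending \<open>a\<^sub>k\<close> to \<open>U\<^sub>k\<close>, for which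
  \<open>D\<^sub>U F = U\<close>. The proof rests on the fact that, for the third triple \<open>(1/6, 2/45, -1/3)\<close>, the
  derivations of all five forms in the Wronskian kill \<open>H\<close>.

  For the first three forms this is the invariance of \<open>H\<close>, as they are multiples of the generators
  of \<open>sl\<^sub>2\<close> acting on the \<open>a\<^sub>k\<close>. If \<open>U\<close> is a covariant then \<open>D\<^sub>U H\<close> is an invariant again, and the
  constants in the triple are those for which the two invariants obtained from \<open>\<U>\<close> and \<open>\<V>\<close>, of
  degrees 22 and 26, vanish. Vanishing is tested on the four-dimensional slice \<open>a\<^sub>2 = a\<^sub>3 = 0\<close>, on which
  \<open>H\<close> has only ten monomials: an invariant that is zero there is zero everywhere
  (\<open>invariant_zero_if_zero_on_slice\<close>), because the two nilpotent generators of \<open>sl\<^sub>2\<close> move the slice in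
  the two missing directions.

  Consequently the gradient of \<open>H\<close> is in the kernel of the 5 by 6 matrix \<open>M\<close> of coefficients of the
  five forms. By Cramer's rule the vector of signed maximal minors of \<open>M\<close> is proportional to it
  (\<open>kernel_proportional_to_minors\<close>), and these minors are, up to nonzero constants, the coefficients
  of the Wronskian (\<open>wronskian_quintics\<close>). Two partial derivatives of \<open>H\<close> form a regular sequence
  (\<open>regular_grad\<close>): on the pencil spanned by the two forms \<open>x\<^sub>1\<^sup>5 + 5 x\<^sub>1 x\<^sub>2\<^sup>4\<close> and \<open>5 x\<^sub>1\<^sup>4 x\<^sub>2 + x\<^sub>2\<^sup>5\<close> they
  vanish simultaneously at the origin only. This turns proportionality into an identity \<open>minors = c * gradient\<close> with \<open>c\<close> in
  \<open>R\<close>. Minors and gradient have degree 17, so \<open>c\<close> is a constant, and it is not zero because some minor is not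
  zero. Hence the two ideals agree.

  Perfection is the theorem of Hilbert and Burch (\<open>minors_of_grade_two.perfect\<close>): the maximal minors of
  an \<open>n\<close> by \<open>n + 1\<close> matrix generate, if their grade is at least two, an ideal resolved by
  \<open>0 \<rightarrow> R\<^sup>n \<rightarrow> R\<^sup>n\<^sup>+\<^sup>1 \<rightarrow> R\<close>, and both its grade and the projective dimension of its quotient are two.\<close>


abbreviation "lookup \<equiv> Poly_Mapping.lookup"
abbreviation "single \<equiv> Poly_Mapping.single"
abbreviation "keys \<equiv> Poly_Mapping.keys"

lemma mult_if_left: "(if P then c else 0) * (x::'a::mult_zero) = (if P then c * x else 0)"
  by simp

lemma mult_if_right: "(x::'a::mult_zero) * (if P then c else 0) = (if P then x * c else 0)"
  by simp

lemma sum_mult_sum_swap: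
  fixes f :: "'i \<Rightarrow> 'a::comm_ring_1"
  shows "(\<Sum>j\<in>A. (\<Sum>i\<in>B. f i * g i j) * u j) = (\<Sum>i\<in>B. f i * (\<Sum>j\<in>A. g i j * u j))"
  by (simp only: sum_distrib_left sum_distrib_right mult.assoc) (rule sum.swap)

section \<open>Ideals and regular sequences\<close>

lemma ideal_gen_image:
  assumes "finite A"
  shows "ideal_gen (h ` A) = {\<Sum>j\<in>A. c j * h j | c. True}" (is "_ = ?S")
proof
  have "Modules.module.subspace (*) ?S"
    unfolding Modules.module.subspace_def[OF module_ring]
  proof (intro conjI ballI allI)
    show "0 \<in> ?S" by (rule CollectI, rule exI[of _ "\<lambda>_. 0"]) simp
  next
    fix x y assume "x \<in> ?S" "y \<in> ?S"
    then obtain c d where cd: "x = (\<Sum>j\<in>A. c j * h j)" "y = (\<Sum>j\<in>A. d j * h j)" by auto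
    have "x + y = (\<Sum>j\<in>A. (c j + d j) * h j)" unfolding cd distrib_right sum.distrib ..
    then show "x + y \<in> ?S" by (intro CollectI exI[of _ "\<lambda>j. c j + d j"] conjI TrueI)
  next
    fix r x assume "x \<in> ?S"
    then obtain c where c: "x = (\<Sum>j\<in>A. c j * h j)" by auto
    have "r * x = (\<Sum>j\<in>A. (r * c j) * h j)" unfolding c sum_distrib_left mult.assoc ..
    then show "r * x \<in> ?S" by (intro CollectI exI[of _ "\<lambda>j. r * c j"] conjI TrueI)
  qed
  moreover have "h ` A \<subseteq> ?S"
  proof (rule image_subsetI)
    fix i assume "i \<in> A"
    then have "h i = (\<Sum>j\<in>A. (if j = i then 1 else 0) * h j)"
      using assms by (simp add: mult_if_left)
    then show "h i \<in> ?S" by (intro CollectI exI[of _ "\<lambda>j. if j = i then 1 else 0"] conjI TrueI)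
  qed
  ultimately show "ideal_gen (h ` A) \<subseteq> ?S"
    unfolding ideal_gen_def by (rule Modules.module.span_minimal[OF module_ring, rotated])
  show "?S \<subseteq> ideal_gen (h ` A)"
    unfolding ideal_gen_def
    by clarify (intro Modules.module.span_sum[OF module_ring] Modules.module.span_scale[OF module_ring] Modules.module.span_base[OF module_ring] imageI)
qed

lemma mem_ideal_gen_single: "r \<in> ideal_gen {x} \<longleftrightarrow> (\<exists>k. r = k * x)"
  unfolding ideal_gen_def Modules.module.span_singleton[OF module_ring] by auto

lemma mem_ideal_gen_pair: "r \<in> ideal_gen {x, y} \<longleftrightarrow> (\<exists>k l. r = k * x + l * y)"
proof -
  have "r \<in> ideal_gen {x, y} \<longleftrightarrow> (\<exists>k. r - k * x \<in> ideal_gen {y})"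
    unfolding ideal_gen_def Modules.module.span_insert[OF module_ring, of x] by simp
  also have "\<dots> \<longleftrightarrow> (\<exists>k l. r = k * x + l * y)"
    by (simp add: mem_ideal_gen_single diff_eq_eq add.commute)
  finally show ?thesis .
qed

lemma ideal_gen_empty: "ideal_gen {} = {0}"
  unfolding ideal_gen_def by (rule Modules.module.span_empty[OF module_ring])

lemma regular_sequence_firstD:
  fixes xs :: "'a::idom list"
  assumes "regular_sequence xs" "0 < length xs"
  shows "xs ! 0 \<noteq> 0"
proof
  assume "xs ! 0 = 0"
  then have "1 * xs ! 0 \<in> ideal_gen (set (take 0 xs))" by (simp add: ideal_gen_empty)
  then have "(1::'a) \<in> ideal_gen (set (take 0 xs))"
    using assms unfolding regular_sequence_def by blast
  then show False by (simp add: ideal_gen_empty)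
qed

lemma regular_sequence_secondD:
  fixes xs :: "'a::idom list"
  assumes "regular_sequence xs" "1 < length xs" "r * xs ! 1 = s * xs ! 0"
  obtains k where "r = k * xs ! 0"
proof -
  have t: "set (take 1 xs) = {xs ! 0}"
    using assms(2) by (cases xs) auto
  have "r * xs ! 1 \<in> ideal_gen (set (take 1 xs))"
    unfolding t mem_ideal_gen_single using assms(3) by blast
  then have "r \<in> ideal_gen (set (take 1 xs))"
    using assms(1,2) unfolding regular_sequence_def by blast
  then show ?thesis unfolding t mem_ideal_gen_single using that by blast
qed

lemma regular_sequence_thirdD:
  fixes xs :: "'a::idom list"
  assumes "regular_sequence xs" "2 < length xs" "r * xs ! 2 = s * xs ! 0 + t * xs ! 1"
  obtains k l where "r = k * xs ! 0 + l * xs ! 1"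
proof -
  have t: "set (take 2 xs) = {xs ! 0, xs ! 1}"
    using assms(2) by (cases xs; cases "tl xs") (auto simp: numeral_2_eq_2)
  have "r * xs ! 2 \<in> ideal_gen (set (take 2 xs))"
    unfolding t mem_ideal_gen_pair using assms(3) by blast
  then have "r \<in> ideal_gen (set (take 2 xs))"
    using assms(1,2) unfolding regular_sequence_def by blast
  then show ?thesis unfolding t mem_ideal_gen_pair using that by blast
qed


section \<open>Maximal minors of an almost square matrix\<close>

text \<open>The sign makes this the cofactor of the last entry in column \<open>j\<close> when a row is added below.\<close>

definition signed_minor :: "nat \<Rightarrow> (nat \<Rightarrow> nat \<Rightarrow> 'a::comm_ring_1) \<Rightarrow> nat \<Rightarrow> 'a" where
  "signed_minor n M j =
     (- 1) ^ (n + j) * det (mat n n (\<lambda>(i, k). M i (if k < j then k else Suc k)))"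

text \<open>With a further row \<open>w\<close> the relations between \<open>M\<close> and its maximal minors become instances of
  Cramer's rule for a square matrix: the determinant is the pairing of \<open>w\<close> with the signed minors,
  and the signed minors are the last column of the adjugate, whatever \<open>w\<close> is.\<close>

definition bordered :: "nat \<Rightarrow> (nat \<Rightarrow> nat \<Rightarrow> 'a::comm_ring_1) \<Rightarrow> (nat \<Rightarrow> 'a) \<Rightarrow> 'a mat" where
  "bordered n M w = mat (Suc n) (Suc n) (\<lambda>(i, j). if i < n then M i j else w j)"

lemma bordered_carrier: "bordered n M w \<in> carrier_mat (Suc n) (Suc n)"
  by (simp add: bordered_def)

lemma cofactor_bordered:
  assumes "j \<le> n"
  shows "cofactor (bordered n M w) n j = signed_minor n M j"
proof -
  have "mat_delete (bordered n M w) n j = mat n n (\<lambda>(i, k). M i (if k < j then k else Suc k))"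
    by (rule eq_matI) (auto simp: mat_delete_def bordered_def)
  then show ?thesis by (simp add: cofactor_def signed_minor_def)
qed

lemma det_bordered: "det (bordered n M w) = (\<Sum>j\<le>n. w j * signed_minor n M j)"
  unfolding laplace_expansion_row[OF bordered_carrier lessI] lessThan_Suc_atMost
  by (intro sum.cong refl) (simp add: cofactor_bordered, simp add: bordered_def)

lemma bordered_unit:
  assumes "l \<le> n"
  shows "det (bordered n M (\<lambda>j. if j = l then 1 else 0)) = signed_minor n M l"
  using assms by (simp add: det_bordered mult_if_left mult_if_right cong: if_cong)

abbreviation bordered_adj :: "nat \<Rightarrow> (nat \<Rightarrow> nat \<Rightarrow> 'a::comm_ring_1) \<Rightarrow> (nat \<Rightarrow> 'a) \<Rightarrow> nat \<Rightarrow> nat \<Rightarrow> 'a" where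
  "bordered_adj n M w j i \<equiv> adj_mat (bordered n M w) $$ (j, i)"

lemma bordered_adj_last: "j \<le> n \<Longrightarrow> bordered_adj n M w j n = signed_minor n M j"
  using bordered_carrier[of n M w] by (simp add: adj_mat_def cofactor_bordered)

lemma bordered_adj_left:
  assumes "k \<le> n" "j \<le> n"
  shows "(\<Sum>i<n. bordered_adj n M w k i * M i j) + bordered_adj n M w k n * w j =
    (if k = j then det (bordered n M w) else 0)"
proof -
  let ?B = "bordered n M w"
  have "(adj_mat ?B * ?B) $$ (k, j) = (\<Sum>i<Suc n. adj_mat ?B $$ (k, i) * ?B $$ (i, j))"
    using assms bordered_carrier[of n M w] adj_mat(1)[OF bordered_carrier[of n M w]]
    by (simp add: scalar_prod_def atLeast0LessThan del: sum.lessThan_Suc)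
  also have "\<dots> = (\<Sum>i<n. adj_mat ?B $$ (k, i) * M i j) + adj_mat ?B $$ (k, n) * w j"
    using assms by (simp add: bordered_def)
  finally have "(\<Sum>i<n. adj_mat ?B $$ (k, i) * M i j) + adj_mat ?B $$ (k, n) * w j = (adj_mat ?B * ?B) $$ (k, j)" by (rule sym)
  then show ?thesis using assms by (simp add: adj_mat(3)[OF bordered_carrier])
qed

lemma bordered_adj_right:
  assumes "i < n" "l \<le> n"
  shows "(\<Sum>j\<le>n. M i j * bordered_adj n M w j l) = (if i = l then det (bordered n M w) else 0)"
proof -
  let ?B = "bordered n M w"
  have "(?B * adj_mat ?B) $$ (i, l) = (\<Sum>j<Suc n. ?B $$ (i, j) * adj_mat ?B $$ (j, l))"
    using assms bordered_carrier[of n M w] adj_mat(1)[OF bordered_carrier[of n M w]]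
    by (simp add: scalar_prod_def atLeast0LessThan del: sum.lessThan_Suc)
  also have "\<dots> = (\<Sum>j\<le>n. M i j * adj_mat ?B $$ (j, l))"
    unfolding lessThan_Suc_atMost using assms by (intro sum.cong refl) (simp add: bordered_def)
  finally have "(\<Sum>j\<le>n. M i j * adj_mat ?B $$ (j, l)) = (?B * adj_mat ?B) $$ (i, l)" by (rule sym)
  then show ?thesis using assms by (simp add: adj_mat(2)[OF bordered_carrier])
qed

lemma matrix_times_signed_minors:
  fixes M :: "nat \<Rightarrow> nat \<Rightarrow> 'a::comm_ring_1"
  assumes "i < n"
  shows "(\<Sum>j\<le>n. M i j * signed_minor n M j) = 0"
proof -
  have "(\<Sum>j\<le>n. M i j * signed_minor n M j) = det (bordered n M (M i))"
    by (rule det_bordered[symmetric])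
  also have "\<dots> = 0"
    by (rule det_identical_rows[OF bordered_carrier, of i n])
      (use assms in \<open>auto simp: bordered_def\<close>)
  finally show ?thesis .
qed

text \<open>Border \<open>M\<close> by the unit row \<open>l\<close>. The bordered matrix sends \<open>u\<close> to a vector whose only nonzero
  entry is the last one, \<open>u l\<close>; apply the adjugate.\<close>

lemma kernel_proportional_to_minors:
  fixes M :: "nat \<Rightarrow> nat \<Rightarrow> 'a::comm_ring_1"
  assumes ker: "\<And>i. i < n \<Longrightarrow> (\<Sum>j\<le>n. M i j * u j) = 0" and "k \<le> n" "l \<le> n"
  shows "u l * signed_minor n M k = signed_minor n M l * u k"
proof -
  let ?w = "\<lambda>j. if j = l then 1 else (0::'a)"
  let ?C = "bordered_adj n M ?w"
  have "(\<Sum>j\<le>n. ((\<Sum>i<n. ?C k i * M i j) + ?C k n * ?w j) * u j) =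
      (\<Sum>j\<le>n. (if k = j then det (bordered n M ?w) else 0) * u j)"
    by (intro sum.cong refl, subst bordered_adj_left) (use assms in auto)
  also have "\<dots> = signed_minor n M l * u k"
    using assms by (simp add: bordered_unit mult_if_left mult_if_right cong: if_cong)
  finally have 1: "(\<Sum>j\<le>n. ((\<Sum>i<n. ?C k i * M i j) + ?C k n * ?w j) * u j) = signed_minor n M l * u k" .
  have "(\<Sum>j\<le>n. (\<Sum>i<n. ?C k i * M i j) * u j) = (\<Sum>i<n. ?C k i * (\<Sum>j\<le>n. M i j * u j))"
    by (rule sum_mult_sum_swap)
  also have "\<dots> = 0" using ker by simp
  finally have 2: "(\<Sum>j\<le>n. (\<Sum>i<n. ?C k i * M i j) * u j) = 0" .
  have 3: "(\<Sum>j\<le>n. ?C k n * ?w j * u j) = ?C k n * u l"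
    using assms(3) by (simp add: mult_if_left mult_if_right cong: if_cong)
  have "u l * signed_minor n M k = (\<Sum>j\<le>n. ?C k n * ?w j * u j)"
    unfolding 3 by (simp only: bordered_adj_last[OF assms(2)] mult.commute)
  also have "\<dots> = (\<Sum>j\<le>n. ((\<Sum>i<n. ?C k i * M i j) + ?C k n * ?w j) * u j)"
    unfolding distrib_right sum.distrib 2 by (rule add_0_left[symmetric])
  also note 1
  finally show ?thesis .
qed

text \<open>Multiply \<open>y\<close> by the adjugate of the matrix bordered by the unit row \<open>l\<close>. The last coordinate of
  the product is the pairing of \<open>y\<close> with the minors, which vanishes; the others form \<open>z\<close>.\<close>

lemma minor_multiple_in_row_space:
  fixes M :: "nat \<Rightarrow> nat \<Rightarrow> 'a::comm_ring_1"
  assumes orth: "(\<Sum>j\<le>n. y j * signed_minor n M j) = 0" and "l \<le> n"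
  obtains z where "\<And>j. j \<le> n \<Longrightarrow> signed_minor n M l * y j = (\<Sum>i<n. z i * M i j)"
proof -
  let ?w = "\<lambda>j. if j = l then 1 else (0::'a)"
  let ?C = "bordered_adj n M ?w"
  define z where "z i = (\<Sum>k\<le>n. y k * ?C k i)" for i
  have "signed_minor n M l * y j = (\<Sum>i<n. z i * M i j)" if "j \<le> n" for j
  proof -
    have "(\<Sum>k\<le>n. y k * ((\<Sum>i<n. ?C k i * M i j) + ?C k n * ?w j)) =
        (\<Sum>k\<le>n. y k * (if k = j then det (bordered n M ?w) else 0))"
      by (intro sum.cong refl, subst bordered_adj_left) (use that in auto)
    also have "\<dots> = signed_minor n M l * y j"
      using that assms by (simp add: bordered_unit mult_if_left mult_if_right cong: if_cong)
    finally have 1: "(\<Sum>k\<le>n. y k * ((\<Sum>i<n. ?C k i * M i j) + ?C k n * ?w j)) = signed_minor n M l * y j" .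
    have "(\<Sum>k\<le>n. y k * (?C k n * ?w j)) = (\<Sum>k\<le>n. y k * signed_minor n M k) * ?w j"
      unfolding sum_distrib_right by (intro sum.cong refl) (simp add: bordered_adj_last)
    then have 2: "(\<Sum>k\<le>n. y k * (?C k n * ?w j)) = 0" by (simp add: orth)
    have 3: "(\<Sum>k\<le>n. y k * (\<Sum>i<n. ?C k i * M i j)) = (\<Sum>i<n. z i * M i j)"
      unfolding z_def by (rule sum_mult_sum_swap[symmetric])
    show ?thesis
      unfolding 1[symmetric] distrib_left sum.distrib 2 3 by (rule add_0_right)
  qed
  then show ?thesis by (rule that)
qed

lemma minor_annihilates_row_relations:
  fixes M :: "nat \<Rightarrow> nat \<Rightarrow> 'a::comm_ring_1"
  assumes rel: "\<And>j. j \<le> n \<Longrightarrow> (\<Sum>i<n. z i * M i j) = 0" and "l \<le> n" "m < n"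
  shows "signed_minor n M l * z m = 0"
proof -
  let ?w = "\<lambda>j. if j = l then 1 else (0::'a)"
  let ?C = "bordered_adj n M ?w"
  have "0 = (\<Sum>j\<le>n. (\<Sum>i<n. z i * M i j) * ?C j m)" using rel by simp
  also have "\<dots> = (\<Sum>i<n. z i * (\<Sum>j\<le>n. M i j * ?C j m))"
    by (rule sum_mult_sum_swap)
  also have "\<dots> = (\<Sum>i<n. z i * (if i = m then det (bordered n M ?w) else 0))"
    by (intro sum.cong refl, subst bordered_adj_right) (use assms in auto)
  also have "\<dots> = signed_minor n M l * z m"
    using assms by (simp add: bordered_unit mult_if_left mult_if_right cong: if_cong)
  finally show ?thesis by simp
qed

lemma minor_multiple_in_column_space:
  fixes M :: "nat \<Rightarrow> nat \<Rightarrow> 'a::comm_ring_1"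
  assumes "l \<le> n"
  obtains u where "\<And>i. i < n \<Longrightarrow> (\<Sum>j\<le>n. M i j * u j) = signed_minor n M l * v i"
proof -
  let ?w = "\<lambda>j. if j = l then 1 else (0::'a)"
  let ?C = "bordered_adj n M ?w"
  define u where "u j = (\<Sum>k<n. ?C j k * v k)" for j
  have "(\<Sum>j\<le>n. M i j * u j) = signed_minor n M l * v i" if "i < n" for i
  proof -
    have "(\<Sum>j\<le>n. M i j * u j) = (\<Sum>k<n. (\<Sum>j\<le>n. M i j * ?C j k) * v k)"
      unfolding u_def by (rule sum_mult_sum_swap[symmetric])
    also have "\<dots> = (\<Sum>k<n. (if i = k then det (bordered n M ?w) else 0) * v k)"
      by (intro sum.cong refl, subst bordered_adj_right) (use that in auto)
    also have "\<dots> = signed_minor n M l * v i"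
      using that assms by (simp add: bordered_unit mult_if_left mult_if_right cong: if_cong)
    finally show ?thesis .
  qed
  then show ?thesis by (rule that)
qed


section \<open>Perfection from maximal minors\<close>

lemma regular_pair_cancel:
  fixes f g :: "'a::idom"
  assumes "regular_sequence [f, g]" "x * g = y * f"
  obtains k where "x = k * f"
  using regular_sequence_secondD[OF assms(1), of x y] assms(2) by auto

lemma regular_pair_cancel_family:
  fixes f g :: "'a::idom"
  assumes "regular_sequence [f, g]" "\<And>i. i \<in> A \<Longrightarrow> x i * g = y i * f"
  shows "\<exists>k. \<forall>i\<in>A. x i = k i * f"
proof -
  have "\<exists>k. i \<in> A \<longrightarrow> x i = k * f" for i
    using regular_pair_cancel[OF assms(1), of "x i" "y i"] assms(2)[of i] by metis
  then show ?thesis by metis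
qed

text \<open>The elements \<open>f\<close> and \<open>g\<close> of the ideal multiply \<open>u\<close> into multiples \<open>a h\<close> and \<open>b h\<close> of \<open>h\<close>, so
  \<open>a g = b f\<close>, and regularity makes \<open>a\<close> divisible by \<open>f\<close>. Thus proportionality, a priori only over
  the fraction field, holds with a factor in the ring.\<close>

lemma proportional_imp_multiple:
  fixes f g :: "'a::idom"
  assumes "finite A" and reg: "regular_sequence [f, g]"
    and fg: "f \<in> ideal_gen (h ` A)" "g \<in> ideal_gen (h ` A)"
    and proportional: "\<And>k l. k \<in> A \<Longrightarrow> l \<in> A \<Longrightarrow> u l * h k = h l * u k"
  shows "\<exists>c. \<forall>k\<in>A. u k = c * h k"
proof -
  obtain p q where p: "f = (\<Sum>l\<in>A. p l * h l)" and q: "g = (\<Sum>l\<in>A. q l * h l)"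
    using fg unfolding ideal_gen_image[OF assms(1)] by auto
  define a b where "a = (\<Sum>l\<in>A. p l * u l)" and "b = (\<Sum>l\<in>A. q l * u l)"
  have comb: "(\<Sum>l\<in>A. r l * h l) * u k = (\<Sum>l\<in>A. r l * u l) * h k" if "k \<in> A" for r k
    unfolding sum_distrib_right mult.assoc using proportional[OF that] by (intro sum.cong refl) simp
  have fu: "f * u k = a * h k" and gu: "g * u k = b * h k" if "k \<in> A" for k
    using comb[OF that] by (simp_all add: p q a_def b_def)
  have f0: "f \<noteq> 0" using regular_sequence_firstD[OF reg] by simp
  have "\<exists>k\<in>A. h k \<noteq> 0"
  proof (rule ccontr)
    assume "\<not> (\<exists>k\<in>A. h k \<noteq> 0)"
    then have "f = 0" unfolding p by (intro sum.neutral) simp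
    then show False using f0 by simp
  qed
  then obtain k where k: "k \<in> A" "h k \<noteq> 0" by blast
  have "(a * g) * h k = g * (f * u k)" by (simp only: fu[OF k(1)] ac_simps)
  also have "\<dots> = (b * f) * h k" by (simp only: gu[OF k(1)] mult.left_commute[of g] ac_simps)
  finally have "a * g = b * f" using k(2) by simp
  then obtain c where c: "a = c * f" using regular_pair_cancel[OF reg] by metis
  have "u k = c * h k" if "k \<in> A" for k
  proof -
    have "f * u k = f * (c * h k)" using fu[OF that] by (simp only: c ac_simps)
    then show ?thesis using f0 by simp
  qed
  then show ?thesis by blast
qed

text \<open>The regular sequence \<open>f, g\<close> witnesses that the grade of the ideal is at least two. The condition on
  the first row serves for the opposite inequality: it prevents the first unit vector from being in
  the image of \<open>M\<close>.\<close>

locale minors_of_grade_two =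
  fixes n :: nat and M :: "nat \<Rightarrow> nat \<Rightarrow> 'a::idom" and I :: "'a set" and f g :: 'a
  assumes I_def: "I = ideal_gen (signed_minor n M ` {..n})"
    and regular: "regular_sequence [f, g]" and f_mem: "f \<in> I" and g_mem: "g \<in> I"
    and proper: "I \<noteq> UNIV"
    and n_pos: "0 < n" and row_proper: "ideal_gen (M 0 ` {..n}) \<noteq> UNIV"
begin

abbreviation "\<delta> \<equiv> signed_minor n M"

lemma mem_I: "x \<in> I \<longleftrightarrow> (\<exists>c. x = (\<Sum>j\<le>n. c j * \<delta> j))"
  unfolding I_def ideal_gen_image[OF finite_atMost] by blast

lemma subspace_I: "Modules.module.subspace (*) I"
  unfolding I_def ideal_gen_def by (rule Modules.module.subspace_span[OF module_ring])

lemma f_nonzero: "f \<noteq> 0"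
  using regular_sequence_firstD[OF regular] by simp

lemma kernel_of_matrix:
  assumes "\<And>i. i < n \<Longrightarrow> (\<Sum>j\<le>n. M i j * u j) = 0"
  obtains c where "\<And>j. j \<le> n \<Longrightarrow> u j = c * \<delta> j"
proof -
  have "\<exists>c. \<forall>k\<in>{..n}. u k = c * \<delta> k"
    by (rule proportional_imp_multiple[OF finite_atMost regular f_mem[unfolded I_def] g_mem[unfolded I_def]])
      (rule kernel_proportional_to_minors, use assms in auto)
  then show ?thesis using that by auto
qed

lemma row_relations_trivial:
  assumes "\<And>j. j \<le> n \<Longrightarrow> (\<Sum>i<n. z i * M i j) = 0" "m < n"
  shows "z m = 0"
proof -
  obtain p where p: "f = (\<Sum>l\<le>n. p l * \<delta> l)" using f_mem mem_I by auto
  have "f * z m = (\<Sum>l\<le>n. p l * (\<delta> l * z m))" unfolding p sum_distrib_right mult.assoc ..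
  also have "\<dots> = 0"
    using minor_annihilates_row_relations[OF assms(1) _ assms(2)] by (intro sum.neutral) auto
  finally show ?thesis using f_nonzero by simp
qed

lemma multiple_in_row_space:
  assumes "(\<Sum>j\<le>n. y j * \<delta> j) = 0" "x \<in> I"
  shows "\<exists>z. \<forall>j\<le>n. x * y j = (\<Sum>i<n. z i * M i j)"
proof -
  obtain p where p: "x = (\<Sum>l\<le>n. p l * \<delta> l)" using assms(2) mem_I by auto
  have "\<exists>z. l \<le> n \<longrightarrow> (\<forall>j\<le>n. \<delta> l * y j = (\<Sum>i<n. z i * M i j))" for l
    using minor_multiple_in_row_space[OF assms(1), of l] by metis
  then obtain Z where Z: "\<And>l j. l \<le> n \<Longrightarrow> j \<le> n \<Longrightarrow> \<delta> l * y j = (\<Sum>i<n. Z l i * M i j)" by metis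
  have "x * y j = (\<Sum>i<n. (\<Sum>l\<le>n. p l * Z l i) * M i j)" if "j \<le> n" for j
  proof -
    have "x * y j = (\<Sum>l\<le>n. p l * (\<delta> l * y j))" unfolding p sum_distrib_right mult.assoc ..
    also have "\<dots> = (\<Sum>l\<le>n. p l * (\<Sum>i<n. Z l i * M i j))" using Z that by (intro sum.cong refl) simp
    also have "\<dots> = (\<Sum>i<n. (\<Sum>l\<le>n. p l * Z l i) * M i j)" by (rule sum_mult_sum_swap[symmetric])
    finally show ?thesis .
  qed
  then show ?thesis by (intro exI[of _ "\<lambda>i. \<Sum>l\<le>n. p l * Z l i"]) simp
qed

text \<open>By Cramer's rule \<open>f y\<close> and \<open>g y\<close> are combinations of the rows of \<open>M\<close>, with coefficients \<open>z\<close> and \<open>w\<close>.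
  The rows are linearly independent, so \<open>g z = f w\<close>; hence \<open>f\<close> divides \<open>z\<close> and can be cancelled.\<close>

lemma syzygies_of_minors:
  assumes "(\<Sum>j\<le>n. y j * \<delta> j) = 0"
  shows "\<exists>z. \<forall>j\<le>n. y j = (\<Sum>i<n. z i * M i j)"
proof -
  obtain z where z: "\<And>j. j \<le> n \<Longrightarrow> f * y j = (\<Sum>i<n. z i * M i j)"
    using multiple_in_row_space[OF assms f_mem] by blast
  obtain w where w: "\<And>j. j \<le> n \<Longrightarrow> g * y j = (\<Sum>i<n. w i * M i j)"
    using multiple_in_row_space[OF assms g_mem] by blast
  have rel: "(\<Sum>i<n. (z i * g - w i * f) * M i j) = 0" if "j \<le> n" for j
  proof -
    have "(\<Sum>i<n. (z i * g - w i * f) * M i j) = g * (\<Sum>i<n. z i * M i j) - f * (\<Sum>i<n. w i * M i j)"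
      unfolding sum_distrib_left sum_subtractf[symmetric] by (intro sum.cong refl) (simp add: algebra_simps)
    also have "\<dots> = 0" unfolding z[OF that, symmetric] w[OF that, symmetric] by simp
    finally show ?thesis .
  qed
  have "z i * g - w i * f = 0" if "i < n" for i
    by (rule row_relations_trivial[where z = "\<lambda>i. z i * g - w i * f"]) (use rel that in auto)
  then have "\<exists>t. \<forall>i\<in>{..<n}. z i = t i * f"
    by (intro regular_pair_cancel_family[OF regular, where y = w]) simp
  then obtain t where t: "\<And>i. i < n \<Longrightarrow> z i = t i * f" by auto
  have "y j = (\<Sum>i<n. t i * M i j)" if "j \<le> n" for j
  proof -
    have "f * y j = f * (\<Sum>i<n. t i * M i j)"
      unfolding z[OF that] sum_distrib_left by (intro sum.cong refl) (simp add: t mult_ac)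
    then show ?thesis using f_nonzero by simp
  qed
  then show ?thesis by blast
qed

text \<open>This is the vanishing argument for \<open>Ext\<close> in elementary form. Let \<open>x, y, z\<close> be a regular sequence in
  the ideal and \<open>e\<close> the first unit vector. Cramer's rule solves \<open>M u = x e\<close>, \<open>M v = y e\<close>, \<open>M w = z e\<close>. The
  vectors \<open>y u - x v\<close> and so on are in the kernel of \<open>M\<close>, hence multiples \<open>c, c', c''\<close> of the vector of minors,
  and \<open>c z\<close> is a combination of \<open>x\<close> and \<open>y\<close>. Regularity of \<open>z\<close> and then of \<open>y\<close> shows that \<open>u\<close> is divisible by
  \<open>x\<close> modulo the kernel, so \<open>e\<close> itself is in the image of \<open>M\<close>, contrary to \<open>row_proper\<close>.\<close>

lemma grade_le_two:
  assumes "regular_sequence xs" "set xs \<subseteq> I"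
  shows "length xs \<le> 2"
proof (rule ccontr)
  assume "\<not> length xs \<le> 2"
  then have len: "2 < length xs" "1 < length xs" "0 < length xs" by auto
  define x y z where xyz: "x = xs ! 0" "y = xs ! 1" "z = xs ! 2"
  have mem: "x \<in> I" "y \<in> I" "z \<in> I" using assms(2) len nth_mem unfolding xyz by blast+
  have x0: "x \<noteq> 0" using regular_sequence_firstD[OF assms(1) len(3)] xyz by simp
  have second: "\<exists>k. r = k * x" if "r * y = s * x" for r s
    using regular_sequence_secondD[OF assms(1) len(2), of r s] that unfolding xyz by metis
  have third: "\<exists>k l. r = k * x + l * y" if "r * z = s * x + t * y" for r s t
    using regular_sequence_thirdD[OF assms(1) len(1), of r s t] that unfolding xyz by metis
  obtain l where l: "l \<le> n" "\<delta> l \<noteq> 0"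
  proof -
    obtain p where "f = (\<Sum>j\<le>n. p j * \<delta> j)" using f_mem mem_I by auto
    then show ?thesis using f_nonzero that by (metis (no_types, lifting) atMost_iff mult_zero_right sum.neutral)
  qed
  define e where "e i = (if i = 0 then 1 else 0 :: 'a)" for i :: nat
  have hit: "\<exists>u. \<forall>i<n. (\<Sum>j\<le>n. M i j * u j) = a * e i" if "a \<in> I" for a
  proof -
    obtain p where p: "a = (\<Sum>l\<le>n. p l * \<delta> l)" using \<open>a \<in> I\<close> mem_I by auto
    have "\<exists>u. l \<le> n \<longrightarrow> (\<forall>i<n. (\<Sum>j\<le>n. M i j * u j) = \<delta> l * e i)" for l
      using minor_multiple_in_column_space[of l n M e] by metis
    then obtain U where U: "\<And>l i. l \<le> n \<Longrightarrow> i < n \<Longrightarrow> (\<Sum>j\<le>n. M i j * U l j) = \<delta> l * e i" by metis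
    have "(\<Sum>j\<le>n. M i j * (\<Sum>l\<le>n. U l j * p l)) = a * e i" if "i < n" for i
    proof -
      have "(\<Sum>j\<le>n. M i j * (\<Sum>l\<le>n. U l j * p l)) = (\<Sum>l\<le>n. (\<Sum>j\<le>n. M i j * U l j) * p l)"
        by (rule sum_mult_sum_swap[symmetric])
      also have "\<dots> = (\<Sum>l\<le>n. p l * \<delta> l * e i)"
        using U that by (intro sum.cong refl) (simp add: mult_ac)
      also have "\<dots> = a * e i" unfolding p sum_distrib_right ..
      finally show ?thesis .
    qed
    then show ?thesis by (intro exI[of _ "\<lambda>j. \<Sum>l\<le>n. U l j * p l"]) blast
  qed
  obtain u where u: "\<And>i. i < n \<Longrightarrow> (\<Sum>j\<le>n. M i j * u j) = x * e i" using hit[OF mem(1)] by blast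
  obtain v where v: "\<And>i. i < n \<Longrightarrow> (\<Sum>j\<le>n. M i j * v j) = y * e i" using hit[OF mem(2)] by blast
  obtain w where w: "\<And>i. i < n \<Longrightarrow> (\<Sum>j\<le>n. M i j * w j) = z * e i" using hit[OF mem(3)] by blast
  have comm: "\<exists>c. \<forall>j\<le>n. b * s j - a * r j = c * \<delta> j"
    if s: "\<And>i. i < n \<Longrightarrow> (\<Sum>j\<le>n. M i j * s j) = a * e i" and r: "\<And>i. i < n \<Longrightarrow> (\<Sum>j\<le>n. M i j * r j) = b * e i"
    for a b s r
  proof -
    have "(\<Sum>j\<le>n. M i j * (b * s j - a * r j)) = 0" if "i < n" for i
    proof -
      have "(\<Sum>j\<le>n. M i j * (b * s j - a * r j)) = b * (\<Sum>j\<le>n. M i j * s j) - a * (\<Sum>j\<le>n. M i j * r j)"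
        unfolding sum_distrib_left sum_subtractf[symmetric] by (intro sum.cong refl) (simp add: algebra_simps)
      also have "\<dots> = 0" unfolding s[OF that] r[OF that] by simp
      finally show ?thesis .
    qed
    from kernel_of_matrix[OF this] show ?thesis by metis
  qed
  obtain c where c: "\<And>j. j \<le> n \<Longrightarrow> y * u j - x * v j = c * \<delta> j" using comm[OF u v] by blast
  obtain c' where c': "\<And>j. j \<le> n \<Longrightarrow> z * u j - x * w j = c' * \<delta> j" using comm[OF u w] by blast
  obtain c'' where c'': "\<And>j. j \<le> n \<Longrightarrow> z * v j - y * w j = c'' * \<delta> j" using comm[OF v w] by blast
  have "(c * z) * \<delta> l = (y * u l - x * v l) * z" using c[OF l(1)] by simp
  also have "\<dots> = y * (z * u l - x * w l) - x * (z * v l - y * w l)" by (simp add: algebra_simps)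
  also have "\<dots> = ((- c'') * x + c' * y) * \<delta> l" unfolding c'[OF l(1)] c''[OF l(1)] by (simp add: algebra_simps)
  finally have "c * z = (- c'') * x + c' * y" using l(2) by simp
  from third[OF this] obtain k m where km: "c = k * x + m * y" by blast
  have "\<exists>t. u j - m * \<delta> j = t * x" if "j \<le> n" for j
  proof (rule second)
    show "(u j - m * \<delta> j) * y = (v j + k * \<delta> j) * x"
      using c[OF that] unfolding km by (simp add: algebra_simps)
  qed
  then have "\<exists>t. j \<le> n \<longrightarrow> u j - m * \<delta> j = t * x" for j by blast
  then obtain t where t: "\<And>j. j \<le> n \<Longrightarrow> u j - m * \<delta> j = t j * x" by metis
  have "x * (\<Sum>j\<le>n. t j * M 0 j) = (\<Sum>j\<le>n. M 0 j * (u j - m * \<delta> j))"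
    unfolding sum_distrib_left using t by (intro sum.cong refl) (simp add: mult_ac)
  also have "\<dots> = (\<Sum>j\<le>n. M 0 j * u j) - m * (\<Sum>j\<le>n. M 0 j * \<delta> j)"
    unfolding sum_distrib_left sum_subtractf[symmetric] by (intro sum.cong refl) (simp add: algebra_simps)
  also have "\<dots> = x * 1" using u[OF n_pos] matrix_times_signed_minors[OF n_pos, of M] by (simp add: e_def)
  finally have "(\<Sum>j\<le>n. t j * M 0 j) = 1" using x0 by simp
  then have "1 \<in> ideal_gen (M 0 ` {..n})"
    unfolding ideal_gen_image[OF finite_atMost] by (metis (mono_tags, lifting) mem_Collect_eq)
  then have "r \<in> ideal_gen (M 0 ` {..n})" for r
    unfolding ideal_gen_def using Modules.module.span_scale[OF module_ring, of 1 _ r] by simp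
  then show False using row_proper by blast
qed

lemma grade_eq_two: "grade I = 2"
proof -
  have "grade I \<le> 2"
    unfolding grade_def by (rule SUP_least) (use grade_le_two in \<open>auto simp: numeral_eq_enat\<close>)
  moreover have "enat (length [f, g]) \<le> grade I"
    unfolding grade_def by (rule SUP_upper) (use regular f_mem g_mem in auto)
  ultimately show ?thesis by (simp add: numeral_eq_enat numeral_2_eq_2 antisym)
qed

end


section \<open>The resolution of a maximal minor ideal\<close>

definition coord_module :: "nat \<Rightarrow> (nat \<Rightarrow>\<^sub>0 'a::comm_ring_1) set" where
  "coord_module k = {x. \<forall>i\<ge>k. lookup x i = 0}"

definition tuple :: "nat \<Rightarrow> (nat \<Rightarrow> 'a::comm_ring_1) \<Rightarrow> (nat \<Rightarrow>\<^sub>0 'a)" where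
  "tuple k h = (\<Sum>i<k. single i (h i))"

lemma lookup_tuple: "lookup (tuple k h) i = (if i < k then h i else 0)"
  by (simp add: tuple_def lookup_sum lookup_single when_def)

lemma tuple_in_coord_module: "tuple k h \<in> coord_module k"
  by (simp add: coord_module_def lookup_tuple)

lemma coord_module_zero: "coord_module 0 = {0}"
  by (auto simp: coord_module_def intro: poly_mapping_eqI)

lemma coord_module_eqI:
  assumes "x \<in> coord_module k" "y \<in> coord_module k"
    "\<And>i. i < k \<Longrightarrow> lookup x i = lookup y i"
  shows "x = y"
proof (rule poly_mapping_eqI)
  show "lookup x i = lookup y i" for i
    using assms by (cases "i < k") (auto simp: coord_module_def)
qed

lemma subspace_lookup_zero:
  "Modules.module.subspace fscale {x :: nat \<Rightarrow>\<^sub>0 'a::comm_ring_1. \<forall>i. P i \<longrightarrow> lookup x i = 0}"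
  unfolding Modules.module.subspace_def[OF module_fscale]
  by (auto simp: lookup_add lookup_fscale)

lemma projective_coord_module: "projective_summand (coord_module k :: (nat \<Rightarrow>\<^sub>0 'a::comm_ring_1) set)"
proof -
  let ?Q = "{x :: nat \<Rightarrow>\<^sub>0 'a. \<forall>i. i < k \<longrightarrow> lookup x i = 0}"
  have "coord_module k \<inter> ?Q = {0}"
    by (auto simp: coord_module_def intro: poly_mapping_eqI) (metis leI lookup_zero poly_mapping_eqI)
  moreover have "x \<in> {p + q | p q. p \<in> coord_module k \<and> q \<in> ?Q}" for x :: "nat \<Rightarrow>\<^sub>0 'a"
  proof -
    let ?p = "tuple k (lookup x)"
    have "x - ?p \<in> ?Q" by (simp add: lookup_minus lookup_tuple)
    moreover have "x = ?p + (x - ?p)" by simp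
    ultimately show ?thesis using tuple_in_coord_module by blast
  qed
  ultimately show ?thesis
    unfolding projective_summand_def
    using subspace_lookup_zero[of "\<lambda>i. k \<le> i"] subspace_lookup_zero[of "\<lambda>i. i < k"]
    by (intro conjI exI[of _ ?Q]) (auto simp: coord_module_def)
qed

lemma linear_on_tuple:
  "linear_on P (\<lambda>x. tuple k (\<lambda>j. \<Sum>i\<in>A. lookup x i * h i j))"
  unfolding linear_on_def
  by (auto intro!: poly_mapping_eqI sum.cong
      simp: lookup_tuple lookup_add lookup_fscale distrib_right sum.distrib sum_distrib_left mult.assoc)

context minors_of_grade_two
begin

definition minor_modules :: "nat \<Rightarrow> (nat \<Rightarrow>\<^sub>0 'a) set" where
  "minor_modules k = coord_module (if k = 0 then 1 else if k = 1 then Suc n else if k = 2 then n else 0)"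

definition minor_maps :: "nat \<Rightarrow> (nat \<Rightarrow>\<^sub>0 'a) \<Rightarrow> (nat \<Rightarrow>\<^sub>0 'a)" where
  "minor_maps k x =
     (if k = 0 then tuple 1 (\<lambda>_. \<Sum>j\<le>n. lookup x j * \<delta> j)
      else if k = 1 then tuple (Suc n) (\<lambda>j. \<Sum>i<n. lookup x i * M i j)
      else 0)"

lemma minor_resolution_start:
  "minor_maps 0 ` minor_modules 1 = {x \<in> minor_modules 0. lookup x 0 \<in> I}" (is "?L = ?R")
proof
  show "?L \<subseteq> ?R"
    using mem_I by (auto simp: minor_maps_def minor_modules_def lookup_tuple coord_module_def)
  show "?R \<subseteq> ?L"
  proof
    fix x assume x: "x \<in> ?R"
    then obtain c where c: "lookup x 0 = (\<Sum>j\<le>n. c j * \<delta> j)" using mem_I by auto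
    have "x = minor_maps 0 (tuple (Suc n) c)"
      by (rule coord_module_eqI[of _ 1])
        (use x c in \<open>auto simp: minor_maps_def minor_modules_def tuple_in_coord_module lookup_tuple intro!: sum.cong\<close>)
    then show "x \<in> ?L" by (auto simp: minor_modules_def tuple_in_coord_module)
  qed
qed

lemma minor_resolution_middle:
  "minor_maps 1 ` minor_modules 2 = {x \<in> minor_modules 1. minor_maps 0 x = 0}" (is "?L = ?R")
proof
  show "?L \<subseteq> ?R"
  proof
    fix x assume "x \<in> ?L"
    then obtain z where x: "x = tuple (Suc n) (\<lambda>j. \<Sum>i<n. lookup z i * M i j)"
      by (auto simp: minor_maps_def)
    have "(\<Sum>j\<le>n. lookup x j * \<delta> j) = (\<Sum>j\<le>n. (\<Sum>i<n. lookup z i * M i j) * \<delta> j)"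
      by (intro sum.cong refl) (simp add: x lookup_tuple)
    also have "\<dots> = (\<Sum>i<n. lookup z i * (\<Sum>j\<le>n. M i j * \<delta> j))" by (rule sum_mult_sum_swap)
    also have "\<dots> = 0" by (intro sum.neutral ballI) (simp add: matrix_times_signed_minors)
    finally show "x \<in> ?R"
      by (auto simp: minor_maps_def minor_modules_def x tuple_in_coord_module lookup_tuple intro!: poly_mapping_eqI)
  qed
  show "?R \<subseteq> ?L"
  proof
    fix x assume x: "x \<in> ?R"
    then have "lookup (minor_maps 0 x) 0 = 0" by simp
    then have "(\<Sum>j\<le>n. lookup x j * \<delta> j) = 0" by (simp add: minor_maps_def lookup_tuple)
    then obtain z where z: "\<forall>j\<le>n. lookup x j = (\<Sum>i<n. z i * M i j)"
      using syzygies_of_minors by blast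
    have "x = minor_maps 1 (tuple n z)"
      by (rule coord_module_eqI[of _ "Suc n"])
        (use x z in \<open>auto simp: minor_maps_def minor_modules_def tuple_in_coord_module lookup_tuple less_Suc_eq_le\<close>)
    then show "x \<in> ?L" by (auto simp: minor_modules_def tuple_in_coord_module)
  qed
qed

lemma minor_resolution_end: "{x \<in> minor_modules 2. minor_maps 1 x = 0} = {0}"
proof (intro equalityI subsetI)
  fix x assume x: "x \<in> {x \<in> minor_modules 2. minor_maps 1 x = 0}"
  have "(\<Sum>i<n. lookup x i * M i j) = 0" if "j \<le> n" for j
  proof -
    have "lookup (minor_maps 1 x) j = 0" using x by simp
    then show ?thesis using that by (simp add: minor_maps_def lookup_tuple)
  qed
  then have "lookup x m = 0" if "m < n" for m
    using row_relations_trivial[of "lookup x"] that by blast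
  then have "x = 0"
    using x by (intro coord_module_eqI[of _ n]) (auto simp: minor_modules_def coord_module_def)
  then show "x \<in> {0}" by simp
qed (auto simp: minor_modules_def coord_module_def minor_maps_def lookup_tuple intro!: poly_mapping_eqI)

lemma minor_resolution: "quotient_resolution I 2 minor_modules minor_maps (\<lambda>x. lookup x 0)"
proof -
  have zero: "0 \<in> I" unfolding mem_I by (rule exI[of _ "\<lambda>_. 0"]) simp
  have lin: "linear_on P (minor_maps k)" for P k
  proof -
    consider "k = 0" | "k = 1" | "1 < k" by linarith
    then show ?thesis
    proof cases
      case 1
      then show ?thesis using linear_on_tuple[where A = "{..n}" and k = 1 and h = "\<lambda>j _. \<delta> j"] by (simp add: minor_maps_def[abs_def])
    next
      case 2
      then show ?thesis using linear_on_tuple[where A = "{..<n}" and k = "Suc n" and h = M] by (simp add: minor_maps_def[abs_def])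
    next
      case 3
      then show ?thesis by (auto simp: linear_on_def minor_maps_def intro!: poly_mapping_eqI simp: lookup_fscale)
    qed
  qed
  have exact: "minor_maps (Suc k) ` minor_modules (Suc (Suc k)) = {x \<in> minor_modules (Suc k). minor_maps k x = 0}" for k
  proof -
    consider "k = 0" | "k = 1" | m where "k = Suc (Suc m)" by (metis One_nat_def not0_implies_Suc)
    then show ?thesis
    proof cases
      case 1
      then show ?thesis using minor_resolution_middle by (simp add: numeral_2_eq_2)
    next
      case 2
      then show ?thesis using minor_resolution_end
        by (simp add: numeral_2_eq_2) (simp add: minor_modules_def minor_maps_def coord_module_zero)
    next
      case 3
      then show ?thesis by (auto simp: minor_modules_def minor_maps_def coord_module_zero)
    qed
  qed
  have onto: "\<exists>x\<in>minor_modules 0. lookup x 0 - r \<in> I" for r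
    by (rule bexI[of _ "tuple 1 (\<lambda>_. r)"]) (use zero in \<open>simp_all add: minor_modules_def tuple_in_coord_module lookup_tuple\<close>)
  have aug: "linear_on_mod I (minor_modules 0) (\<lambda>x. lookup x 0)"
    unfolding linear_on_mod_def by (simp add: lookup_add lookup_fscale zero)
  have proj: "projective_summand (minor_modules k)" for k
    unfolding minor_modules_def by (rule projective_coord_module)
  have triv: "minor_modules k = {0}" if "2 < k" for k
    using that by (simp add: minor_modules_def coord_module_zero)
  show ?thesis
    unfolding quotient_resolution_def
    using lin exact onto minor_resolution_start aug proj triv by (intro conjI allI impI) blast+
qed

text \<open>In a resolution of length at most one the map \<open>d 0\<close> is injective on \<open>P 1\<close>. For \<open>p\<close> in \<open>P 0\<close> both
  \<open>f p\<close> and \<open>g p\<close> are images, of \<open>u\<close> and \<open>v\<close> say, and then \<open>g u = f v\<close>. In the ambient free module \<open>u\<close> is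
  therefore divisible by \<open>f\<close>, and the quotient lies in \<open>P 1\<close> since \<open>P 1\<close> is a direct summand. So \<open>p\<close>
  is an image too, and the cokernel would be zero.\<close>

lemma resolution_length_ge_two:
  assumes res: "quotient_resolution I m P d e"
  shows "2 \<le> m"
proof (rule ccontr)
  assume "\<not> 2 \<le> m"
  then have P2: "P 2 = {0}" using res unfolding quotient_resolution_def by simp
  have lin: "linear_on (P 1) (d 0)" "linear_on (P 2) (d 1)" and mod: "linear_on_mod I (P 0) e"
    and onto: "\<forall>r. \<exists>x\<in>P 0. e x - r \<in> I"
    and im: "d 0 ` P 1 = {x \<in> P 0. e x \<in> I}"
    and ex: "d 1 ` P 2 = {x \<in> P 1. d 0 x = 0}"
    and proj: "projective_summand (P 0)" "projective_summand (P 1)"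
    using res unfolding quotient_resolution_def by (auto simp: numeral_2_eq_2)
  have "d 1 0 = d 1 0 + d 1 0" using lin(2) P2 unfolding linear_on_def by (metis add.right_neutral insertI1)
  then have "d 1 0 = 0" by (simp only: add_cancel_right_right)
  then have inj: "x = 0" if "x \<in> P 1" "d 0 x = 0" for x using ex P2 that by auto
  obtain Q where Q: "Modules.module.subspace fscale Q" "P 1 \<inter> Q = {0}" "{p + q | p q. p \<in> P 1 \<and> q \<in> Q} = UNIV"
    and sub1: "Modules.module.subspace fscale (P 1)"
    using proj(2) unfolding projective_summand_def by blast
  have sub0: "Modules.module.subspace fscale (P 0)" using proj(1) unfolding projective_summand_def by blast
  note closed = Modules.module.subspace_scale[OF module_fscale] Modules.module.subspace_diff[OF module_fscale]
    Modules.module.subspace_add[OF module_fscale]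
  have d_scale: "d 0 (fscale c x) = fscale c (d 0 x)" if "x \<in> P 1" for c x
    using lin(1) that unfolding linear_on_def by blast
  have d_diff: "d 0 (x - y) = d 0 x - d 0 y" if "x \<in> P 1" "y \<in> P 1" for x y
  proof -
    have "d 0 ((x - y) + y) = d 0 (x - y) + d 0 y"
      using lin(1) that closed(2)[OF sub1] unfolding linear_on_def by blast
    then show ?thesis by simp
  qed
  have killed: "\<exists>u\<in>P 1. d 0 u = fscale a p" if "a \<in> I" "p \<in> P 0" for a p
  proof -
    have "e (fscale a p) - a * e p \<in> I" using mod that(2) unfolding linear_on_mod_def by blast
    moreover have "a * e p \<in> I"
      using Modules.module.subspace_scale[OF module_ring subspace_I that(1), of "e p"] by (simp add: mult.commute)
    ultimately have "e (fscale a p) \<in> I"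
      using Modules.module.subspace_add[OF module_ring subspace_I] by (metis diff_add_cancel)
    then have "fscale a p \<in> d 0 ` P 1" using im closed(1)[OF sub0 that(2)] by simp
    then show ?thesis by auto
  qed
  have "e p \<in> I" if p: "p \<in> P 0" for p
  proof -
    obtain u where u: "u \<in> P 1" "d 0 u = fscale f p" using killed[OF f_mem p] by blast
    obtain v where v: "v \<in> P 1" "d 0 v = fscale g p" using killed[OF g_mem p] by blast
    have gu: "fscale g u \<in> P 1" and fv: "fscale f v \<in> P 1" using u v closed(1)[OF sub1] by auto
    have "d 0 (fscale g u - fscale f v) = fscale g (fscale f p) - fscale f (fscale g p)"
      by (simp only: d_diff[OF gu fv] d_scale[OF u(1)] d_scale[OF v(1)] u(2) v(2))
    also have "\<dots> = 0" by (rule poly_mapping_eqI) (simp add: lookup_minus lookup_fscale)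
    finally have "fscale g u - fscale f v = 0" using inj closed(2)[OF sub1 gu fv] by blast
    then have gufv: "fscale g u = fscale f v" by simp
    have "\<exists>t. \<forall>i\<in>UNIV. lookup u i = t i * f"
    proof (rule regular_pair_cancel_family[OF regular, where y = "lookup v"])
      fix i
      have "lookup (fscale g u) i = lookup (fscale f v) i" by (simp only: gufv)
      then show "lookup u i * g = lookup v i * f" by (simp add: lookup_fscale mult.commute)
    qed
    then obtain t where t: "\<And>i. lookup u i = t i * f" by auto
    have "finite {i. t i \<noteq> 0}"
      by (rule finite_subset[OF _ finite_lookup[of u]]) (use f_nonzero in \<open>auto simp: t\<close>)
    then have lt: "lookup (Abs_poly_mapping t) = t" by simp
    define s where "s = Abs_poly_mapping t"
    have us: "u = fscale f s" by (rule poly_mapping_eqI) (simp add: s_def lt t lookup_fscale)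
    obtain a q where aq: "s = a + q" "a \<in> P 1" "q \<in> Q" using Q(3) by blast
    have "fscale f q = u - fscale f a" by (rule poly_mapping_eqI) (simp add: us aq lookup_minus lookup_fscale lookup_add algebra_simps)
    then have "fscale f q \<in> P 1" using closed(2)[OF sub1 u(1) closed(1)[OF sub1 aq(2)]] by simp
    then have "fscale f q = 0" using closed(1)[OF Q(1) aq(3)] Q(2) by blast
    then have "lookup (fscale f q) i = 0" for i by simp
    then have "q = 0" using f_nonzero by (intro poly_mapping_eqI) (simp add: lookup_fscale)
    then have "fscale f p = fscale f (d 0 a)" using us u(2) aq d_scale by simp
    then have eq: "lookup (fscale f p) i = lookup (fscale f (d 0 a)) i" for i by simp
    have "p = d 0 a" using eq f_nonzero by (intro poly_mapping_eqI) (simp add: lookup_fscale)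
    then show "e p \<in> I" using im aq(2) by blast
  qed
  then have "r \<in> I" for r
  proof -
    obtain x where x: "x \<in> P 0" "e x - r \<in> I" using onto by blast
    then have "e x \<in> I" using \<open>\<And>p. p \<in> P 0 \<Longrightarrow> e p \<in> I\<close> by blast
    then have "e x - (e x - r) \<in> I" using Modules.module.subspace_diff[OF module_ring subspace_I] x(2) by blast
    then show ?thesis by simp
  qed
  then show False using proper by blast
qed

theorem perfect: "perfect_ideal I"
proof -
  have "projective_dimension_quotient I \<le> enat 2"
    unfolding projective_dimension_quotient_def using minor_resolution by (intro INF_lower) blast
  moreover have "enat 2 \<le> projective_dimension_quotient I"
    unfolding projective_dimension_quotient_def by (rule INF_greatest) (use resolution_length_ge_two in auto)
  ultimately show ?thesis
    unfolding perfect_ideal_def grade_eq_two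
    using subspace_I proper by (simp add: numeral_eq_enat antisym)
qed

end


section \<open>Derivations and homomorphisms of polynomial rings\<close>

lemma poly_mapping_sum_singles: "p = (\<Sum>m\<in>keys p. single m (lookup p m))"
  by (rule poly_mapping_eqI) (auto simp: lookup_sum lookup_single when_def in_keys_iff)

lemma poly_mapping_single_induct [case_names single add]:
  fixes p :: "'k \<Rightarrow>\<^sub>0 'a::comm_monoid_add"
  assumes single: "\<And>m c. P (single m c)" and add: "\<And>p q. P p \<Longrightarrow> P q \<Longrightarrow> P (p + q)"
  shows "P p"
proof -
  have "P (\<Sum>m\<in>A. single m (h m))" if "finite A" for A :: "'k set" and h :: "'k \<Rightarrow> 'a"
    using that
  proof induction
    case empty
    then show ?case using single[of _ 0] by simp
  next
    case (insert x F)
    then show ?case by (simp add: single add)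
  qed
  from this[OF finite_keys] show ?thesis by (subst poly_mapping_sum_singles)
qed

lemma mpoly_induct [case_names const var add mult]:
  fixes p :: "('v, 'a::comm_semiring_1) mpoly"
  assumes const: "\<And>c. P (mconst c)" and var: "\<And>v. P (mvar v)"
    and add: "\<And>p q. P p \<Longrightarrow> P q \<Longrightarrow> P (p + q)" and mult: "\<And>p q. P p \<Longrightarrow> P q \<Longrightarrow> P (p * q)"
  shows "P p"
proof -
  have "P (single m c)" for m :: "'v \<Rightarrow>\<^sub>0 nat" and c
  proof (induction m arbitrary: c rule: poly_mapping_single_induct)
    case (single v k)
    show ?case
    proof (induction k)
      case 0
      then show ?case using const by (simp add: mconst_def)
    next
      case (Suc k)
      have "single (single v (Suc k)) c = single (single v k) c * mvar v"
        by (simp add: mvar_def mult_single single_add[symmetric])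
      then show ?case using mult[OF Suc var] by simp
    qed
  next
    case (add m m')
    have "single (m + m') c = single m c * single m' 1"
      by (simp add: mult_single)
    then show ?case using mult[OF add] by simp
  qed
  then show ?thesis using add by (induction p rule: poly_mapping_single_induct) auto
qed

lemma mconst_add: "mconst (a + b) = mconst a + mconst b"
  by (simp add: mconst_def single_add)

lemma mconst_mult: "mconst (a * b) = (mconst a * mconst b :: ('v, 'a::comm_semiring_1) mpoly)"
  by (simp add: mconst_def mult_single)

lemma mconst_0 [simp]: "mconst 0 = 0"
  by (simp add: mconst_def)

lemma mconst_1 [simp]: "mconst 1 = (1 :: ('v, 'a::comm_semiring_1) mpoly)"
  by (simp add: mconst_def)

lemma mconst_of_nat [simp]: "mconst (of_nat n) = (of_nat n :: ('v, 'a::comm_semiring_1) mpoly)"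
  by (simp add: mconst_def)

lemma mconst_numeral [simp]: "mconst (numeral n) = (numeral n :: ('v, 'a::comm_semiring_1) mpoly)"
  by (simp add: mconst_def)

lemma mconst_uminus: "mconst (- a) = (- mconst a :: ('v, 'a::comm_ring_1) mpoly)"
  by (simp add: mconst_def single_uminus)

lemma mconst_diff: "mconst (a - b) = (mconst a - mconst b :: ('v, 'a::comm_ring_1) mpoly)"
  by (simp add: mconst_def single_diff)

lemma mconst_power: "mconst (a ^ n) = (mconst a ^ n :: ('v, 'a::comm_semiring_1) mpoly)"
  by (induction n) (simp_all add: mconst_mult)

lemma mconst_sum: "mconst (sum h A) = (\<Sum>a\<in>A. mconst (h a) :: ('v, 'a::comm_semiring_1) mpoly)"
  by (induction A rule: infinite_finite_induct) (simp_all add: mconst_add)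

lemma mconst_eq_iff [simp]: "mconst a = mconst b \<longleftrightarrow> a = b"
  unfolding mconst_def by (metis lookup_single_eq)

definition derivation :: "('a::comm_ring_1 \<Rightarrow> 'a) \<Rightarrow> bool" where
  "derivation D \<longleftrightarrow> (\<forall>x y. D (x + y) = D x + D y) \<and> (\<forall>x y. D (x * y) = D x * y + x * D y)"

context
  fixes D :: "'a::comm_ring_1 \<Rightarrow> 'a"
  assumes D: "derivation D"
begin

lemma derivation_add: "D (x + y) = D x + D y"
  using D by (simp add: derivation_def)

lemma derivation_mult: "D (x * y) = D x * y + x * D y"
  using D by (simp add: derivation_def)

lemma derivation_0: "D 0 = 0"
  using derivation_add[of 0 0] by simp

lemma derivation_1: "D 1 = 0"
  using derivation_mult[of 1 1] by simp

lemma derivation_uminus: "D (- x) = - D x"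
  using derivation_add[of x "- x"] derivation_0 by (simp add: eq_neg_iff_add_eq_0 add.commute)

lemma derivation_diff: "D (x - y) = D x - D y"
  using derivation_add[of x "- y"] derivation_uminus by simp

lemma derivation_sum: "D (sum h A) = (\<Sum>a\<in>A. D (h a))"
  by (induction A rule: infinite_finite_induct) (simp_all add: derivation_0 derivation_add)

lemma derivation_of_nat: "D (of_nat n) = 0"
  by (induction n) (simp_all add: derivation_0 derivation_add derivation_1)

lemma derivation_numeral: "D (numeral n) = 0"
  using derivation_of_nat[of "numeral n"] by simp

lemma derivation_power: "D (x ^ n) = of_nat n * x ^ (n - 1) * D x"
proof (induction n)
  case (Suc n)
  then show ?case by (cases n) (simp_all add: derivation_mult derivation_1 algebra_simps)
qed (simp add: derivation_1)

lemma derivation_scaled: "derivation (\<lambda>x. c * D x)"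
  by (simp add: derivation_def derivation_add derivation_mult algebra_simps)

end

lemmas derivation_simps = derivation_add derivation_mult derivation_0 derivation_1 derivation_uminus
  derivation_diff derivation_of_nat derivation_numeral derivation_power

lemma derivation_sum_of:
  assumes "\<And>i. i \<in> A \<Longrightarrow> derivation (D i)"
  shows "derivation (\<lambda>x. \<Sum>i\<in>A. c i * D i x)"
  unfolding derivation_def
proof (intro conjI allI)
  fix x y
  show "(\<Sum>i\<in>A. c i * D i (x + y)) = (\<Sum>i\<in>A. c i * D i x) + (\<Sum>i\<in>A. c i * D i y)"
    by (simp add: sum.distrib[symmetric] derivation_add[OF assms] algebra_simps cong: sum.cong)
  show "(\<Sum>i\<in>A. c i * D i (x * y)) = (\<Sum>i\<in>A. c i * D i x) * y + x * (\<Sum>i\<in>A. c i * D i y)"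
    by (simp add: sum.distrib[symmetric] sum_distrib_left sum_distrib_right derivation_mult[OF assms] algebra_simps cong: sum.cong)
qed

lemma derivation_diff_of: "derivation D \<Longrightarrow> derivation D' \<Longrightarrow> derivation (\<lambda>x. D x - D' x)"
  by (simp add: derivation_def algebra_simps)

lemma derivation_commutator: "derivation D \<Longrightarrow> derivation D' \<Longrightarrow> derivation (\<lambda>x. D (D' x) - D' (D x))"
  by (simp add: derivation_def algebra_simps)

lemma derivation_eqI:
  fixes D D' :: "('v, 'a::comm_ring_1) mpoly \<Rightarrow> ('v, 'a) mpoly"
  assumes "derivation D" "derivation D'" "\<And>c. D (mconst c) = D' (mconst c)" "\<And>v. D (mvar v) = D' (mvar v)"
  shows "D p = D' p"
  by (induction p rule: mpoly_induct) (simp_all add: assms derivation_add derivation_mult)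

lemma lookup_mpderiv:
  "lookup (mpderiv v p) m =
     of_nat (Suc (lookup m v)) * lookup p (m + single v 1)"
proof -
  let ?e = "single v (1::nat)"
  let ?t = "\<lambda>k. of_nat (lookup k v) * lookup p k"
  have iff: "k - ?e = m \<longleftrightarrow> k = m + ?e" if "lookup k v \<noteq> 0" for k
    using that by (auto simp: poly_mapping_eq_iff fun_eq_iff lookup_minus lookup_add lookup_single when_def)
  have "lookup (mpderiv v p) m = (\<Sum>k\<in>keys p. ?t k when k - ?e = m)"
    by (simp add: mpderiv_def lookup_sum lookup_single)
  also have "\<dots> = (\<Sum>k\<in>keys p. if k = m + ?e then ?t k else 0)"
  proof (intro sum.cong refl)
    fix k
    show "(?t k when k - ?e = m) = (if k = m + ?e then ?t k else 0)"
    proof (cases "lookup k v = 0")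
      case True
      then have t: "?t k = 0" by simp
      show ?thesis unfolding when_def t by simp
    next
      case False
      then show ?thesis unfolding when_def iff[OF False] by simp
    qed
  qed
  also have "\<dots> = ?t (m + ?e)"
    by (simp add: in_keys_iff)
  finally show ?thesis by (simp add: lookup_add)
qed

lemma mpderiv_single:
  "mpderiv v (single m c) =
     single (m - single v 1) (of_nat (lookup m v) * c)"
  by (cases "c = 0") (simp_all add: mpderiv_def)

lemma mpderiv_add: "mpderiv v (p + q) = mpderiv v p + mpderiv v q"
  by (rule poly_mapping_eqI) (simp add: lookup_mpderiv lookup_add algebra_simps)

lemma mpderiv_mult: "mpderiv v (p * q) = mpderiv v p * q + p * mpderiv v q"
proof (induction p rule: poly_mapping_single_induct)
  case (single a x)
  show ?case
  proof (induction q rule: poly_mapping_single_induct)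
    case (single b y)
    let ?e = "single v (1::nat)"
    have sub: "(k + l) - ?e = (k - ?e) + l" if "lookup k v \<noteq> 0" for k l
      using that by (auto simp: poly_mapping_eq_iff fun_eq_iff lookup_minus lookup_add lookup_single when_def)
    consider "lookup a v = 0" | "lookup b v = 0" |
      "lookup a v \<noteq> 0" "lookup b v \<noteq> 0" by blast
    then show ?case
      using sub[of a b] sub[of b a]
      by cases (simp_all add: mult_single mpderiv_single lookup_add single_add[symmetric] algebra_simps,
          (cases "lookup b v = 0"; simp), (cases "lookup a v = 0"; simp))
  next
    case (add p q)
    then show ?case by (simp add: mpderiv_add algebra_simps)
  qed
next
  case (add p q)
  then show ?case by (simp add: mpderiv_add algebra_simps)
qed

lemma derivation_mpderiv: "derivation (mpderiv v)"
  by (simp add: derivation_def mpderiv_add mpderiv_mult)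

lemma mpderiv_mconst [simp]: "mpderiv v (mconst c) = 0"
  by (simp add: mconst_def mpderiv_single)

lemma mpderiv_mvar: "mpderiv v (mvar w) = (if v = w then 1 else 0)"
  by (simp add: mvar_def mpderiv_single lookup_single when_def)

text \<open>The extension of the homomorphism \<open>\<phi>\<close> of the coefficient rings that sends the variable \<open>v\<close> to \<open>x v\<close>.\<close>

definition msubst :: "('a::comm_ring_1 \<Rightarrow> 'b::comm_ring_1) \<Rightarrow> ('v::finite \<Rightarrow> 'b) \<Rightarrow> ('v, 'a) mpoly \<Rightarrow> 'b" where
  "msubst \<phi> x p = (\<Sum>m\<in>keys p. \<phi> (lookup p m) * (\<Prod>v\<in>UNIV. x v ^ lookup m v))"

lemma msubst_superset:
  assumes "comm_ring_hom \<phi>" "finite A" "keys p \<subseteq> A"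
  shows "msubst \<phi> x p = (\<Sum>m\<in>A. \<phi> (lookup p m) * (\<Prod>v\<in>UNIV. x v ^ lookup m v))"
proof -
  interpret comm_ring_hom \<phi> by fact
  show ?thesis
    unfolding msubst_def by (intro sum.mono_neutral_left assms) (auto simp: in_keys_iff)
qed

lemma comm_ring_hom_msubst:
  assumes "comm_ring_hom \<phi>"
  shows "comm_ring_hom (msubst \<phi> x)"
proof -
  interpret comm_ring_hom \<phi> by fact
  have add: "msubst \<phi> x (p + q) = msubst \<phi> x p + msubst \<phi> x q" for p q
  proof -
    let ?A = "keys p \<union> keys q"
    have "keys (p + q) \<subseteq> ?A" by (rule keys_add)
    then show ?thesis
      using msubst_superset[OF assms, of ?A] by (simp add: lookup_add hom_add distrib_right sum.distrib)
  qed
  have single: "msubst \<phi> x (single m c) = \<phi> c * (\<Prod>v\<in>UNIV. x v ^ lookup m v)" for m c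
    using msubst_superset[OF assms, of "{m}" "single m c" x] by simp
  have mult: "msubst \<phi> x (p * q) = msubst \<phi> x p * msubst \<phi> x q" for p q
  proof (induction p rule: poly_mapping_single_induct)
    case (single a c)
    show ?case
    proof (induction q rule: poly_mapping_single_induct)
      case (single b d)
      show ?case by (simp add: mult_single \<open>\<And>m c. msubst \<phi> x (single m c) = _ m c\<close> hom_mult lookup_add power_add prod.distrib mult_ac)
    next
      case (add p q)
      then show ?case by (simp add: \<open>\<And>p q. msubst \<phi> x (p + q) = _ p q\<close> algebra_simps)
    qed
  next
    case (add p q)
    then show ?case by (simp add: \<open>\<And>p q. msubst \<phi> x (p + q) = _ p q\<close> algebra_simps)
  qed
  have "msubst \<phi> x 1 = 1" using single[of 0 1] by simp
  moreover have "msubst \<phi> x 0 = 0" by (simp add: msubst_def)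
  ultimately show ?thesis by unfold_locales (simp_all add: add mult)
qed

lemma msubst_mconst: "comm_ring_hom \<phi> \<Longrightarrow> msubst \<phi> x (mconst c) = \<phi> c"
  using msubst_superset[of \<phi> "{0}" "mconst c" x] by (simp add: mconst_def)

lemma msubst_mvar: 
  assumes "comm_ring_hom \<phi>"
  shows "msubst \<phi> x (mvar v) = x v"
proof -
  interpret comm_ring_hom \<phi> by fact
  have "(\<Prod>w\<in>UNIV. x w ^ lookup (single v 1) w) = (\<Prod>w\<in>UNIV. if w = v then x w else 1)"
    by (intro prod.cong refl) (simp add: lookup_single when_def)
  then show ?thesis
    using msubst_superset[OF assms, of "{single v 1}" "mvar v" x] by (simp add: mvar_def)
qed

lemma lookup_map: "T 0 = 0 \<Longrightarrow> lookup (Poly_Mapping.map T p) m = T (lookup p m)"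
  by (simp add: map.rep_eq when_def)

lemma map_poly_mapping_add:
  assumes "\<And>a b. T (a + b) = T a + T b" and "T (0::'a::comm_ring_1) = (0::'b::comm_ring_1)"
  shows "Poly_Mapping.map T (p + q) = Poly_Mapping.map T p + Poly_Mapping.map T q"
  by (rule poly_mapping_eqI) (simp add: lookup_map[where T = T, OF assms(2)] lookup_add assms)

lemma derivation_map:
  fixes D :: "'a::comm_ring_1 \<Rightarrow> 'a"
  assumes "derivation D"
  shows "derivation (Poly_Mapping.map D :: ('v, 'a) mpoly \<Rightarrow> ('v, 'a) mpoly)"
proof -
  note D = derivation_simps[OF assms]
  note add = map_poly_mapping_add[of D, OF D(1,3)]
  have "Poly_Mapping.map D (p * q) = Poly_Mapping.map D p * q + p * Poly_Mapping.map D q" for p q :: "('v, 'a) mpoly"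
  proof (induction p rule: poly_mapping_single_induct)
    case (single a x)
    show ?case
      by (induction q rule: poly_mapping_single_induct)
        (simp_all add: mult_single D single_add add distrib_left algebra_simps)
  qed (simp add: add algebra_simps)
  then show ?thesis unfolding derivation_def using add by blast
qed

lemma mpderiv_map:
  assumes "\<And>a b. T (a + b) = T a + T b" and "T (0::'a::comm_ring_1) = (0::'b::comm_ring_1)"
  shows "mpderiv v (Poly_Mapping.map T p) = Poly_Mapping.map T (mpderiv v p)"
proof -
  have "T (of_nat k * a) = of_nat k * T a" for k a
    by (induction k) (simp_all add: assms distrib_right)
  then show ?thesis
    by (intro poly_mapping_eqI) (simp add: lookup_mpderiv lookup_map[where T = T, OF assms(2)] del: of_nat_Suc)
qed

lemma mpderiv_commute: "mpderiv v (mpderiv w p) = mpderiv w (mpderiv v p)"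
  for p :: "('v, 'a::comm_ring_1) mpoly"
proof -
  have "derivation (\<lambda>p. mpderiv v (mpderiv w p) - mpderiv w (mpderiv v p) :: ('v, 'a) mpoly)"
    by (intro derivation_commutator derivation_mpderiv)
  then have "mpderiv v (mpderiv w p) - mpderiv w (mpderiv v p) = 0"
    by (rule derivation_eqI[where D' = "\<lambda>_. 0"])
      (auto simp: derivation_def mpderiv_mvar derivation_0[OF derivation_mpderiv] derivation_1[OF derivation_mpderiv])
  then show ?thesis by simp
qed


section \<open>Binary forms and their coefficients\<close>

definition bform :: "nat \<Rightarrow> (nat \<Rightarrow> R) \<Rightarrow> form" where
  "bform n u = (\<Sum>k\<le>n. mconst (u k) * x1 ^ (n - k) * x2 ^ k)"

text \<open>With binomial factors in the coefficients both derivatives become shifts of the coefficient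
  sequence, up to a factor that depends on the order only.\<close>

definition nform :: "nat \<Rightarrow> (nat \<Rightarrow> R) \<Rightarrow> form" where
  "nform n c = bform n (\<lambda>k. of_nat (n choose k) * c k)"

definition bmono :: "nat \<Rightarrow> nat \<Rightarrow> 2 \<Rightarrow>\<^sub>0 nat" where
  "bmono i j = single 0 i + single 1 j"

lemma bmono_eq_iff: "bmono i j = bmono i' j' \<longleftrightarrow> i = i' \<and> j = j'"
proof
  assume "bmono i j = bmono i' j'"
  then have "lookup (bmono i j) v = lookup (bmono i' j') v" for v by simp
  from this[of 0] this[of 1] show "i = i' \<and> j = j'"
    by (simp add: bmono_def lookup_add lookup_single when_def)
qed simp

lemma mvar_power: "mvar v ^ i = (single (single v i) 1 :: ('v, 'a::comm_semiring_1) mpoly)"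
  by (induction i) (simp_all add: mvar_def mult_single single_add[symmetric])

lemma form_monomial: "mconst a * x1 ^ i * x2 ^ j = (single (bmono i j) a :: form)"
  by (simp add: mconst_def x1_def x2_def mvar_power mult_single bmono_def)

lemma lookup_bform:
  "lookup (bform n u) m = (\<Sum>k\<le>n. if m = bmono (n - k) k then u k else 0)"
  unfolding bform_def form_monomial lookup_sum lookup_single when_def by (intro sum.cong refl) auto

lemma lookup_bform_bmono: "k \<le> n \<Longrightarrow> lookup (bform n u) (bmono (n - k) k) = u k"
proof -
  assume "k \<le> n"
  then have "(\<Sum>j\<le>n. if bmono (n - k) k = bmono (n - j) j then u j else 0) = (\<Sum>j\<le>n. if j = k then u j else 0)"
    by (intro sum.cong refl) (auto simp: bmono_eq_iff)
  then show ?thesis using \<open>k \<le> n\<close> by (simp add: lookup_bform)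
qed

lemma bform_eqD: "bform n u = bform n v \<Longrightarrow> k \<le> n \<Longrightarrow> u k = v k"
  by (metis lookup_bform_bmono)

lemma nform_eqD:
  assumes "nform n c = nform n d" "k \<le> n"
  shows "c k = d k"
  using bform_eqD[OF assms[unfolded nform_def]] assms(2) by simp

lemma bform_cong: "(\<And>k. k \<le> n \<Longrightarrow> u k = v k) \<Longrightarrow> bform n u = bform n v"
  unfolding bform_def by (intro sum.cong refl) simp

lemma nform_cong: "(\<And>k. k \<le> n \<Longrightarrow> c k = d k) \<Longrightarrow> nform n c = nform n d"
  unfolding nform_def by (rule bform_cong) simp

lemma bform_add: "bform n u + bform n v = bform n (\<lambda>k. u k + v k)"
  by (simp add: bform_def sum.distrib[symmetric] mconst_add algebra_simps)

lemma bform_diff: "bform n u - bform n v = bform n (\<lambda>k. u k - v k)"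
  by (simp add: bform_def sum_subtractf[symmetric] mconst_diff algebra_simps)

lemma bform_mconst_mult: "mconst a * bform n u = bform n (\<lambda>k. a * u k)"
  by (simp add: bform_def sum_distrib_left mconst_mult algebra_simps)

lemma bform_sum: "finite A \<Longrightarrow> (\<Sum>i\<in>A. bform n (u i)) = bform n (\<lambda>k. \<Sum>i\<in>A. u i k)"
  by (induction A rule: finite_induct) (simp_all add: bform_add, simp add: bform_def)

lemma nform_add: "nform n c + nform n d = nform n (\<lambda>k. c k + d k)"
  by (simp add: nform_def bform_add algebra_simps)

lemma nform_diff: "nform n c - nform n d = nform n (\<lambda>k. c k - d k)"
  by (simp add: nform_def bform_diff algebra_simps)

lemma nform_mconst_mult: "mconst a * nform n c = nform n (\<lambda>k. a * c k)"
  by (simp add: nform_def bform_mconst_mult algebra_simps)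

lemma bform_mult:
  "bform m u * bform n v =
     bform (m + n) (\<lambda>k. \<Sum>i\<le>m. if i \<le> k \<and> k - i \<le> n then u i * v (k - i) else 0)"
proof -
  let ?g = "\<lambda>i k. mconst (u i * v (k - i)) * x1 ^ (m + n - k) * x2 ^ k"
  have "bform (m + n) (\<lambda>k. \<Sum>i\<le>m. if i \<le> k \<and> k - i \<le> n then u i * v (k - i) else 0) =
      (\<Sum>k\<le>m + n. \<Sum>i\<le>m. if i \<le> k \<and> k - i \<le> n then ?g i k else 0)"
    unfolding bform_def mconst_sum sum_distrib_right by (intro sum.cong refl) auto
  also have "\<dots> = (\<Sum>i\<le>m. \<Sum>k\<le>m + n. if i \<le> k \<and> k - i \<le> n then ?g i k else 0)"
    by (rule sum.swap)
  also have "\<dots> = (\<Sum>i\<le>m. \<Sum>j\<le>n. ?g i (i + j))"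
  proof (rule sum.cong[OF refl])
    fix i assume "i \<in> {..m}"
    then have "(\<Sum>k\<le>m + n. if i \<le> k \<and> k - i \<le> n then ?g i k else 0) = (\<Sum>k\<in>{i..i + n}. ?g i k)"
      by (subst sum.inter_filter[symmetric]) (auto intro!: sum.cong)
    also have "\<dots> = (\<Sum>j\<le>n. ?g i (i + j))"
      using sum.shift_bounds_cl_nat_ivl[of "?g i" 0 i n] by (simp add: atMost_atLeast0 add.commute)
    finally show "(\<Sum>k\<le>m + n. if i \<le> k \<and> k - i \<le> n then ?g i k else 0) = (\<Sum>j\<le>n. ?g i (i + j))" .
  qed
  also have "\<dots> = bform m u * bform n v"
    unfolding bform_def sum_product
  proof (rule sum.cong[OF refl], rule sum.cong[OF refl])
    fix i j assume "i \<in> {..m}" "j \<in> {..n}"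
    then have "m + n - (i + j) = (m - i) + (n - j)" by simp
    then show "?g i (i + j) = mconst (u i) * x1 ^ (m - i) * x2 ^ i * (mconst (v j) * x1 ^ (n - j) * x2 ^ j)"
      by (simp add: power_add mconst_mult algebra_simps)
  qed
  finally show ?thesis by simp
qed

lemma derivation_D1: "derivation D1" and derivation_D2: "derivation D2"
  by (simp_all add: D1_def D2_def derivation_mpderiv)

lemma D_simps: "D1 x1 = 1" "D1 x2 = 0" "D2 x1 = 0" "D2 x2 = 1" "D1 (mconst a) = 0" "D2 (mconst a) = 0"
  by (simp_all add: D1_def D2_def x1_def x2_def mpderiv_mvar)

lemma D1_D2: "D1 (D2 A) = D2 (D1 A)"
  unfolding D1_def D2_def by (rule mpderiv_commute)

lemma D1_mconst_mult: "D1 (mconst a * A) = mconst a * D1 A"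
  and D2_mconst_mult: "D2 (mconst a * A) = mconst a * D2 A"
  by (simp_all add: derivation_mult[OF derivation_D1] derivation_mult[OF derivation_D2] D_simps)

lemma D1_bform: "D1 (bform (Suc n) u) = bform n (\<lambda>k. of_nat (Suc n - k) * u k)"
proof -
  have "D1 (bform (Suc n) u) = (\<Sum>k\<le>Suc n. mconst (u k) * (of_nat (Suc n - k) * x1 ^ (Suc n - k - 1)) * x2 ^ k)"
    unfolding bform_def derivation_sum[OF derivation_D1]
    by (intro sum.cong refl) (simp add: derivation_simps[OF derivation_D1] D_simps)
  also have "\<dots> = bform n (\<lambda>k. of_nat (Suc n - k) * u k)"
    by (simp add: bform_def mconst_mult Suc_diff_le mult_ac cong: sum.cong)
  finally show ?thesis .
qed

lemma D2_bform: "D2 (bform (Suc n) u) = bform n (\<lambda>k. of_nat (Suc k) * u (Suc k))"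
proof -
  have "D2 (bform (Suc n) u) = (\<Sum>k\<le>Suc n. mconst (u k) * x1 ^ (Suc n - k) * (of_nat k * x2 ^ (k - 1)))"
    unfolding bform_def derivation_sum[OF derivation_D2]
    by (intro sum.cong refl) (simp add: derivation_simps[OF derivation_D2] D_simps)
  also have "\<dots> = bform n (\<lambda>k. of_nat (Suc k) * u (Suc k))"
    unfolding sum.atMost_Suc_shift by (simp add: bform_def mconst_mult mult_ac del: of_nat_Suc)
  finally show ?thesis .
qed

lemma scalar_of_nat: "scalar (of_nat k) = of_nat k" and scalar_mult: "scalar (a * b) = scalar a * scalar b"
  and scalar_1: "scalar 1 = 1"
  by (simp_all add: scalar_def mconst_mult)

lemma D1_nform: "D1 (nform (Suc n) c) = of_nat (Suc n) * nform n c"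
proof -
  have "of_nat (Suc n - k) * (of_nat (Suc n choose k) * c k) = of_nat (Suc n) * (of_nat (n choose k) * c k)"
    if "k \<le> n" for k
    unfolding mult.assoc[symmetric] of_nat_mult[symmetric] using binomial_absorb_comp[of "Suc n" k] by simp
  then show ?thesis
    unfolding nform_def D1_bform mconst_of_nat[symmetric] bform_mconst_mult by (intro bform_cong) (simp del: of_nat_Suc)
qed

lemma D2_nform: "D2 (nform (Suc n) c) = of_nat (Suc n) * nform n (\<lambda>k. c (Suc k))"
proof -
  have "of_nat (Suc k) * (of_nat (Suc n choose Suc k) * c (Suc k)) = of_nat (Suc n) * (of_nat (n choose k) * c (Suc k))" for k
    unfolding mult.assoc[symmetric] of_nat_mult[symmetric] Suc_times_binomial ..
  then show ?thesis
    unfolding nform_def D2_bform mconst_of_nat[symmetric] bform_mconst_mult by (intro bform_cong) (simp del: of_nat_Suc)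
qed

lemma D1_scalar_mult: "D1 (scalar a * A) = scalar a * D1 A"
  and D2_scalar_mult: "D2 (scalar a * A) = scalar a * D2 A"
  by (simp_all add: scalar_def D1_mconst_mult D2_mconst_mult)

lemma D2_power_nform: "(D2 ^^ b) (nform (b + m) c) = scalar (fact (b + m) / fact m) * nform m (\<lambda>k. c (k + b))"
proof (induction b arbitrary: c m)
  case 0
  then show ?case by (simp add: scalar_1)
next
  case (Suc b)
  have "(D2 ^^ Suc b) (nform (Suc b + m) c) = D2 ((D2 ^^ b) (nform (b + Suc m) c))" by simp
  also have "\<dots> = scalar (fact (b + Suc m) / fact (Suc m)) * (of_nat (Suc m) * nform m (\<lambda>k. c (Suc k + b)))"
    by (simp only: Suc D2_scalar_mult D2_nform)
  also have "\<dots> = scalar (fact (b + Suc m) / fact (Suc m) * of_nat (Suc m)) * nform m (\<lambda>k. c (k + Suc b))"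
    by (simp only: scalar_mult scalar_of_nat mult.assoc add_Suc_right add_Suc)
  also have "fact (b + Suc m) / fact (Suc m) * of_nat (Suc m) = (fact (Suc b + m) / fact m :: complex)"
    by (simp add: field_simps del: of_nat_Suc)
  finally show ?case .
qed

lemma D1_power_scalar_mult: "(D1 ^^ a) (scalar s * A) = scalar s * (D1 ^^ a) A"
  by (induction a) (simp_all add: D1_scalar_mult)

lemma D1_power_nform: "(D1 ^^ a) (nform (a + m) c) = scalar (fact (a + m) / fact m) * nform m c"
proof (induction a arbitrary: m)
  case 0
  then show ?case by (simp add: scalar_1)
next
  case (Suc a)
  have "(D1 ^^ Suc a) (nform (Suc a + m) c) = D1 ((D1 ^^ a) (nform (a + Suc m) c))" by simp
  also have "\<dots> = scalar (fact (a + Suc m) / fact (Suc m)) * (of_nat (Suc m) * nform m c)"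
    by (simp only: Suc D1_scalar_mult D1_nform)
  also have "\<dots> = scalar (fact (a + Suc m) / fact (Suc m) * of_nat (Suc m)) * nform m c"
    by (simp only: scalar_mult scalar_of_nat mult.assoc)
  also have "fact (a + Suc m) / fact (Suc m) * of_nat (Suc m) = (fact (Suc a + m) / fact m :: complex)"
    by (simp add: field_simps del: of_nat_Suc)
  finally show ?case .
qed

lemma mixed_derivative_nform:
  assumes "a + b \<le> n"
  shows "(D1 ^^ a) ((D2 ^^ b) (nform n c)) = scalar (fact n / fact (n - (a + b))) * nform (n - (a + b)) (\<lambda>k. c (k + b))"
proof -
  obtain m where n: "n = b + (a + m)" using assms by (metis add.assoc add.commute le_Suc_ex)
  have "(D1 ^^ a) ((D2 ^^ b) (nform n c)) =
      scalar (fact n / fact (a + m)) * (scalar (fact (a + m) / fact m) * nform m (\<lambda>k. c (k + b)))"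
    unfolding n D2_power_nform D1_power_scalar_mult D1_power_nform ..
  also have "\<dots> = scalar (fact n / fact (a + m) * (fact (a + m) / fact m)) * nform m (\<lambda>k. c (k + b))"
    unfolding scalar_mult mult.assoc ..
  finally show ?thesis by (simp add: n)
qed

lemma transvectant_nform:
  assumes "r \<le> m" "r \<le> n"
  shows "transvectant m n r (nform m c) (nform n d) =
    (\<Sum>i\<le>r. (- 1) ^ i * of_nat (r choose i) * nform (m - r) (\<lambda>k. c (k + i)) * nform (n - r) (\<lambda>k. d (k + (r - i))))"
proof -
  let ?s = "fact (m - r) * fact (n - r) / (fact m * fact n) :: complex"
  have "transvectant m n r (nform m c) (nform n d) = (\<Sum>i\<le>r. scalar ?s * ((- 1) ^ i * of_nat (r choose i) *
      (D1 ^^ (r - i)) ((D2 ^^ i) (nform m c)) * (D1 ^^ i) ((D2 ^^ (r - i)) (nform n d))))"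
    using assms by (simp add: transvectant_def sum_distrib_left atMost_atLeast0)
  also have "\<dots> = (\<Sum>i\<le>r. (- 1) ^ i * of_nat (r choose i) * nform (m - r) (\<lambda>k. c (k + i)) * nform (n - r) (\<lambda>k. d (k + (r - i))))"
  proof (intro sum.cong refl)
    fix i assume "i \<in> {..r}"
    then have i: "r - i + i = r" "i + (r - i) = r" by auto
    let ?A = "nform (m - r) (\<lambda>k. c (k + i))" and ?B = "nform (n - r) (\<lambda>k. d (k + (r - i)))"
    have 1: "(D1 ^^ (r - i)) ((D2 ^^ i) (nform m c)) = scalar (fact m / fact (m - r)) * ?A"
      using mixed_derivative_nform[of "r - i" i m c] assms i by simp
    have 2: "(D1 ^^ i) ((D2 ^^ (r - i)) (nform n d)) = scalar (fact n / fact (n - r)) * ?B"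
      using mixed_derivative_nform[of i "r - i" n d] assms i by simp
    have "scalar ?s * ((- 1) ^ i * of_nat (r choose i) * (scalar (fact m / fact (m - r)) * ?A) * (scalar (fact n / fact (n - r)) * ?B)) =
        scalar (?s * (fact m / fact (m - r)) * (fact n / fact (n - r))) * ((- 1) ^ i * of_nat (r choose i) * ?A * ?B)"
      unfolding scalar_mult by (simp only: mult_ac)
    also have "?s * (fact m / fact (m - r)) * (fact n / fact (n - r)) = 1" by simp
    finally show "scalar ?s * ((- 1) ^ i * of_nat (r choose i) *
      (D1 ^^ (r - i)) ((D2 ^^ i) (nform m c)) * (D1 ^^ i) ((D2 ^^ (r - i)) (nform n d))) =
      (- 1) ^ i * of_nat (r choose i) * ?A * ?B"
      unfolding 1 2 by (simp add: scalar_1)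
  qed
  finally show ?thesis .
qed


section \<open>Equivariance of transvectants\<close>

text \<open>Cayley's Omega process: up to a constant it is the transvectant. Invariance, which is opaque in the
  closed formula, is an induction over this recursion.\<close>

fun omega :: "nat \<Rightarrow> form \<Rightarrow> form \<Rightarrow> form" where
  "omega 0 A B = A * B"
| "omega (Suc r) A B = omega r (D1 A) (D2 B) - omega r (D2 A) (D1 B)"

lemma alternating_binomial_sum_Suc:
  fixes g :: "nat \<Rightarrow> 'a::comm_ring_1"
  shows "(\<Sum>i\<le>Suc r. (- 1) ^ i * of_nat (Suc r choose i) * g i) =
    (\<Sum>i\<le>r. (- 1) ^ i * of_nat (r choose i) * (g i - g (Suc i)))"
proof -
  have "(\<Sum>i\<le>r. (- 1) ^ i * of_nat (r choose i) * g i) = (\<Sum>i\<le>Suc r. (- 1) ^ i * of_nat (r choose i) * g i)"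
    by (simp add: binomial_eq_0)
  also have "\<dots> = g 0 + (\<Sum>i\<le>r. (- 1) ^ Suc i * of_nat (r choose Suc i) * g (Suc i))"
    unfolding sum.atMost_Suc_shift by simp
  finally have 1: "(\<Sum>i\<le>r. (- 1) ^ i * of_nat (r choose i) * g i) =
    g 0 + (\<Sum>i\<le>r. (- 1) ^ Suc i * of_nat (r choose Suc i) * g (Suc i))" .
  have "(\<Sum>i\<le>Suc r. (- 1) ^ i * of_nat (Suc r choose i) * g i) =
      g 0 + (\<Sum>i\<le>r. (- 1) ^ Suc i * of_nat (Suc r choose Suc i) * g (Suc i))"
    unfolding sum.atMost_Suc_shift by simp
  also have "\<dots> = g 0 + (\<Sum>i\<le>r. (- 1) ^ Suc i * of_nat (r choose Suc i) * g (Suc i)) -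
      (\<Sum>i\<le>r. (- 1) ^ i * of_nat (r choose i) * g (Suc i))"
    unfolding add_diff_eq[symmetric] sum_subtractf[symmetric]
    by (intro arg_cong2[of _ _ _ _ "(+)"] refl sum.cong) (simp add: algebra_simps)
  also have "\<dots> = (\<Sum>i\<le>r. (- 1) ^ i * of_nat (r choose i) * (g i - g (Suc i)))"
    unfolding 1[symmetric] sum_subtractf[symmetric] by (simp only: right_diff_distrib)
  finally show ?thesis .
qed

lemma omega_eq_sum:
  "omega r A B = (\<Sum>i\<le>r. (- 1) ^ i * of_nat (r choose i) *
     ((D1 ^^ (r - i)) ((D2 ^^ i) A) * (D1 ^^ i) ((D2 ^^ (r - i)) B)))"
proof (induction r arbitrary: A B)
  case (Suc r)
  define g where "g i = (D1 ^^ (Suc r - i)) ((D2 ^^ i) A) * (D1 ^^ i) ((D2 ^^ (Suc r - i)) B)" for i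
  have D2p: "(D2 ^^ i) (D1 C) = D1 ((D2 ^^ i) C)" for i C
    by (induction i) (simp_all add: D1_D2)
  have g1: "(D1 ^^ (r - i)) ((D2 ^^ i) (D1 A)) * (D1 ^^ i) ((D2 ^^ (r - i)) (D2 B)) = g i"
    and g2: "(D1 ^^ (r - i)) ((D2 ^^ i) (D2 A)) * (D1 ^^ i) ((D2 ^^ (r - i)) (D1 B)) = g (Suc i)" if "i \<le> r" for i
    using that by (simp_all add: g_def D2p Suc_diff_le funpow_swap1[of D1] funpow_swap1[of D2] del: funpow.simps(2))
      (simp_all add: funpow_Suc_right del: funpow.simps(2))
  have "omega (Suc r) A B = (\<Sum>i\<le>r. (- 1) ^ i * of_nat (r choose i) * (g i - g (Suc i)))"
    unfolding omega.simps Suc.IH sum_subtractf[symmetric] right_diff_distrib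
    by (intro sum.cong refl) (simp add: g1 g2)
  also have "\<dots> = (\<Sum>i\<le>Suc r. (- 1) ^ i * of_nat (Suc r choose i) * g i)"
    by (rule alternating_binomial_sum_Suc[symmetric])
  finally show ?case unfolding g_def .
qed simp

lemma transvectant_omega:
  "r \<le> m \<Longrightarrow> r \<le> n \<Longrightarrow>
   transvectant m n r A B = scalar (fact (m - r) * fact (n - r) / (fact m * fact n)) * omega r A B"
  by (simp add: transvectant_def omega_eq_sum atMost_atLeast0 mult.assoc)

lemma omega_add_left: "omega r (A + A') B = omega r A B + omega r A' B"
  by (induction r arbitrary: A A' B)
    (simp_all add: derivation_add[OF derivation_D1] derivation_add[OF derivation_D2] algebra_simps)

lemma omega_add_right: "omega r A (B + B') = omega r A B + omega r A B'"
  by (induction r arbitrary: A B B')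
    (simp_all add: derivation_add[OF derivation_D1] derivation_add[OF derivation_D2] algebra_simps)

lemma D1_of_nat_mult: "D1 (of_nat k * A) = of_nat k * D1 A"
  and D2_of_nat_mult: "D2 (of_nat k * A) = of_nat k * D2 A"
  by (simp_all add: derivation_simps[OF derivation_D1] derivation_simps[OF derivation_D2])

lemma omega_of_nat_left: "omega r (of_nat k * A) B = of_nat k * omega r A B"
  by (induction r arbitrary: A B) (simp_all add: D1_of_nat_mult D2_of_nat_mult right_diff_distrib)

lemma omega_of_nat_right: "omega r A (of_nat k * B) = of_nat k * omega r A B"
  by (induction r arbitrary: A B) (simp_all add: D1_of_nat_mult D2_of_nat_mult right_diff_distrib)

text \<open>The error terms cancel in \<open>D1 A * D2 B - D2 A * D1 B\<close>. The numbers \<open>e\<close> and \<open>f\<close> allow for the two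
  nilpotent generators of \<open>sl\<^sub>2\<close>, with \<open>(e, f)\<close> equal to \<open>(0, 1)\<close> and \<open>(1, 0)\<close>, and for derivations of the
  coefficients alone, with \<open>(0, 0)\<close>.\<close>

lemma derivation_omega:
  assumes T: "derivation T"
    and T1: "\<And>A. T (D1 A) = D1 (T A) + of_nat e * D2 A"
    and T2: "\<And>A. T (D2 A) = D2 (T A) + of_nat f * D1 A"
  shows "T (omega r A B) = omega r (T A) B + omega r A (T B)"
proof (induction r arbitrary: A B)
  case 0
  then show ?case by (simp add: derivation_mult[OF T])
next
  case (Suc r)
  show ?case
    unfolding omega.simps derivation_diff[OF T] Suc.IH T1 T2 omega_add_left omega_add_right
      omega_of_nat_left omega_of_nat_right
    by (simp add: algebra_simps)
qed

definition scalar_derivation :: "(form \<Rightarrow> form) \<Rightarrow> nat \<Rightarrow> nat \<Rightarrow> bool" where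
  "scalar_derivation T e f \<longleftrightarrow> derivation T \<and> (\<forall>c. T (scalar c) = 0) \<and>
     (\<forall>A. T (D1 A) = D1 (T A) + of_nat e * D2 A) \<and> (\<forall>A. T (D2 A) = D2 (T A) + of_nat f * D1 A)"

lemma derivation_transvectant:
  assumes "scalar_derivation T e f"
  shows "T (transvectant m n r A B) = transvectant m n r (T A) B + transvectant m n r A (T B)"
proof -
  have T: "derivation T" "\<And>c. T (scalar c) = 0" "\<And>A. T (D1 A) = D1 (T A) + of_nat e * D2 A"
    "\<And>A. T (D2 A) = D2 (T A) + of_nat f * D1 A"
    using assms by (auto simp: scalar_derivation_def)
  show ?thesis
  proof (cases "r \<le> m \<and> r \<le> n")
    case True
    then show ?thesis
      by (simp add: transvectant_omega derivation_mult[OF T(1)] T(2) derivation_omega[OF T(1,3,4)] distrib_left)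
  next
    case False
    then show ?thesis by (auto simp: transvectant_def derivation_0[OF T(1)])
  qed
qed

lemma transvectant_of_nat_left: "transvectant m n r (of_nat k * A) B = of_nat k * transvectant m n r A B"
  by (cases "r \<le> m \<and> r \<le> n") (auto simp: transvectant_omega omega_of_nat_left, auto simp: transvectant_def)

lemma transvectant_of_nat_right: "transvectant m n r A (of_nat k * B) = of_nat k * transvectant m n r A B"
  by (cases "r \<le> m \<and> r \<le> n") (auto simp: transvectant_omega omega_of_nat_right, auto simp: transvectant_def)

lemma transvectant_zero: "transvectant m n r 0 B = 0" "transvectant m n r A 0 = 0"
  using transvectant_of_nat_left[of m n r 0 0 B] transvectant_of_nat_right[of m n r A 0 0] by simp_all


section \<open>Polarizations\<close>

definition coef :: "nat \<Rightarrow> R" where "coef k = mvar (of_nat k)"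

text \<open>The vector field with components \<open>c\<close>. The choice \<open>c = coef\<close> is the Euler field, whose eigenvalues
  are the degrees.\<close>

definition polar :: "(nat \<Rightarrow> R) \<Rightarrow> R \<Rightarrow> R" where
  "polar c p = (\<Sum>k\<le>5. c k * mpderiv (of_nat k) p)"

lemma index_cases: "\<exists>k\<le>5. (v::6) = of_nat k"
proof -
  obtain z where z: "v = of_int z" "0 \<le> z" "z < 6" by (cases v rule: bit0_cases) simp
  then show ?thesis by (intro exI[of _ "nat z"]) auto
qed

lemma of_nat_index_eq_iff: "j \<le> 5 \<Longrightarrow> k \<le> 5 \<Longrightarrow> (of_nat j :: 6) = of_nat k \<longleftrightarrow> j = k"
proof -
  assume "j \<le> 5" "k \<le> 5"
  then have "j \<in> {0, 1, 2, 3, 4, 5}" "k \<in> {0, 1, 2, 3, 4, 5}" by auto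
  then show ?thesis by auto
qed

lemma derivation_polar: "derivation (polar c)"
  unfolding polar_def by (intro derivation_sum_of derivation_mpderiv)

lemma polar_mconst [simp]: "polar c (mconst a) = 0"
  by (simp add: polar_def)

lemma polar_coef: "k \<le> 5 \<Longrightarrow> polar c (coef k) = c k"
proof -
  assume k: "k \<le> 5"
  have "polar c (coef k) = (\<Sum>j\<le>5. if j = k then c j else 0)"
    unfolding polar_def coef_def by (intro sum.cong refl) (simp add: mpderiv_mvar of_nat_index_eq_iff k)
  then show ?thesis using k by simp
qed

lemma derivation_R_eqI:
  fixes D D' :: "R \<Rightarrow> R"
  assumes "derivation D" "derivation D'" "\<And>c. D (mconst c) = D' (mconst c)" "\<And>k. k \<le> 5 \<Longrightarrow> D (coef k) = D' (coef k)"
  shows "D p = D' p"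
  by (rule derivation_eqI[OF assms(1-3)]) (metis assms(4) coef_def index_cases)

lemma map_bform:
  assumes "derivation T"
  shows "Poly_Mapping.map T (bform n u) = bform n (\<lambda>k. T (u k))"
  by (rule poly_mapping_eqI)
    (simp add: lookup_map[where T = T, OF derivation_0[OF assms]] lookup_bform derivation_sum[OF assms] if_distrib[of T]
      derivation_0[OF assms] cong: if_cong)

lemma map_nform:
  assumes "derivation T"
  shows "Poly_Mapping.map T (nform n c) = nform n (\<lambda>k. T (c k))"
  by (simp add: nform_def map_bform[OF assms] derivation_mult[OF assms] derivation_of_nat[OF assms])

lemma x2_bform: "x2 * bform n u = bform (Suc n) (\<lambda>k. if k = 0 then 0 else u (k - 1))"
  unfolding bform_def sum.atMost_Suc_shift by (simp add: sum_distrib_left mult_ac)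

lemma x1_bform: "x1 * bform n u = bform (Suc n) (\<lambda>k. if k = Suc n then 0 else u k)"
  unfolding bform_def by (simp add: sum_distrib_left mult_ac Suc_diff_le)

lemma of_nat_mult_nform: "of_nat a * nform n c = nform n (\<lambda>k. of_nat a * c k)"
  using nform_mconst_mult[of "of_nat a" n c] by simp

lemma x2_D1_nform: "x2 * D1 (nform n c) = nform n (\<lambda>k. of_nat k * c (k - 1))"
proof (cases n)
  case 0
  then show ?thesis by (simp add: nform_def bform_def D_simps derivation_0[OF derivation_D1])
next
  case (Suc m)
  have eq: "of_nat (m choose (k - 1)) * (of_nat (Suc m) * c (k - 1)) = of_nat (Suc m choose k) * (of_nat k * c (k - 1))" if k: "k \<noteq> 0" for k
  proof -
    have "(m choose (k - 1)) * Suc m = (Suc m choose k) * k"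
      using Suc_times_binomial_eq[of m "k - 1"] k by (simp add: mult.commute)
    then have "of_nat (m choose (k - 1)) * of_nat (Suc m) = (of_nat (Suc m choose k) * of_nat k :: R)"
      unfolding of_nat_mult[symmetric] by simp
    then show ?thesis by (simp only: mult.assoc[symmetric])
  qed
  show ?thesis
    unfolding Suc D1_nform of_nat_mult_nform unfolding nform_def x2_bform
  proof (rule bform_cong)
    fix k
    show "(if k = 0 then 0 else of_nat (m choose (k - 1)) * (of_nat (Suc m) * c (k - 1))) =
        of_nat (Suc m choose k) * (of_nat k * c (k - 1))"
      by (cases "k = 0") (simp, subst eq[symmetric], simp_all)
  qed
qed

lemma x1_D2_nform: "x1 * D2 (nform n c) = nform n (\<lambda>k. of_nat (n - k) * c (Suc k))"
proof (cases n)
  case 0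
  then show ?thesis by (simp add: nform_def bform_def D_simps derivation_0[OF derivation_D1])
next
  case (Suc m)
  have eq: "of_nat (m choose k) * (of_nat (Suc m) * c (Suc k)) = of_nat (Suc m choose k) * (of_nat (Suc m - k) * c (Suc k))" for k
  proof -
    have "(m choose k) * Suc m = (Suc m choose k) * (Suc m - k)"
      using binomial_absorb_comp[of "Suc m" k] by (simp add: mult.commute)
    then have "of_nat (m choose k) * of_nat (Suc m) = (of_nat (Suc m choose k) * of_nat (Suc m - k) :: R)"
      unfolding of_nat_mult[symmetric] by simp
    then show ?thesis by (simp only: mult.assoc[symmetric])
  qed
  show ?thesis
    unfolding Suc D2_nform of_nat_mult_nform unfolding nform_def x1_bform by (intro bform_cong) (simp add: eq del: of_nat_Suc)
qed

text \<open>The two nilpotent generators of \<open>sl\<^sub>2\<close>, as vector fields on the space of quintics.\<close>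

definition lowering :: "nat \<Rightarrow> R" where "lowering k = of_nat k * coef (k - 1)"

definition raising :: "nat \<Rightarrow> R" where "raising k = of_nat (5 - k) * coef (Suc k)"

text \<open>The action of the generators on forms with coefficients in \<open>R\<close>, on the coefficients and on the
  variables at the same time. It kills the quintic, and covariants are the forms that it kills.\<close>

definition lower :: "form \<Rightarrow> form" where "lower A = Poly_Mapping.map (polar lowering) A - x2 * D1 A"

definition raise :: "form \<Rightarrow> form" where "raise A = Poly_Mapping.map (polar raising) A - x1 * D2 A"

lemma D_scalar: "D1 (scalar c) = 0" "D2 (scalar c) = 0"
  by (simp_all add: scalar_def D_simps)

lemma map_polar_scalar: "Poly_Mapping.map (polar c) (scalar a) = 0"
  by (rule poly_mapping_eqI)
    (simp add: lookup_map[where T = "polar c", OF derivation_0[OF derivation_polar]] scalar_def mconst_def[of "mconst a"] lookup_single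
      when_def derivation_0[OF derivation_polar])

lemma D_map_polar: "D1 (Poly_Mapping.map (polar c) A) = Poly_Mapping.map (polar c) (D1 A)"
  "D2 (Poly_Mapping.map (polar c) A) = Poly_Mapping.map (polar c) (D2 A)"
  unfolding D1_def D2_def by (rule mpderiv_map; simp add: derivation_simps[OF derivation_polar])+

lemma scalar_derivation_map: "scalar_derivation (Poly_Mapping.map (polar c)) 0 0"
  unfolding scalar_derivation_def by (simp add: derivation_map derivation_polar map_polar_scalar D_map_polar)

lemma scalar_derivation_lower: "scalar_derivation lower 0 1"
  unfolding scalar_derivation_def lower_def
  by (auto intro!: derivation_diff_of derivation_map derivation_polar derivation_scaled derivation_D1
      simp: map_polar_scalar D_scalar D_simps D_map_polar D1_D2 derivation_simps[OF derivation_D1] derivation_simps[OF derivation_D2])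

lemma scalar_derivation_raise: "scalar_derivation raise 1 0"
  unfolding scalar_derivation_def raise_def
  by (auto intro!: derivation_diff_of derivation_map derivation_polar derivation_scaled derivation_D2
      simp: map_polar_scalar D_scalar D_simps D_map_polar D1_D2 derivation_simps[OF derivation_D1] derivation_simps[OF derivation_D2])

definition covariant :: "form \<Rightarrow> bool" where "covariant A \<longleftrightarrow> lower A = 0 \<and> raise A = 0"

definition form_degree :: "nat \<Rightarrow> form \<Rightarrow> bool" where
  "form_degree d A \<longleftrightarrow> Poly_Mapping.map (polar coef) A = of_nat d * A"

lemma derivation_lower: "derivation lower" and derivation_raise: "derivation raise"
  using scalar_derivation_lower scalar_derivation_raise by (simp_all add: scalar_derivation_def)

lemma covariant_transvectant: "covariant A \<Longrightarrow> covariant B \<Longrightarrow> covariant (transvectant m n r A B)"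
  by (simp add: covariant_def derivation_transvectant[OF scalar_derivation_lower]
      derivation_transvectant[OF scalar_derivation_raise] transvectant_zero)

lemma covariant_mult: "covariant A \<Longrightarrow> covariant B \<Longrightarrow> covariant (A * B)"
  by (simp add: covariant_def derivation_mult[OF derivation_lower] derivation_mult[OF derivation_raise])

lemma covariant_diff: "covariant A \<Longrightarrow> covariant B \<Longrightarrow> covariant (A - B)"
  by (simp add: covariant_def derivation_diff[OF derivation_lower] derivation_diff[OF derivation_raise])

lemma covariant_scalar: "covariant (scalar c)"
  using scalar_derivation_lower scalar_derivation_raise by (simp add: covariant_def scalar_derivation_def)

lemma covariant_power: "covariant A \<Longrightarrow> covariant (A ^ n)"
  using covariant_scalar[of 1] by (induction n) (simp_all add: covariant_mult scalar_1)

lemma form_degree_transvectant: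
  "form_degree d A \<Longrightarrow> form_degree e B \<Longrightarrow> form_degree (d + e) (transvectant m n r A B)"
  by (simp add: form_degree_def derivation_transvectant[OF scalar_derivation_map] transvectant_of_nat_left transvectant_of_nat_right distrib_right)

lemma form_degree_mult: "form_degree d A \<Longrightarrow> form_degree e B \<Longrightarrow> form_degree (d + e) (A * B)"
  by (simp add: form_degree_def derivation_mult[OF derivation_map[OF derivation_polar]] algebra_simps)

lemma form_degree_diff: "form_degree d A \<Longrightarrow> form_degree d B \<Longrightarrow> form_degree d (A - B)"
  by (simp add: form_degree_def derivation_diff[OF derivation_map[OF derivation_polar]] algebra_simps)

lemma form_degree_scalar: "form_degree 0 (scalar c)"
  by (simp add: form_degree_def map_polar_scalar)

lemma form_degree_power: "form_degree d A \<Longrightarrow> form_degree (n * d) (A ^ n)"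
  using form_degree_scalar[of 1] form_degree_mult by (induction n) (auto simp: scalar_1)

lemma quintic_nform: "quintic = nform 5 coef"
  by (simp add: quintic_def nform_def bform_def coef_def mconst_mult atMost_atLeast0)

lemma covariant_quintic: "covariant quintic"
proof -
  have "lower quintic = 0"
    unfolding lower_def quintic_nform map_nform[OF derivation_polar] x2_D1_nform nform_diff
    by (subst nform_cong[where d = "\<lambda>_. 0"]) (simp_all add: polar_coef lowering_def nform_def bform_def)
  moreover have "raise quintic = 0"
    unfolding raise_def quintic_nform map_nform[OF derivation_polar] x1_D2_nform nform_diff
    by (subst nform_cong[where d = "\<lambda>_. 0"]) (simp_all add: polar_coef raising_def nform_def bform_def)
  ultimately show ?thesis by (simp add: covariant_def)
qed

lemma form_degree_quintic: "form_degree 1 quintic"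
  unfolding form_degree_def quintic_nform map_nform[OF derivation_polar]
  by simp (rule nform_cong, simp add: polar_coef)

lemma covariant_nformD:
  assumes "covariant (nform n c)" "k \<le> n"
  shows "polar lowering (c k) = of_nat k * c (k - 1)" "polar raising (c k) = of_nat (n - k) * c (Suc k)"
proof -
  have "nform n (\<lambda>k. polar lowering (c k)) = nform n (\<lambda>k. of_nat k * c (k - 1))"
    using assms(1) by (simp add: covariant_def lower_def map_nform[OF derivation_polar] x2_D1_nform)
  from nform_eqD[OF this assms(2)] show "polar lowering (c k) = of_nat k * c (k - 1)" .
  have "nform n (\<lambda>k. polar raising (c k)) = nform n (\<lambda>k. of_nat (n - k) * c (Suc k))"
    using assms(1) by (simp add: covariant_def raise_def map_nform[OF derivation_polar] x1_D2_nform)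
  from nform_eqD[OF this assms(2)] show "polar raising (c k) = of_nat (n - k) * c (Suc k)" .
qed

lemma form_degree_nformD:
  assumes "form_degree d (nform n c)" "k \<le> n"
  shows "polar coef (c k) = of_nat d * c k"
proof -
  have "nform n (\<lambda>k. polar coef (c k)) = nform n (\<lambda>k. of_nat d * c k)"
    using assms(1) nform_mconst_mult[of "of_nat d" n c] by (simp add: form_degree_def map_nform[OF derivation_polar])
  from nform_eqD[OF this assms(2)] show ?thesis .
qed

text \<open>Covariance of \<open>U\<close> means that its vector field commutes with the generators.\<close>

lemma polarization_invariant:
  assumes U: "\<And>k. k \<le> 5 \<Longrightarrow> polar lowering (U k) = of_nat k * U (k - 1)"
      "\<And>k. k \<le> 5 \<Longrightarrow> polar raising (U k) = of_nat (5 - k) * U (Suc k)"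
    and h: "polar lowering h = 0" "polar raising h = 0"
  shows "polar lowering (polar U h) = 0" "polar raising (polar U h) = 0"
proof -
  note s = derivation_simps[OF derivation_polar] derivation_commutator derivation_polar
  have z: "derivation (\<lambda>_. 0 :: R)" by (simp add: derivation_def)
  have "polar lowering (polar U h) - polar U (polar lowering h) = 0"
    by (rule derivation_R_eqI[OF derivation_commutator[OF derivation_polar derivation_polar] z])
      (auto simp: s polar_coef U lowering_def)
  then show "polar lowering (polar U h) = 0" by (simp add: h s)
  have "polar raising (polar U h) - polar U (polar raising h) = 0"
  proof (rule derivation_R_eqI[OF derivation_commutator[OF derivation_polar derivation_polar] z])
    fix k :: nat assume k: "k \<le> 5"
    show "polar raising (polar U (coef k)) - polar U (polar raising (coef k)) = 0"
      using k by (cases "k = 5") (simp_all add: s polar_coef U raising_def)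
  qed (simp_all add: s)
  then show "polar raising (polar U h) = 0" by (simp add: h s)
qed

text \<open>The commutator of the two nilpotent generators is the weight operator.\<close>

lemma weight_invariant:
  assumes h: "polar lowering h = 0" "polar raising h = 0"
  shows "(\<Sum>k\<le>5. of_int (2 * int k - 5) * coef k * mpderiv (of_nat k) h) = 0"
proof -
  let ?W = "\<lambda>k. of_int (2 * int k - 5) * coef k"
  note s = derivation_simps[OF derivation_polar]
  have "polar raising (polar lowering h) - polar lowering (polar raising h) = polar ?W h"
  proof (rule derivation_R_eqI[OF derivation_commutator[OF derivation_polar derivation_polar] derivation_polar])
    fix k :: nat assume "k \<le> 5"
    then have "k \<in> {0, 1, 2, 3, 4, 5}" by auto
    then show "polar raising (polar lowering (coef k)) - polar lowering (polar raising (coef k)) = polar ?W (coef k)"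
      by (auto simp: s polar_coef raising_def lowering_def algebra_simps numeral_eq_Suc)
  qed (simp add: s)
  then have "polar ?W h = 0" by (simp add: h s)
  then show ?thesis unfolding polar_def .
qed


section \<open>Evaluation and the slice of vanishing middle coefficients\<close>

text \<open>Points are given by sequences, so that coordinates can be addressed by natural numbers.\<close>

definition point :: "(nat \<Rightarrow> complex) \<Rightarrow> 6 \<Rightarrow> complex" where
  "point s v = s (THE k. k \<le> 5 \<and> v = of_nat k)"

lemma point_of_nat: "k \<le> 5 \<Longrightarrow> point s (of_nat k) = s k"
  unfolding point_def by (rule arg_cong[where f = s], rule the_equality) (auto simp: of_nat_index_eq_iff)

definition ev :: "(nat \<Rightarrow> complex) \<Rightarrow> R \<Rightarrow> complex" where
  "ev s = msubst (\<lambda>c. c) (point s)"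

lemma comm_ring_hom_id: "comm_ring_hom (\<lambda>c::'a::comm_ring_1. c)"
  by unfold_locales simp_all

interpretation ev: comm_ring_hom "ev s"
  unfolding ev_def by (rule comm_ring_hom_msubst[OF comm_ring_hom_id])

lemma ev_mconst [simp]: "ev s (mconst c) = c"
  unfolding ev_def by (rule msubst_mconst[OF comm_ring_hom_id])

lemma ev_coef: "k \<le> 5 \<Longrightarrow> ev s (coef k) = s k"
  unfolding ev_def coef_def by (simp add: msubst_mvar[OF comm_ring_hom_id] point_of_nat)

lemma ev_zero_point: "ev (\<lambda>_. 0) p = lookup p 0"
proof -
  have "(\<Prod>v\<in>UNIV. point (\<lambda>_. 0) v ^ lookup m v) = (if m = 0 then 1 else 0)" for m :: "6 \<Rightarrow>\<^sub>0 nat"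
  proof (cases "m = 0")
    case False
    then obtain v where "lookup m v \<noteq> 0" by (auto simp: poly_mapping_eq_iff fun_eq_iff)
    then have "(\<Prod>v\<in>UNIV. point (\<lambda>_. 0) v ^ lookup m v) = 0"
      by (intro prod_zero bexI[of _ v]) (auto simp: point_def)
    then show ?thesis using False by simp
  qed simp
  then have "ev (\<lambda>_. 0) p = (\<Sum>m\<in>keys p. if m = 0 then lookup p m else 0)"
    unfolding ev_def msubst_def by (intro sum.cong refl) auto
  then show ?thesis by (simp add: in_keys_iff)
qed

lemma ev_has_field_derivative:
  assumes k: "k \<le> 5"
  shows "((\<lambda>t. ev (s(k := t)) p) has_field_derivative ev (s(k := t)) (mpderiv (of_nat k) p)) (at t)"
proof (induction p arbitrary: t rule: mpoly_induct)
  case (const c)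
  then show ?case by simp
next
  case (var v)
  obtain j where j: "j \<le> 5" "v = of_nat j" using index_cases by blast
  have "ev u (mvar v) = u j" for u using ev_coef[OF j(1)] by (simp add: coef_def j)
  then show ?case using j k by (auto simp: mpderiv_mvar of_nat_index_eq_iff intro!: derivative_eq_intros)
next
  case (add p q)
  then show ?case by (simp add: mpderiv_add ev.hom_add DERIV_add)
next
  case (mult p q)
  show ?case
    unfolding mpderiv_mult ev.hom_add ev.hom_mult by (rule DERIV_cong[OF DERIV_mult[OF mult(1) mult(2)]]) (simp add: mult.commute fun_upd_def)
qed

text \<open>Derivatives of \<open>p\<close> in directions of the subspace vanish on it as well, and at the origin they are
  the coefficients, up to factorials.\<close>

lemma lookup_zero_if_vanishing:
  assumes "\<And>s. (\<And>k. k \<in> K \<Longrightarrow> s k = 0) \<Longrightarrow> ev s p = 0"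
    and "\<And>k. k \<in> K \<Longrightarrow> lookup m (of_nat k) = 0"
  shows "lookup p m = 0"
  using assms
proof (induction "\<Sum>v\<in>UNIV. lookup m v" arbitrary: m p)
  case 0
  then have "m = 0" by (intro poly_mapping_eqI) simp
  then show ?case using 0(2)[of "\<lambda>_. 0"] by (simp add: ev_zero_point)
next
  case (Suc n)
  have "(\<Sum>v\<in>UNIV. lookup m v) \<noteq> 0" unfolding Suc(2)[symmetric] by simp
  then obtain v where v: "lookup m v \<noteq> 0" by (metis sum.neutral)
  obtain k where k: "k \<le> 5" "v = of_nat k" using index_cases by blast
  have kK: "k \<notin> K" using Suc(4) v k by auto
  define m' where "m' = m - single v 1"
  have m: "m = m' + single v 1"
    using v by (auto simp: m'_def poly_mapping_eq_iff fun_eq_iff lookup_minus lookup_add lookup_single when_def)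
  have "Suc n = (\<Sum>w\<in>UNIV. lookup m' w) + (\<Sum>w\<in>UNIV. lookup (single v (1::nat)) w)"
    unfolding Suc(2) m lookup_add sum.distrib ..
  then have n: "n = (\<Sum>w\<in>UNIV. lookup m' w)" by (simp add: lookup_single when_def)
  have "ev s (mpderiv v p) = 0" if s: "\<And>k. k \<in> K \<Longrightarrow> s k = 0" for s
  proof -
    have "(\<lambda>t. ev (s(k := t)) p) = (\<lambda>_. 0)"
      using kK s by (intro ext Suc(3)) auto
    then have "((\<lambda>_. 0) has_field_derivative ev (s(k := s k)) (mpderiv (of_nat k) p)) (at (s k))"
      using ev_has_field_derivative[OF k(1), of s p "s k"] by simp
    from DERIV_unique[OF this DERIV_const] show ?thesis using k(2) by simp
  qed
  moreover have "lookup m' (of_nat k) = 0" if "k \<in> K" for k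
    using Suc(4)[OF that] by (simp add: m'_def lookup_minus)
  ultimately have "lookup (mpderiv v p) m' = 0" using Suc(1)[OF n] by blast
  then show ?case unfolding lookup_mpderiv m[symmetric] by (simp del: of_nat_Suc)
qed

lemma lookup_mvar_mult:
  "lookup (mvar w * q) x =
     (if lookup x w = 0 then 0 else lookup q (x - single w 1))"
  for q :: "('v, 'a::comm_ring_1) mpoly"
proof (induction q rule: poly_mapping_single_induct)
  case (single m c)
  have "single w 1 + m = x \<longleftrightarrow> lookup x w \<noteq> 0 \<and> m = x - single w 1"
    by (auto simp: poly_mapping_eq_iff fun_eq_iff lookup_minus lookup_add lookup_single when_def)
  then show ?case by (auto simp: mvar_def mult_single lookup_single when_def)
qed (simp add: distrib_left lookup_add)

lemma lookup_of_nat_mult: "lookup (of_nat k * q) x = of_nat k * lookup q x"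
  for q :: "('v, 'a::comm_ring_1) mpoly"
  by (induction k) (simp_all add: distrib_right lookup_add)

lemma lookup_polarization_term:
  "lookup (of_nat a * coef j * mpderiv (of_nat k) p) x =
    (if lookup x (of_nat j) = 0 then 0
     else of_nat a * of_nat (Suc (lookup (x - single (of_nat j) 1) (of_nat k))) *
       lookup p (x - single (of_nat j) 1 + single (of_nat k) 1))"
  by (simp add: mult.assoc lookup_of_nat_mult coef_def lookup_mvar_mult lookup_mpderiv del: of_nat_Suc)

definition middle_degree :: "(6 \<Rightarrow>\<^sub>0 nat) \<Rightarrow> nat" where
  "middle_degree m = lookup m 2 + lookup m 3"

text \<open>Take a monomial of \<open>p\<close> whose degree in \<open>a\<^sub>2\<close> and \<open>a\<^sub>3\<close> is minimal. Modulo terms that do not lower this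
  degree, the lowering field is \<open>2 a\<^sub>1 d/da\<^sub>2\<close> and the raising field is \<open>2 a\<^sub>4 d/da\<^sub>3\<close>. As they kill \<open>p\<close>,
  the monomial contains neither \<open>a\<^sub>2\<close> nor \<open>a\<^sub>3\<close>, so it is seen on the slice. The factor \<open>s 1 * s 4\<close> permits
  denominators in the evaluation on the slice.\<close>

lemma invariant_zero_if_zero_on_slice:
  fixes p :: R
  assumes low: "polar lowering p = 0" and rai: "polar raising p = 0"
    and slice: "\<And>s. s 2 = 0 \<Longrightarrow> s 3 = 0 \<Longrightarrow> s 1 * s 4 * ev s p = 0"
  shows "p = 0"
proof (rule ccontr)
  assume "p \<noteq> 0"
  then have "keys p \<noteq> {}" by simp
  then obtain m where m: "m \<in> keys p"
    and min: "\<And>y. y \<in> keys p \<Longrightarrow> middle_degree m \<le> middle_degree y"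
    using ex_has_least_nat[of "\<lambda>m. m \<in> keys p" _ middle_degree] by blast
  have small: "lookup p y = 0" if "middle_degree y < middle_degree m" for y
    using min[of y] that by (auto simp: in_keys_iff)
  let ?e = "\<lambda>v::6. single v (1::nat)"
  have split: "m = (m - ?e v) + ?e v" if "lookup m v \<noteq> 0" for v
    using that by (auto simp: poly_mapping_eq_iff fun_eq_iff lookup_minus lookup_add lookup_single when_def)
  have m2: "lookup m 2 = 0"
  proof (rule ccontr)
    assume nz: "lookup m 2 \<noteq> 0"
    define x where "x = (m - ?e 2) + ?e 1"
    have x: "x - ?e 1 + ?e 2 = m" using split[OF nz] by (simp add: x_def)
    have "0 = (\<Sum>k\<le>5. lookup (of_nat k * coef (k - 1) * mpderiv (of_nat k) p) x)"
      using low by (simp add: polar_def lowering_def lookup_sum[symmetric])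
    also have "\<dots> = (\<Sum>k\<le>5. if k = 2 then lookup (of_nat k * coef (k - 1) * mpderiv (of_nat k) p) x else 0)"
    proof (rule sum.cong[OF refl])
      fix k :: nat assume "k \<in> {..5}"
      then have "k \<in> {0, 1, 2, 3, 4, 5}" by auto
      then show "lookup (of_nat k * coef (k - 1) * mpderiv (of_nat k) p) x =
        (if k = 2 then lookup (of_nat k * coef (k - 1) * mpderiv (of_nat k) p) x else 0)"
        unfolding lookup_polarization_term
        using nz by (auto intro!: small simp: middle_degree_def x_def lookup_add lookup_minus lookup_single when_def)
    qed
    also have "\<dots> = lookup (of_nat 2 * coef 1 * mpderiv (of_nat 2) p) x" by simp
    also have "\<dots> = 2 * of_nat (Suc (lookup (x - ?e 1) 2)) * lookup p m"
      unfolding lookup_polarization_term using x by (simp add: x_def lookup_add del: of_nat_Suc One_nat_def)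
    finally have "lookup p m = 0" by (simp del: of_nat_Suc)
    then show False using m by (simp add: in_keys_iff)
  qed
  have m3: "lookup m 3 = 0"
  proof (rule ccontr)
    assume nz: "lookup m 3 \<noteq> 0"
    define x where "x = (m - ?e 3) + ?e 4"
    have x: "x - ?e 4 + ?e 3 = m" using split[OF nz] by (simp add: x_def)
    have "0 = (\<Sum>k\<le>5. lookup (of_nat (5 - k) * coef (Suc k) * mpderiv (of_nat k) p) x)"
      using rai by (simp add: polar_def raising_def lookup_sum[symmetric])
    also have "\<dots> = (\<Sum>k\<le>5. if k = 3 then lookup (of_nat (5 - k) * coef (Suc k) * mpderiv (of_nat k) p) x else 0)"
    proof (rule sum.cong[OF refl])
      fix k :: nat assume "k \<in> {..5}"
      then have "k \<in> {0, 1, 2, 3, 4, 5}" by auto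
      then show "lookup (of_nat (5 - k) * coef (Suc k) * mpderiv (of_nat k) p) x =
        (if k = 3 then lookup (of_nat (5 - k) * coef (Suc k) * mpderiv (of_nat k) p) x else 0)"
        unfolding lookup_polarization_term
        using nz by (auto intro!: small simp: middle_degree_def x_def lookup_add lookup_minus lookup_single when_def)
    qed
    also have "\<dots> = lookup (of_nat 2 * coef 4 * mpderiv (of_nat 3) p) x" by simp
    also have "\<dots> = 2 * of_nat (Suc (lookup (x - ?e 4) 3)) * lookup p m"
      unfolding lookup_polarization_term using x by (simp add: x_def lookup_add del: of_nat_Suc One_nat_def)
    finally have "lookup p m = 0" by (simp del: of_nat_Suc)
    then show False using m by (simp add: in_keys_iff)
  qed
  have "lookup (mvar 1 * (mvar 4 * p)) (m + ?e 1 + ?e 4) = 0"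
  proof (rule lookup_zero_if_vanishing[of "{2, 3}"])
    fix s :: "nat \<Rightarrow> complex" assume "\<And>k. k \<in> {2, 3} \<Longrightarrow> s k = 0"
    then have "s 1 * s 4 * ev s p = 0" using slice by simp
    then show "ev s (mvar 1 * (mvar 4 * p)) = 0"
      using ev_coef[of 1 s] ev_coef[of 4 s] by (simp add: coef_def ev.hom_mult mult.assoc)
  qed (use m2 m3 in \<open>auto simp: lookup_add lookup_single when_def\<close>)
  moreover have "m + ?e 1 + ?e 4 - ?e 1 - ?e 4 = m"
    by (auto simp: poly_mapping_eq_iff fun_eq_iff lookup_minus lookup_add)
  ultimately have "lookup p m = 0"
    by (simp add: lookup_mvar_mult lookup_add lookup_minus lookup_single when_def)
  then show False using m by (simp add: in_keys_iff)
qed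


section \<open>Regular sequences by specialization to a line\<close>

lemma sum_lessThan_add: "(\<Sum>j<n + (k::nat). a j) = (\<Sum>j<n. a j) + (\<Sum>j<k. a (n + j) :: 'a::comm_monoid_add)"
  by (induction k) (simp_all add: add.assoc)

lemma coeff_mult_sum_below:
  fixes p q :: "'a::comm_ring_1 poly"
  assumes "\<And>j. n \<le> j \<Longrightarrow> coeff p j = 0"
  shows "coeff (p * q) i = (\<Sum>j<n. (if j \<le> i then coeff q (i - j) else 0) * coeff p j)"
proof -
  have "coeff (p * q) i = (\<Sum>j\<le>i. coeff p j * coeff q (i - j))" by (rule coeff_mult)
  also have "\<dots> = (\<Sum>j\<in>{..i} \<inter> {..<n}. coeff p j * coeff q (i - j))"
    by (rule sum.mono_neutral_right) (auto, metis assms leI mult_zero_left)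
  also have "\<dots> = (\<Sum>j<n. (if j \<le> i then coeff q (i - j) else 0) * coeff p j)"
    by (rule sum.mono_neutral_cong_left) (auto simp: mult.commute)
  finally show ?thesis .
qed

text \<open>The matrix of the map sending \<open>(t, w)\<close>, two polynomials of degree less than \<open>n\<close>, to \<open>t g - w m\<close>.\<close>

definition sylvester_square :: "nat \<Rightarrow> 'a::comm_ring_1 poly \<Rightarrow> 'a poly \<Rightarrow> 'a mat" where
  "sylvester_square n g m = mat (n + n) (n + n)
     (\<lambda>(i, j). if j < n then (if j \<le> i then coeff g (i - j) else 0)
       else (if j - n \<le> i then - coeff m (i - (j - n)) else 0))"

lemma sylvester_square_mult:
  fixes t w g m :: "'a::comm_ring_1 poly"
  assumes t: "\<And>j. n \<le> j \<Longrightarrow> coeff t j = 0" and w: "\<And>j. n \<le> j \<Longrightarrow> coeff w j = 0" and "i < n + n"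
  shows "(sylvester_square n g m *\<^sub>v vec (n + n) (\<lambda>j. if j < n then coeff t j else coeff w (j - n))) $ i =
    coeff (t * g - w * m) i"
proof -
  let ?v = "\<lambda>j. if j < n then coeff t j else coeff w (j - n)"
  let ?a = "\<lambda>j. (if j < n then (if j \<le> i then coeff g (i - j) else 0)
       else (if j - n \<le> i then - coeff m (i - (j - n)) else 0)) * ?v j"
  have "(sylvester_square n g m *\<^sub>v vec (n + n) ?v) $ i = (\<Sum>j<n + n. ?a j)"
    using assms(3) by (simp add: sylvester_square_def scalar_prod_def atLeast0LessThan)
  also have "\<dots> = (\<Sum>j<n. ?a j) + (\<Sum>j<n. ?a (n + j))"
    by (rule sum_lessThan_add)
  also have "(\<Sum>j<n. ?a j) = coeff (t * g) i"
    by (subst coeff_mult_sum_below[of n t], rule t, assumption, rule sum.cong) simp_all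
  also have "(\<Sum>j<n. ?a (n + j)) = - coeff (w * m) i"
    by (subst coeff_mult_sum_below[of n w], rule w, assumption, subst sum_negf[symmetric], rule sum.cong) simp_all
  finally show ?thesis by simp
qed

text \<open>The determinant of the map \<open>(t, w) \<mapsto> t g - w m\<close> is not zero, since it is not zero after the
  specialization \<open>\<phi>\<close>, where \<open>m\<close> keeps its degree and \<open>m\<close> and \<open>g\<close> are coprime.\<close>

lemma coprime_specialization_cancel:
  fixes \<phi> :: "'a::idom \<Rightarrow> 'b::field_gcd" and m g t w :: "'a poly"
  assumes hom: "comm_ring_hom \<phi>"
    and m: "degree m = n" "0 < n" "\<phi> (lead_coeff m) \<noteq> 0" and g: "degree g \<le> n"
    and coprime: "coprime (map_poly \<phi> m) (map_poly \<phi> g)"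
    and eq: "t * g = w * m" and t: "degree t < n"
  shows "t = 0"
proof (rule ccontr)
  assume "t \<noteq> 0"
  interpret \<phi>: comm_ring_hom \<phi> by fact
  have m0: "m \<noteq> 0" using m by auto
  have dw: "w = 0 \<or> degree w < n"
  proof (cases "w = 0")
    case False
    then have "n + degree w = degree (t * g)" using m0 m(1) by (simp add: eq degree_mult_eq)
    also have "\<dots> \<le> degree t + degree g" by (rule degree_mult_le)
    finally show ?thesis using t g by linarith
  qed simp
  let ?N = "n + n"
  let ?A = "sylvester_square n g m"
  let ?v = "vec ?N (\<lambda>j. if j < n then coeff t j else coeff w (j - n))"
  have A: "?A \<in> carrier_mat ?N ?N" by (simp add: sylvester_square_def)
  have "?A *\<^sub>v ?v = 0\<^sub>v ?N"
  proof (rule eq_vecI)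
    fix i assume "i < dim_vec (0\<^sub>v ?N :: 'a vec)"
    then show "(?A *\<^sub>v ?v) $ i = 0\<^sub>v ?N $ i"
      using t dw eq by (subst sylvester_square_mult) (auto intro: coeff_eq_0)
  qed (use A in simp)
  moreover have "?v \<noteq> 0\<^sub>v ?N"
  proof
    assume "?v = 0\<^sub>v ?N"
    then have "?v $ degree t = 0" using t by simp
    then show False using t \<open>t \<noteq> 0\<close> by simp
  qed
  ultimately have "det ?A = 0" using det_0_iff_vec_prod_zero[OF A] by (metis vec_carrier)
  then have "\<phi> (det ?A) = 0" by simp
  moreover have "map_mat \<phi> ?A = sylvester_square n (map_poly \<phi> g) (map_poly \<phi> m)"
    by (rule eq_matI) (auto simp: sylvester_square_def coeff_map_poly \<phi>.hom_uminus)
  ultimately have "det (sylvester_square n (map_poly \<phi> g) (map_poly \<phi> m)) = 0"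
    by (metis \<phi>.hom_det)
  moreover have A': "sylvester_square n (map_poly \<phi> g) (map_poly \<phi> m) \<in> carrier_mat ?N ?N"
    by (simp add: sylvester_square_def)
  ultimately obtain v where v: "v \<in> carrier_vec ?N" "v \<noteq> 0\<^sub>v ?N"
    "sylvester_square n (map_poly \<phi> g) (map_poly \<phi> m) *\<^sub>v v = 0\<^sub>v ?N"
    using det_0_iff_vec_prod_zero_field by blast
  define t' where "t' = (\<Sum>j<n. monom (v $ j) j)"
  define w' where "w' = (\<Sum>j<n. monom (v $ (n + j)) j)"
  have ct: "coeff t' j = (if j < n then v $ j else 0)" and cw: "coeff w' j = (if j < n then v $ (n + j) else 0)" for j
    by (simp_all add: t'_def w'_def coeff_sum)
  have vv: "v = vec ?N (\<lambda>j. if j < n then coeff t' j else coeff w' (j - n))"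
    by (rule eq_vecI) (use v(1) in \<open>auto simp: ct cw\<close>)
  have low: "coeff (t' * map_poly \<phi> g - w' * map_poly \<phi> m) i = 0" if "i < ?N" for i
    using sylvester_square_mult[of n t' w' i "map_poly \<phi> g" "map_poly \<phi> m"] that v(3)
    unfolding vv[symmetric] by (simp add: ct cw)
  have dm: "degree (map_poly \<phi> m) \<le> n" and dg: "degree (map_poly \<phi> g) \<le> n"
    using m(1) g by (auto intro: order_trans[OF map_poly_degree_leq])
  have dt: "degree t' < n" and dw': "degree w' < n"
    using m(2) by (auto intro!: degree_lessI simp: ct cw)
  have "coeff (t' * map_poly \<phi> g) i = 0" "coeff (w' * map_poly \<phi> m) i = 0" if "?N \<le> i" for i
    using that dm dg dt dw' degree_mult_le[of t' "map_poly \<phi> g"] degree_mult_le[of w' "map_poly \<phi> m"]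
    by (auto intro!: coeff_eq_0)
  with low have "t' * map_poly \<phi> g - w' * map_poly \<phi> m = 0"
    by (intro poly_eqI) (metis coeff_0 coeff_diff diff_zero leI)
  then have eq': "t' * map_poly \<phi> g = w' * map_poly \<phi> m" by simp
  have nz: "coeff (map_poly \<phi> m) n \<noteq> 0" using m by (simp add: coeff_map_poly)
  then have dm': "degree (map_poly \<phi> m) = n" using dm le_degree[OF nz] by simp
  have m0': "map_poly \<phi> m \<noteq> 0" using nz by (metis coeff_0)
  have "map_poly \<phi> m dvd t' * map_poly \<phi> g" unfolding eq' by simp
  then have "map_poly \<phi> m dvd t'" using coprime by (simp add: coprime_dvd_mult_left_iff)
  then have "t' = 0" using dt dm' dvd_imp_degree_le[of "map_poly \<phi> m" t'] by auto
  then have "w' = 0" using eq' m0' by simp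
  have "v $ j = 0" if "j < ?N" for j
  proof (cases "j < n")
    case True
    then show ?thesis using ct[of j] \<open>t' = 0\<close> by simp
  next
    case False
    then have "j - n < n" "n + (j - n) = j" using that by auto
    then show ?thesis using cw[of "j - n"] \<open>w' = 0\<close> by simp
  qed
  then have "v = 0\<^sub>v ?N" using v(1) by (intro eq_vecI) auto
  then show False using v(2) by simp
qed

lemma comm_ring_hom_mconst: "comm_ring_hom (mconst :: 'a::comm_ring_1 \<Rightarrow> ('v, 'a) mpoly)"
  by unfold_locales (simp_all add: mconst_add mconst_mult)

lemma comm_ring_hom_pCons_mconst: "comm_ring_hom (\<lambda>c. [:mconst c:] :: R poly)"
  by unfold_locales (simp_all add: mconst_add mconst_mult one_pCons)

text \<open>The polynomial \<open>p (a + t u)\<close> in \<open>t\<close>.\<close>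

definition taylor :: "(6 \<Rightarrow> complex) \<Rightarrow> R \<Rightarrow> R poly" where
  "taylor u = msubst (\<lambda>c. [:mconst c:]) (\<lambda>v. [:mvar v, mconst (u v):])"

lemma comm_ring_hom_taylor: "comm_ring_hom (taylor u)"
  unfolding taylor_def by (rule comm_ring_hom_msubst[OF comm_ring_hom_pCons_mconst])

interpretation taylor: comm_ring_hom "taylor u"
  by (rule comm_ring_hom_taylor)

lemma taylor_mconst: "taylor u (mconst c) = [:mconst c:]"
  unfolding taylor_def by (rule msubst_mconst[OF comm_ring_hom_pCons_mconst])

lemma taylor_mvar: "taylor u (mvar v) = [:mvar v, mconst (u v):]"
  unfolding taylor_def by (rule msubst_mvar[OF comm_ring_hom_pCons_mconst])

lemma taylor_at_zero: "poly (taylor u p) 0 = p"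
  by (induction p rule: mpoly_induct) (simp_all add: taylor_mconst taylor_mvar taylor.hom_add taylor.hom_mult)

lemma taylor_eval:
  "poly (map_poly (ev s) (taylor (point f) p)) t = ev (\<lambda>k. s k + t * f k) p"
proof -
  interpret h: map_poly_comm_ring_hom "ev s" ..
  show ?thesis
  proof (induction p rule: mpoly_induct)
    case (const c)
    show ?case by (simp add: taylor_mconst Polynomial.map_poly_pCons[where f = "ev s", OF ev.hom_zero])
  next
    case (var v)
    obtain j where j: "j \<le> 5" "v = of_nat j" using index_cases by blast
    have e: "ev u (mvar v) = u j" for u using ev_coef[OF j(1)] by (simp add: coef_def j)
    have "point f v = f j" unfolding j(2) by (rule point_of_nat[OF j(1)])
    then show ?case by (simp add: taylor_mvar Polynomial.map_poly_pCons[where f = "ev s", OF ev.hom_zero] e)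
  next
    case (mult p q)
    show ?case by (simp add: taylor.hom_mult ev.hom_mult mult h.hom_mult)
  next
    case (add p q)
    show ?case by (simp add: taylor.hom_add ev.hom_add add h.hom_add)
  qed
qed

definition total_degree :: "(6 \<Rightarrow>\<^sub>0 nat) \<Rightarrow> nat" where
  "total_degree m = (\<Sum>v\<in>UNIV. lookup m v)"

lemma UNIV_index: "(UNIV :: 6 set) = of_nat ` {..5}"
  using index_cases by auto

lemma lookup_euler: "lookup (polar coef p) m = of_nat (total_degree m) * lookup p m"
proof -
  have "lookup (coef k * mpderiv (of_nat k) p) m = of_nat (lookup m (of_nat k)) * lookup p m" for k
  proof (cases "lookup m (of_nat k) = 0")
    case False
    let ?e = "single (of_nat k :: 6) (1::nat)"
    have 1: "m - ?e + ?e = m" and 2: "Suc (lookup (m - ?e) (of_nat k)) = lookup m (of_nat k)"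
      using False by (auto simp: poly_mapping_eq_iff fun_eq_iff lookup_minus lookup_add lookup_single when_def)
    then show ?thesis using False by (simp only: coef_def lookup_mvar_mult lookup_mpderiv 1 2 if_False)
  qed (simp add: coef_def lookup_mvar_mult)
  moreover have "total_degree m = (\<Sum>k\<le>5. lookup m (of_nat k))"
    unfolding total_degree_def UNIV_index by (subst sum.reindex) (auto simp: inj_on_def of_nat_index_eq_iff)
  ultimately show ?thesis by (simp add: polar_def lookup_sum sum_distrib_right)
qed

lemma euler_homogeneous:
  assumes "polar coef p = of_nat d * p" "m \<in> keys p"
  shows "total_degree m = d"
proof -
  have "of_nat (total_degree m) * lookup p m = of_nat d * lookup p m"
    unfolding lookup_euler[symmetric] assms(1) by (rule lookup_of_nat_mult)
  then show ?thesis using assms(2) by (simp add: in_keys_iff)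
qed

lemma coeff_mult_at_bounds:
  fixes p q :: "'a::comm_ring_1 poly"
  assumes "degree p \<le> a" "degree q \<le> b"
  shows "coeff (p * q) (a + b) = coeff p a * coeff q b"
proof -
  have "coeff (p * q) (a + b) = (\<Sum>i\<le>a + b. if i = a then coeff p a * coeff q b else 0)"
    unfolding coeff_mult
  proof (rule sum.cong[OF refl])
    fix i assume "i \<in> {..a + b}"
    then consider "i = a" | "a < i" | "i < a" "b < a + b - i" by fastforce
    then show "coeff p i * coeff q (a + b - i) = (if i = a then coeff p a * coeff q b else 0)"
      by cases (use assms in \<open>auto simp: coeff_eq_0\<close>)
  qed
  then show ?thesis by simp
qed

lemma linear_power_top:
  fixes x y :: "'a::comm_ring_1"
  shows "degree ([:x, y:] ^ n) \<le> n \<and> coeff ([:x, y:] ^ n) n = y ^ n"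
proof (induction n)
  case (Suc n)
  have d: "degree [:x, y:] \<le> 1" by simp
  have "degree ([:x, y:] * [:x, y:] ^ n) \<le> 1 + n"
    using degree_mult_le[of "[:x, y:]" "[:x, y:] ^ n"] d Suc by linarith
  moreover have "coeff ([:x, y:] * [:x, y:] ^ n) (1 + n) = y * y ^ n"
    using coeff_mult_at_bounds[OF d conjunct1[OF Suc]] Suc by simp
  ultimately show ?case by simp
qed simp

lemma prod_linear_top:
  fixes x y :: "'v \<Rightarrow> 'a::comm_ring_1"
  assumes "finite A"
  shows "degree (\<Prod>v\<in>A. [:x v, y v:] ^ e v) \<le> (\<Sum>v\<in>A. e v) \<and>
    coeff (\<Prod>v\<in>A. [:x v, y v:] ^ e v) (\<Sum>v\<in>A. e v) = (\<Prod>v\<in>A. y v ^ e v)"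
  using assms
proof (induction A rule: finite_induct)
  case (insert a A)
  let ?P = "\<Prod>v\<in>A. [:x v, y v:] ^ e v"
  have "degree ([:x a, y a:] ^ e a * ?P) \<le> e a + (\<Sum>v\<in>A. e v)"
    using degree_mult_le[of "[:x a, y a:] ^ e a" ?P] linear_power_top[of "x a" "y a" "e a"] insert.IH by linarith
  moreover have "coeff ([:x a, y a:] ^ e a * ?P) (e a + (\<Sum>v\<in>A. e v)) = y a ^ e a * (\<Prod>v\<in>A. y v ^ e v)"
    using coeff_mult_at_bounds[of "[:x a, y a:] ^ e a" "e a" ?P "\<Sum>v\<in>A. e v"] linear_power_top[of "x a" "y a" "e a"] insert.IH by simp
  ultimately show ?case using insert.hyps by simp
qed simp

lemma taylor_top:
  assumes "polar coef p = of_nat d * p"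
  shows "degree (taylor (point f) p) \<le> d \<and> coeff (taylor (point f) p) d = mconst (ev f p)"
proof -
  let ?P = "\<lambda>m. \<Prod>v\<in>UNIV. [:mvar v, mconst (point f v):] ^ lookup m v :: R poly"
  have P: "degree (?P m) \<le> d \<and> coeff (?P m) d = mconst (\<Prod>v\<in>UNIV. point f v ^ lookup m v)"
    if "m \<in> keys p" for m
  proof -
    interpret mc: comm_ring_hom "mconst :: complex \<Rightarrow> R" by (rule comm_ring_hom_mconst)
    show ?thesis
      using prod_linear_top[of UNIV mvar "\<lambda>v. mconst (point f v) :: R" "lookup m"]
        euler_homogeneous[OF assms that] unfolding total_degree_def by (simp add: mc.hom_prod mc.hom_power)
  qed
  have t: "taylor (point f) p = (\<Sum>m\<in>keys p. smult (mconst (lookup p m)) (?P m))"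
    unfolding taylor_def msubst_def by simp
  have "degree (taylor (point f) p) \<le> d"
    unfolding t using P by (intro degree_sum_le order_trans[OF degree_smult_le]) auto
  moreover have "coeff (taylor (point f) p) d = mconst (ev f p)"
    unfolding t coeff_sum ev_def msubst_def mconst_sum mconst_mult
    by (intro sum.cong refl) (simp add: P)
  ultimately show ?thesis ..
qed

text \<open>Expand along the direction \<open>f\<close>. The polynomial \<open>p (a + t f)\<close> has the constant \<open>p (f)\<close> as leading
  coefficient, so division by it is possible. If \<open>r q\<close> is a multiple of \<open>p\<close>, the remainder of
  \<open>r (a + t f)\<close> times \<open>q (a + t f)\<close> is a multiple of \<open>p (a + t f)\<close>, and
  \<open>coprime_specialization_cancel\<close>, with the coefficients evaluated at one point \<open>s\<close>, shows that this
  remainder is zero. At \<open>t = 0\<close> this says that \<open>p\<close> divides \<open>r\<close>.\<close>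

theorem regular_sequence_homogeneous_pair:
  fixes p q :: R
  assumes p: "polar coef p = of_nat d * p" and q: "polar coef q = of_nat d * q" and "0 < d"
    and top: "ev f p \<noteq> 0"
    and coprime: "coprime (map_poly (ev s) (taylor (point f) p)) (map_poly (ev s) (taylor (point f) q))"
    and proper: "ideal_gen {p, q} \<noteq> UNIV"
  shows "regular_sequence [p, q]"
proof -
  let ?m = "taylor (point f) p" and ?g = "taylor (point f) q"
  have dm: "degree ?m = d" and lm: "lead_coeff ?m = mconst (ev f p)"
  proof -
    have "coeff ?m d \<noteq> 0" using taylor_top[OF p, of f] top by (metis mconst_0 mconst_eq_iff)
    then show "degree ?m = d" using taylor_top[OF p, of f] le_degree by (metis le_antisym)
    then show "lead_coeff ?m = mconst (ev f p)" using taylor_top[OF p, of f] by simp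
  qed
  have p0: "p \<noteq> 0" using top by auto
  have main: "r \<in> ideal_gen {p}" if "r * q \<in> ideal_gen {p}" for r
  proof -
    from that obtain y where y: "r * q = y * p" unfolding mem_ideal_gen_single by blast
    obtain Q T where QT: "pseudo_divmod (taylor (point f) r) ?m = (Q, T)" by fastforce
    have m0: "?m \<noteq> 0" using lm top by (metis leading_coeff_0_iff mconst_0 mconst_eq_iff)
    define c where "c = ev f p ^ (Suc (degree (taylor (point f) r)) - degree ?m)"
    have div: "smult (mconst c) (taylor (point f) r) = ?m * Q + T" and T: "T = 0 \<or> degree T < degree ?m"
      using pseudo_divmod[OF m0 QT] by (simp_all add: lm c_def mconst_power)
    have "T = smult (mconst c) (taylor (point f) r) - ?m * Q" unfolding div by simp
    then have "T * ?g = smult (mconst c) (taylor (point f) (r * q)) - ?m * Q * ?g"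
      by (simp only: left_diff_distrib mult_smult_left taylor.hom_mult)
    also have "\<dots> = (smult (mconst c) (taylor (point f) y) - Q * ?g) * ?m"
      unfolding y taylor.hom_mult left_diff_distrib mult_smult_left by (simp only: mult_ac)
    finally have eq: "T * ?g = (smult (mconst c) (taylor (point f) y) - Q * ?g) * ?m" .
    have "T = 0"
    proof (rule ccontr)
      assume "T \<noteq> 0"
      moreover have "T = 0"
        by (rule coprime_specialization_cancel[OF ev.comm_ring_hom_axioms dm \<open>0 < d\<close> _ _ coprime eq])
          (use lm top taylor_top[OF q, of f] T dm \<open>T \<noteq> 0\<close> in auto)
      ultimately show False by simp
    qed
    then have "poly (smult (mconst c) (taylor (point f) r)) 0 = poly (?m * Q) 0" using div by simp
    then have "mconst c * r = p * poly Q 0" by (simp add: taylor_at_zero)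
    then have "mconst (1 / c) * (mconst c * r) = (mconst (1 / c) * poly Q 0) * p" by (simp only: mult_ac)
    moreover have "mconst (1 / c) * mconst c = (1 :: R)"
      unfolding mconst_mult[symmetric] using top by (simp add: c_def)
    ultimately have "r = (mconst (1 / c) * poly Q 0) * p"
      by (simp only: mult.assoc[symmetric] mult_1)
    then show ?thesis unfolding mem_ideal_gen_single by blast
  qed
  show ?thesis
    unfolding regular_sequence_def
  proof (intro conjI allI impI)
    fix i r assume "i < length [p, q]" and r: "r * [p, q] ! i \<in> ideal_gen (set (take i [p, q]))"
    then consider "i = 0" | "i = 1" by fastforce
    then show "r \<in> ideal_gen (set (take i [p, q]))"
      by cases (use r main p0 in \<open>auto simp: ideal_gen_empty\<close>)
  qed (use proper in simp)
qed


section \<open>Wronskians and maximal minors\<close>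

lemma x1_D1_nform: "x1 * D1 (nform n c) = nform n (\<lambda>k. of_nat (n - k) * c k)"
proof (cases n)
  case 0
  then show ?thesis by (simp add: nform_def bform_def D_simps derivation_0[OF derivation_D1])
next
  case (Suc m)
  show ?thesis
    unfolding Suc nform_def D1_bform x1_bform by (intro bform_cong) (simp add: mult_ac del: of_nat_Suc)
qed

lemma x2_D2_nform: "x2 * D2 (nform n c) = nform n (\<lambda>k. of_nat k * c k)"
proof (cases n)
  case 0
  then show ?thesis by (simp add: nform_def bform_def D_simps derivation_0[OF derivation_D1])
next
  case (Suc m)
  show ?thesis
    unfolding Suc nform_def D2_bform x2_bform by (intro bform_cong) (simp add: mult_ac del: of_nat_Suc)
qed

lemma signed_minor_mconst:
  "signed_minor n (\<lambda>i j. mconst (M i j)) k = (mconst (signed_minor n M k) :: ('v, 'a::comm_ring_1) mpoly)"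
proof -
  interpret mc: comm_ring_hom "mconst :: 'a \<Rightarrow> ('v, 'a) mpoly" by (rule comm_ring_hom_mconst)
  have "mat n n (\<lambda>(i, j). mconst (M i (if j < k then j else Suc j)) :: ('v, 'a) mpoly) =
      map_mat mconst (mat n n (\<lambda>(i, j). M i (if j < k then j else Suc j)))"
    by (rule eq_matI) auto
  then show ?thesis by (simp add: signed_minor_def mc.hom_mult mc.hom_power mc.hom_uminus)
qed

text \<open>The matrix is the product of \<open>M\<close> with a bidiagonal matrix. Add the row \<open>v\<close> to \<open>M\<close> that this
  bidiagonal matrix annihilates, and one column to the latter, to obtain square matrices.\<close>

lemma det_consecutive_columns:
  fixes M :: "nat \<Rightarrow> nat \<Rightarrow> 'a::idom" and x y :: 'a
  assumes x0: "x \<noteq> 0"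
  shows "det (mat n n (\<lambda>(i, j). M i j * x + M i (Suc j) * y)) =
    (\<Sum>j\<le>n. (- 1) ^ (n + j) * x ^ j * y ^ (n - j) * signed_minor n M j)"
proof -
  define v where "v j = (- 1) ^ (n + j) * x ^ j * y ^ (n - j)" for j
  let ?B = "bordered n M v"
  let ?W = "mat n n (\<lambda>(i, j). M i j * x + M i (Suc j) * y)"
  let ?N = "mat (Suc n) (Suc n) (\<lambda>(i, j). if i = j then (if j < n then x else 1) else if i = Suc j then y else 0)"
  have entry: "(?B * ?N) $$ (i, j) = (if j < n then ?B $$ (i, j) * x + ?B $$ (i, Suc j) * y else ?B $$ (i, n))"
    if "i \<le> n" "j \<le> n" for i j
  proof -
    have "(?B * ?N) $$ (i, j) = (\<Sum>k<Suc n. ?B $$ (i, k) * ?N $$ (k, j))"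
      using that by (simp add: bordered_def scalar_prod_def atLeast0LessThan)
    also have "\<dots> = (\<Sum>k<Suc n. (if k = j then ?B $$ (i, k) * (if j < n then x else 1) else 0) +
        (if k = Suc j then ?B $$ (i, k) * y else 0))"
      using that by (intro sum.cong refl) auto
    also have "\<dots> = (if j < n then ?B $$ (i, j) * x + ?B $$ (i, Suc j) * y else ?B $$ (i, n))"
      using that by (auto simp: sum.distrib)
    finally show ?thesis .
  qed
  define P where "P = ?B * ?N"
  have P: "P \<in> carrier_mat (Suc n) (Suc n)"
    unfolding P_def by (rule mult_carrier_mat[of _ _ "Suc n"]) (simp_all add: bordered_def)
  note entry = entry[folded P_def]
  have v_step: "v j * x + v (Suc j) * y = 0" if "j < n" for j
  proof -
    have "n - j = Suc (n - Suc j)" using that by simp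
    then show ?thesis by (simp add: v_def)
  qed
  have last: "P $$ (n, j) = (if j = n then x ^ n else 0)" if "j \<le> n" for j
    using that entry[of n j] v_step[of j] by (auto simp: bordered_def v_def mult_2[symmetric])
  have "mat_delete P n n = ?W"
    by (rule eq_matI) (use P in \<open>auto simp: mat_delete_def entry bordered_def\<close>)
  then have "cofactor P n n = det ?W" by (simp add: cofactor_def mult_2[symmetric])
  then have "det P = x ^ n * det ?W"
    unfolding laplace_expansion_row[OF P lessI] lessThan_Suc_atMost
    by (subst sum.mono_neutral_right[of _ "{n}"]) (auto simp: last)
  moreover have "det P = det ?B * det ?N"
    unfolding P_def by (rule det_mult[of _ "Suc n"]) (simp_all add: bordered_def)
  moreover have "det ?N = x ^ n"
  proof -
    have "det ?N = prod_list (diag_mat ?N)"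
      by (rule det_lower_triangular[of "Suc n"]) auto
    also have "\<dots> = prod_list (map (\<lambda>i. ?N $$ (i, i)) [0..<n]) * ?N $$ (n, n)"
      by (simp add: diag_mat_def)
    also have "map (\<lambda>i. ?N $$ (i, i)) [0..<n] = map (\<lambda>_. x) [0..<n]" by (rule map_cong) auto
    finally show ?thesis by (simp add: map_replicate_const)
  qed
  ultimately have "x ^ n * det ?W = x ^ n * det ?B" by (metis mult.commute)
  then have "det ?W = det ?B" using x0 by simp
  then show ?thesis by (simp add: det_bordered v_def)
qed

lemma x1_nonzero: "x1 \<noteq> 0"
proof
  assume "x1 = 0"
  then have "D1 x1 = 0" by (simp add: derivation_0[OF derivation_D1])
  then show False by (simp add: D_simps)
qed

text \<open>Fourth derivatives of a quintic are linear forms, and the coefficients of the \<open>j\<close>-th one are the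
  \<open>j\<close>-th and the next normalized coefficient. Up to sign the constant is the fifth power of
  \<open>5! / 1!\<close>.\<close>

lemma wronskian_quintics:
  "wronskian (map (\<lambda>i. nform 5 (M i)) [0..<5]) =
     bform 5 (\<lambda>k. mconst (- (120 ^ 5) * (- 1) ^ (5 - k)) * signed_minor 5 M (5 - k))"
proof -
  let ?W = "mat 5 5 (\<lambda>(i, j). mconst (M i j) * x1 + mconst (M i (Suc j)) * x2)"
  have "mat 5 5 (\<lambda>(i, j). (D1 ^^ (5 - 1 - j)) ((D2 ^^ j) (map (\<lambda>i. nform 5 (M i)) [0..<5] ! i))) = scalar 120 \<cdot>\<^sub>m ?W"
  proof (rule eq_matI)
    fix i j assume "i < dim_row (scalar 120 \<cdot>\<^sub>m ?W)" "j < dim_col (scalar 120 \<cdot>\<^sub>m ?W)"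
    then have ij: "i < 5" "j < 5" by simp_all
    then have "(D1 ^^ (5 - 1 - j)) ((D2 ^^ j) (nform 5 (M i))) = scalar 120 * nform 1 (\<lambda>k. M i (k + j))"
      using mixed_derivative_nform[of "5 - 1 - j" j 5 "M i"] by (simp add: fact_numeral)
    then show "mat 5 5 (\<lambda>(i, j). (D1 ^^ (5 - 1 - j)) ((D2 ^^ j) (map (\<lambda>i. nform 5 (M i)) [0..<5] ! i))) $$ (i, j) =
        (scalar 120 \<cdot>\<^sub>m ?W) $$ (i, j)"
      using ij by (simp add: nform_def bform_def del: upt.simps upt_rec_numeral)
  qed simp_all
  then have "wronskian (map (\<lambda>i. nform 5 (M i)) [0..<5]) = scalar 120 ^ 5 * det ?W"
    by (simp add: wronskian_def Let_def det_smult del: upt_rec_numeral)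
  also have "det ?W = (\<Sum>j\<le>5. (- 1) ^ (5 + j) * x1 ^ j * x2 ^ (5 - j) * mconst (signed_minor 5 M j))"
    using det_consecutive_columns[OF x1_nonzero, of 5 "\<lambda>i j. mconst (M i j)" x2] unfolding signed_minor_mconst .
  also have "scalar 120 ^ 5 * \<dots> = (\<Sum>j\<le>5. mconst (mconst (- (120 ^ 5) * (- 1) ^ j) * signed_minor 5 M j) * x1 ^ j * x2 ^ (5 - j))"
    unfolding sum_distrib_left
    by (intro sum.cong refl) (simp add: scalar_def mconst_mult mconst_uminus mconst_power power_add mult_ac)
  also have "\<dots> = (\<Sum>k\<le>5. mconst (mconst (- (120 ^ 5) * (- 1) ^ (5 - k)) * signed_minor 5 M (5 - k)) * x1 ^ (5 - k) * x2 ^ (5 - (5 - k)))"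
    unfolding atMost_atLeast0 by (subst sum.atLeastAtMost_rev) simp
  also have "\<dots> = bform 5 (\<lambda>k. mconst (- (120 ^ 5) * (- 1) ^ (5 - k)) * signed_minor 5 M (5 - k))"
    unfolding bform_def by (intro sum.cong refl) simp
  finally show ?thesis .
qed

section \<open>Proper ideals, homogeneous determinants and coprimality\<close>

lemma ideal_gen_subset: "S \<subseteq> ideal_gen T \<Longrightarrow> ideal_gen S \<subseteq> ideal_gen T"
  unfolding ideal_gen_def
  by (rule Modules.module.span_minimal[OF module_ring]) (auto intro: Modules.module.subspace_span[OF module_ring])

lemma ideal_gen_base: "x \<in> S \<Longrightarrow> x \<in> ideal_gen S"
  unfolding ideal_gen_def by (rule Modules.module.span_base[OF module_ring])

lemma ideal_gen_scale: "x \<in> ideal_gen S \<Longrightarrow> r * x \<in> ideal_gen S"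
  unfolding ideal_gen_def by (rule Modules.module.span_scale[OF module_ring])

lemma ideal_gen_zero: "0 \<in> ideal_gen S"
  unfolding ideal_gen_def by (rule Modules.module.span_zero[OF module_ring])

lemma ideal_gen_proper:
  fixes S :: "R set"
  assumes "\<And>x. x \<in> S \<Longrightarrow> ev s x = 0"
  shows "ideal_gen S \<noteq> UNIV"
proof -
  have "Modules.module.subspace (*) {x. ev s x = 0}"
    unfolding Modules.module.subspace_def[OF module_ring] by (auto simp: ev.hom_add ev.hom_mult)
  then have "ideal_gen S \<subseteq> {x. ev s x = 0}"
    unfolding ideal_gen_def using assms by (intro Modules.module.span_minimal[OF module_ring]) auto
  then have "1 \<notin> ideal_gen S" by auto
  then show ?thesis by blast
qed

lemma det_euler:
  fixes D :: "'a::comm_ring_1 \<Rightarrow> 'a"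
  assumes D: "derivation D" and rows: "\<And>i j. i < n \<Longrightarrow> j < n \<Longrightarrow> D (A i j) = of_nat (d i) * A i j"
  shows "D (det (mat n n (\<lambda>(i, j). A i j))) = of_nat (\<Sum>i<n. d i) * det (mat n n (\<lambda>(i, j). A i j))"
proof -
  have prod: "D (\<Prod>i\<in>I. A i (p i)) = of_nat (\<Sum>i\<in>I. d i) * (\<Prod>i\<in>I. A i (p i))"
    if "finite I" "\<And>i. i \<in> I \<Longrightarrow> i < n \<and> p i < n" for I p
    using that
    by (induction I rule: finite_induct) (simp_all add: derivation_1[OF D] derivation_mult[OF D] rows algebra_simps)
  have sgn: "D (signof p * x) = signof p * D x" for p x
    by (simp add: sign_def derivation_uminus[OF D])
  have det: "det (mat n n (\<lambda>(i, j). A i j)) = (\<Sum>p\<in>{p. p permutes {0..<n}}. signof p * (\<Prod>i\<in>{0..<n}. A i (p i)))"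
    unfolding det_def'[OF mat_carrier]
    by (intro sum.cong refl arg_cong2[of _ _ _ _ "(*)"] prod.cong) (auto simp: permutes_in_image)
  show ?thesis
    unfolding det derivation_sum[OF D] sgn sum_distrib_left
  proof (rule sum.cong[OF refl])
    fix p assume "p \<in> {p. p permutes {0..<n}}"
    then have "p i < n" if "i < n" for i using that permutes_in_image[of p "{0..<n}" i] by simp
    then show "signof p * D (\<Prod>i\<in>{0..<n}. A i (p i)) =
        of_nat (\<Sum>i<n. d i) * (signof p * (\<Prod>i\<in>{0..<n}. A i (p i)))"
      by (subst prod) (auto simp: atLeast0LessThan mult_ac)
  qed
qed

lemma coprime_if_no_common_root:
  fixes p q :: "complex poly"
  assumes "p \<noteq> 0" "\<And>z. poly p z = 0 \<Longrightarrow> poly q z = 0 \<Longrightarrow> False"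
  shows "coprime p q"
proof (rule coprimeI)
  fix r assume r: "r dvd p" "r dvd q"
  show "is_unit r"
  proof (rule ccontr)
    assume "\<not> is_unit r"
    moreover have "r \<noteq> 0" using r(1) assms(1) by auto
    ultimately have "degree r \<noteq> 0" by (simp add: is_unit_iff_degree)
    then have "\<not> constant (poly r)" by (simp add: constant_degree)
    then obtain z where "poly r z = 0" using fundamental_theorem_of_algebra by blast
    then show False using r assms(2)[of z] by (auto elim!: dvdE)
  qed
qed


section \<open>Coefficient sequences of transvectants\<close>

text \<open>The normalized coefficient with index \<open>k\<close> of the transvectant of two forms with normalized
  coefficients \<open>c\<close> and \<open>d\<close>. The inner sum is the coefficient of a product of two forms.\<close>

definition tv_coeff :: "nat \<Rightarrow> nat \<Rightarrow> nat \<Rightarrow> (nat \<Rightarrow> R) \<Rightarrow> (nat \<Rightarrow> R) \<Rightarrow> nat \<Rightarrow> R" where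
  "tv_coeff m n r c d k = mconst (1 / of_nat ((m + n - 2 * r) choose k)) *
     (\<Sum>i\<le>r. mconst ((- 1) ^ i * of_nat (r choose i)) *
       (\<Sum>j\<le>m - r. if j \<le> k \<and> k - j \<le> n - r
          then (of_nat ((m - r) choose j) * c (j + i)) * (of_nat ((n - r) choose (k - j)) * d (k - j + (r - i)))
          else 0))"

definition tv_val :: "nat \<Rightarrow> nat \<Rightarrow> nat \<Rightarrow> (nat \<Rightarrow> complex) \<Rightarrow> (nat \<Rightarrow> complex) \<Rightarrow> nat \<Rightarrow> complex" where
  "tv_val m n r c d k = (1 / of_nat ((m + n - 2 * r) choose k)) *
     (\<Sum>i\<le>r. ((- 1) ^ i * of_nat (r choose i)) *
       (\<Sum>j\<le>m - r. if j \<le> k \<and> k - j \<le> n - r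
          then (of_nat ((m - r) choose j) * c (j + i)) * (of_nat ((n - r) choose (k - j)) * d (k - j + (r - i)))
          else 0))"

lemma ev_tv_coeff: "ev s (tv_coeff m n r c d k) = tv_val m n r (\<lambda>i. ev s (c i)) (\<lambda>i. ev s (d i)) k"
  unfolding tv_coeff_def tv_val_def by (simp add: ev.hom_mult ev.hom_sum ev.hom_of_nat if_distrib[of "ev s"] cong: if_cong)

lemma transvectant_tv_coeff:
  assumes "r \<le> m" "r \<le> n"
  shows "transvectant m n r (nform m c) (nform n d) = nform (m + n - 2 * r) (tv_coeff m n r c d)"
proof -
  let ?N = "m + n - 2 * r"
  let ?w = "\<lambda>i k. \<Sum>j\<le>m - r. if j \<le> k \<and> k - j \<le> n - r
      then (of_nat ((m - r) choose j) * c (j + i)) * (of_nat ((n - r) choose (k - j)) * d (k - j + (r - i))) else 0"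
  let ?s = "\<lambda>i. (- 1) ^ i * of_nat (r choose i) :: complex"
  have N: "m - r + (n - r) = ?N" using assms by simp
  have sc: "(- 1) ^ i * of_nat (r choose i) = (mconst (mconst (?s i)) :: form)" for i
    by (simp add: mconst_mult mconst_power mconst_uminus)
  have "transvectant m n r (nform m c) (nform n d) = (\<Sum>i\<le>r. bform ?N (\<lambda>k. mconst (?s i) * ?w i k))"
    unfolding transvectant_nform[OF assms]
  proof (rule sum.cong[OF refl])
    fix i
    have "nform (m - r) (\<lambda>k. c (k + i)) * nform (n - r) (\<lambda>k. d (k + (r - i))) = bform ?N (?w i)"
      unfolding nform_def bform_mult N ..
    then show "(- 1) ^ i * of_nat (r choose i) * nform (m - r) (\<lambda>k. c (k + i)) * nform (n - r) (\<lambda>k. d (k + (r - i))) =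
        bform ?N (\<lambda>k. mconst (?s i) * ?w i k)"
      unfolding sc mult.assoc by (simp only: bform_mconst_mult)
  qed
  also have "\<dots> = bform ?N (\<lambda>k. \<Sum>i\<le>r. mconst (?s i) * ?w i k)" by (rule bform_sum) simp
  also have "\<dots> = nform ?N (tv_coeff m n r c d)"
    unfolding nform_def
  proof (rule bform_cong)
    fix k assume "k \<le> ?N"
    then have "of_nat (?N choose k) * mconst (1 / of_nat (?N choose k)) = (1 :: R)"
      unfolding mconst_of_nat[symmetric] mconst_mult[symmetric] by simp
    then show "(\<Sum>i\<le>r. mconst (?s i) * ?w i k) = of_nat (?N choose k) * tv_coeff m n r c d k"
      unfolding tv_coeff_def mult.assoc[symmetric] by simp
  qed
  finally show ?thesis .
qed

lemma nform_mult: "nform m c * nform n d = nform (m + n) (tv_coeff m n 0 c d)"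
proof -
  have "nform m c * nform n d = transvectant m n 0 (nform m c) (nform n d)"
    by (simp add: transvectant_def scalar_1)
  then show ?thesis by (simp add: transvectant_tv_coeff)
qed

lemma nform_0: "nform 0 c = mconst (c 0)"
  by (simp add: nform_def bform_def)

fun pow_coeff :: "nat \<Rightarrow> (nat \<Rightarrow> R) \<Rightarrow> nat \<Rightarrow> R" where
  "pow_coeff 0 c = (\<lambda>_. 1)"
| "pow_coeff (Suc j) c = tv_coeff 2 (2 * j) 0 c (pow_coeff j c)"

fun pow_val :: "nat \<Rightarrow> (nat \<Rightarrow> complex) \<Rightarrow> nat \<Rightarrow> complex" where
  "pow_val 0 c = (\<lambda>_. 1)"
| "pow_val (Suc j) c = tv_val 2 (2 * j) 0 c (pow_val j c)"

lemma nform_power: "nform 2 c ^ j = nform (2 * j) (pow_coeff j c)"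
  by (induction j) (simp_all add: nform_0 nform_mult)

lemma ev_pow_coeff: "ev s (pow_coeff j c k) = pow_val j (\<lambda>i. ev s (c i)) k"
  by (induction j arbitrary: k) (simp_all add: ev_tv_coeff)

lemma atMost_numeral_1: "{..1::nat} = {0, 1}"
  by auto

lemma choose_complex: "k \<le> n \<Longrightarrow> of_nat (n choose k) = (fact n / (fact k * fact (n - k)) :: complex)"
  by (rule binomial_fact)

lemmas tv_val_eval = tv_val_def atMost_nat_numeral atMost_numeral_1 choose_complex fact_numeral

lemmas expand = field_simps power_numeral_reduce

context
  notes One_nat_def [simp del] One_nat_def [symmetric, simp] pow_val.simps [simp del]
begin

lemma pow_val_1: "pow_val 1 q 0 = q 0" "pow_val 1 q 1 = q 1" "pow_val 1 q 2 = q 2"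
  using pow_val.simps(2)[of 0 q] pow_val.simps(1)[of q] by (simp_all add: tv_val_eval)

lemma pow_val_2:
  "pow_val 2 q 0 = (q 0)^2"
    "pow_val 2 q 1 = q 0*q 1"
    "pow_val 2 q 2 = 2/3*(q 1)^2 + 1/3*q 0*q 2"
    "pow_val 2 q 3 = q 1*q 2"
    "pow_val 2 q 4 = (q 2)^2"
  using pow_val.simps(2)[of 1 q]
  by (simp_all add: tv_val_eval pow_val_1)
    (simp_all add: expand)

lemma pow_val_3:
  "pow_val 3 q 0 = (q 0)^3"
    "pow_val 3 q 1 = (q 0)^2*q 1"
    "pow_val 3 q 2 = 4/5*q 0*(q 1)^2 + 1/5*(q 0)^2*q 2"
    "pow_val 3 q 3 = 2/5*(q 1)^3 + 3/5*q 0*q 1*q 2"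
    "pow_val 3 q 4 = 4/5*(q 1)^2*q 2 + 1/5*q 0*(q 2)^2"
    "pow_val 3 q 5 = q 1*(q 2)^2"
    "pow_val 3 q 6 = (q 2)^3"
  using pow_val.simps(2)[of 2 q]
  by (simp_all add: tv_val_eval pow_val_2)
    (simp_all add: expand)

lemma pow_val_4:
  "pow_val 4 q 0 = (q 0)^4"
    "pow_val 4 q 1 = (q 0)^3*q 1"
    "pow_val 4 q 2 = 6/7*(q 0)^2*(q 1)^2 + 1/7*(q 0)^3*q 2"
    "pow_val 4 q 3 = 4/7*q 0*(q 1)^3 + 3/7*(q 0)^2*q 1*q 2"
    "pow_val 4 q 4 = 8/35*(q 1)^4 + 24/35*q 0*(q 1)^2*q 2 + 3/35*(q 0)^2*(q 2)^2"
    "pow_val 4 q 5 = 4/7*(q 1)^3*q 2 + 3/7*q 0*q 1*(q 2)^2"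
    "pow_val 4 q 6 = 6/7*(q 1)^2*(q 2)^2 + 1/7*q 0*(q 2)^3"
    "pow_val 4 q 7 = q 1*(q 2)^3"
    "pow_val 4 q 8 = (q 2)^4"
  using pow_val.simps(2)[of 3 q]
  by (simp_all add: tv_val_eval pow_val_3)
    (simp_all add: expand)

lemma pow_val_5:
  "pow_val 5 q 0 = (q 0)^5"
    "pow_val 5 q 1 = (q 0)^4*q 1"
    "pow_val 5 q 2 = 8/9*(q 0)^3*(q 1)^2 + 1/9*(q 0)^4*q 2"
    "pow_val 5 q 3 = 2/3*(q 0)^2*(q 1)^3 + 1/3*(q 0)^3*q 1*q 2"
    "pow_val 5 q 4 = 8/21*q 0*(q 1)^4 + 4/7*(q 0)^2*(q 1)^2*q 2 + 1/21*(q 0)^3*(q 2)^2"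
    "pow_val 5 q 5 = 8/63*(q 1)^5 + 40/63*q 0*(q 1)^3*q 2 + 5/21*(q 0)^2*q 1*(q 2)^2"
    "pow_val 5 q 6 = 8/21*(q 1)^4*q 2 + 4/7*q 0*(q 1)^2*(q 2)^2 + 1/21*(q 0)^2*(q 2)^3"
    "pow_val 5 q 7 = 2/3*(q 1)^3*(q 2)^2 + 1/3*q 0*q 1*(q 2)^3"
    "pow_val 5 q 8 = 8/9*(q 1)^2*(q 2)^3 + 1/9*q 0*(q 2)^4"
    "pow_val 5 q 9 = q 1*(q 2)^4"
    "pow_val 5 q 10 = (q 2)^5"
  using pow_val.simps(2)[of 4 q]
  by (simp_all add: tv_val_eval pow_val_4)
    (simp_all add: expand)

lemma pow_val_6:
  "pow_val 6 q 0 = (q 0)^6"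
    "pow_val 6 q 1 = (q 0)^5*q 1"
    "pow_val 6 q 2 = 10/11*(q 0)^4*(q 1)^2 + 1/11*(q 0)^5*q 2"
    "pow_val 6 q 3 = 8/11*(q 0)^3*(q 1)^3 + 3/11*(q 0)^4*q 1*q 2"
    "pow_val 6 q 4 = 16/33*(q 0)^2*(q 1)^4 + 16/33*(q 0)^3*(q 1)^2*q 2 + 1/33*(q 0)^4*(q 2)^2"
    "pow_val 6 q 5 = 8/33*q 0*(q 1)^5 + 20/33*(q 0)^2*(q 1)^3*q 2 + 5/33*(q 0)^3*q 1*(q 2)^2"
    "pow_val 6 q 6 = 16/231*(q 1)^6 + 40/77*q 0*(q 1)^4*q 2 + 30/77*(q 0)^2*(q 1)^2*(q 2)^2 + 5/231*(q 0)^3*(q 2)^3"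
    "pow_val 6 q 7 = 8/33*(q 1)^5*q 2 + 20/33*q 0*(q 1)^3*(q 2)^2 + 5/33*(q 0)^2*q 1*(q 2)^3"
    "pow_val 6 q 8 = 16/33*(q 1)^4*(q 2)^2 + 16/33*q 0*(q 1)^2*(q 2)^3 + 1/33*(q 0)^2*(q 2)^4"
    "pow_val 6 q 9 = 8/11*(q 1)^3*(q 2)^3 + 3/11*q 0*q 1*(q 2)^4"
    "pow_val 6 q 10 = 10/11*(q 1)^2*(q 2)^4 + 1/11*q 0*(q 2)^5"
    "pow_val 6 q 11 = q 1*(q 2)^5"
    "pow_val 6 q 12 = (q 2)^6"
  using pow_val.simps(2)[of 5 q]
  by (simp_all add: tv_val_eval pow_val_5)
    (simp_all add: expand)

lemma pow_val_7:
  "pow_val 7 q 0 = (q 0)^7"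
    "pow_val 7 q 1 = (q 0)^6*q 1"
    "pow_val 7 q 2 = 12/13*(q 0)^5*(q 1)^2 + 1/13*(q 0)^6*q 2"
    "pow_val 7 q 3 = 10/13*(q 0)^4*(q 1)^3 + 3/13*(q 0)^5*q 1*q 2"
    "pow_val 7 q 4 = 80/143*(q 0)^3*(q 1)^4 + 60/143*(q 0)^4*(q 1)^2*q 2 + 3/143*(q 0)^5*(q 2)^2"
    "pow_val 7 q 5 = 48/143*(q 0)^2*(q 1)^5 + 80/143*(q 0)^3*(q 1)^3*q 2 + 15/143*(q 0)^4*q 1*(q 2)^2"
    "pow_val 7 q 6 = 64/429*q 0*(q 1)^6 + 80/143*(q 0)^2*(q 1)^4*q 2 + 40/143*(q 0)^3*(q 1)^2*(q 2)^2 + 5/429*(q 0)^4*(q 2)^3"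
    "pow_val 7 q 7 = 16/429*(q 1)^7 + 56/143*q 0*(q 1)^5*q 2 + 70/143*(q 0)^2*(q 1)^3*(q 2)^2 + 35/429*(q 0)^3*q 1*(q 2)^3"
    "pow_val 7 q 8 = 64/429*(q 1)^6*q 2 + 80/143*q 0*(q 1)^4*(q 2)^2 + 40/143*(q 0)^2*(q 1)^2*(q 2)^3 + 5/429*(q 0)^3*(q 2)^4"
    "pow_val 7 q 9 = 48/143*(q 1)^5*(q 2)^2 + 80/143*q 0*(q 1)^3*(q 2)^3 + 15/143*(q 0)^2*q 1*(q 2)^4"
    "pow_val 7 q 10 = 80/143*(q 1)^4*(q 2)^3 + 60/143*q 0*(q 1)^2*(q 2)^4 + 3/143*(q 0)^2*(q 2)^5"
    "pow_val 7 q 11 = 10/13*(q 1)^3*(q 2)^4 + 3/13*q 0*q 1*(q 2)^5"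
    "pow_val 7 q 12 = 12/13*(q 1)^2*(q 2)^5 + 1/13*q 0*(q 2)^6"
    "pow_val 7 q 13 = q 1*(q 2)^6"
    "pow_val 7 q 14 = (q 2)^7"
  using pow_val.simps(2)[of 6 q]
  by (simp_all add: tv_val_eval pow_val_6)
    (simp_all add: expand)

text \<open>The values of the coefficients of \<open>\<theta>22\<close>, and below of the other covariants, at the quintic with
  coefficients \<open>f\<close>.\<close>

definition val22 :: "(nat \<Rightarrow> complex) \<Rightarrow> nat \<Rightarrow> complex" where "val22 f = tv_val 5 5 4 f f"

definition val26 :: "(nat \<Rightarrow> complex) \<Rightarrow> nat \<Rightarrow> complex" where "val26 f = tv_val 5 5 2 f f"

definition val33 :: "(nat \<Rightarrow> complex) \<Rightarrow> nat \<Rightarrow> complex" where "val33 f = tv_val 2 5 2 (val22 f) f"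

definition val39 :: "(nat \<Rightarrow> complex) \<Rightarrow> nat \<Rightarrow> complex" where "val39 f = tv_val 5 6 1 f (val26 f)"

definition val40 :: "(nat \<Rightarrow> complex) \<Rightarrow> nat \<Rightarrow> complex" where "val40 f = tv_val 2 2 2 (val22 f) (val22 f)"

definition val51 :: "(nat \<Rightarrow> complex) \<Rightarrow> nat \<Rightarrow> complex" where "val51 f = tv_val 4 5 4 (pow_val 2 (val22 f)) f"

definition val80 :: "(nat \<Rightarrow> complex) \<Rightarrow> nat \<Rightarrow> complex" where "val80 f = tv_val 6 6 6 (pow_val 3 (val22 f)) (val26 f)"

definition valF39 :: "(nat \<Rightarrow> complex) \<Rightarrow> nat \<Rightarrow> complex" where "valF39 f = tv_val 5 9 0 f (val39 f)"

definition valU0 :: "(nat \<Rightarrow> complex) \<Rightarrow> nat \<Rightarrow> complex" where "valU0 f = tv_val 3 2 0 (val33 f) (val22 f)"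

definition valV0 :: "(nat \<Rightarrow> complex) \<Rightarrow> nat \<Rightarrow> complex" where "valV0 f = tv_val 1 4 0 (val51 f) (pow_val 2 (val22 f))"

definition valU :: "(nat \<Rightarrow> complex) \<Rightarrow> nat \<Rightarrow> complex" where
  "valU f k = tv_val 3 2 0 (val33 f) (val22 f) k - 1 / 6 * val40 f 0 * f k"

definition valV :: "(nat \<Rightarrow> complex) \<Rightarrow> nat \<Rightarrow> complex" where
  "valV f k = tv_val 1 4 0 (val51 f) (pow_val 2 (val22 f)) k - 2 / 45 * (val40 f 0)\<^sup>2 * f k + 1 / 3 * val80 f 0 * f k"

text \<open>The Hermite invariant of the quintic with coefficients \<open>a, b, 0, 0, c, d\<close>; the functions that follow
  are its partial derivatives.\<close>

definition hermite_slice :: "complex \<Rightarrow> complex \<Rightarrow> complex \<Rightarrow> complex \<Rightarrow> complex" where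
  "hermite_slice a b c d = 82944*b^10*c^5*d^3 + 1920*b^11*c*d^6 - 34560*a*b^9*c^4*d^4 - 384*a*b^10*d^7 + 3840*a^2*b^8*c^3*d^5 - 82944*a^3*b^5*c^10 + 34560*a^4*b^4*c^9*d - 3840*a^5*b^3*c^8*d^2 - 1920*a^6*b*c^11 + 384*a^7*c^10*d"

definition hermite_slice_d0 :: "complex \<Rightarrow> complex \<Rightarrow> complex \<Rightarrow> complex \<Rightarrow> complex" where
  "hermite_slice_d0 a b c d = - 34560*b^9*c^4*d^4 - 384*b^10*d^7 + 7680*a*b^8*c^3*d^5 - 248832*a^2*b^5*c^10 + 138240*a^3*b^4*c^9*d - 19200*a^4*b^3*c^8*d^2 - 11520*a^5*b*c^11 + 2688*a^6*c^10*d"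

definition hermite_slice_d1 :: "complex \<Rightarrow> complex \<Rightarrow> complex \<Rightarrow> complex \<Rightarrow> complex" where
  "hermite_slice_d1 a b c d = 829440*b^9*c^5*d^3 + 21120*b^10*c*d^6 - 311040*a*b^8*c^4*d^4 - 3840*a*b^9*d^7 + 30720*a^2*b^7*c^3*d^5 - 414720*a^3*b^4*c^10 + 138240*a^4*b^3*c^9*d - 11520*a^5*b^2*c^8*d^2 - 1920*a^6*c^11"

definition hermite_slice_d4 :: "complex \<Rightarrow> complex \<Rightarrow> complex \<Rightarrow> complex \<Rightarrow> complex" where
  "hermite_slice_d4 a b c d = 414720*b^10*c^4*d^3 + 1920*b^11*d^6 - 138240*a*b^9*c^3*d^4 + 11520*a^2*b^8*c^2*d^5 - 829440*a^3*b^5*c^9 + 311040*a^4*b^4*c^8*d - 30720*a^5*b^3*c^7*d^2 - 21120*a^6*b*c^10 + 3840*a^7*c^9*d"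

definition hermite_slice_d5 :: "complex \<Rightarrow> complex \<Rightarrow> complex \<Rightarrow> complex \<Rightarrow> complex" where
  "hermite_slice_d5 a b c d = 248832*b^10*c^5*d^2 + 11520*b^11*c*d^5 - 138240*a*b^9*c^4*d^3 - 2688*a*b^10*d^6 + 19200*a^2*b^8*c^3*d^4 + 34560*a^4*b^4*c^9 - 7680*a^5*b^3*c^8*d + 384*a^7*c^10"

lemmas hermite_slice_defs = hermite_slice_def hermite_slice_d0_def hermite_slice_d1_def hermite_slice_d4_def hermite_slice_d5_def

text \<open>The invariance of \<open>H\<close> under the lowering and the raising field determines its derivatives \<open>y2\<close> and
  \<open>y3\<close> across the slice from those along the slice.\<close>

lemma middle_elimination:
  fixes a b c d :: "'a::comm_ring_1"
  assumes "2 * b * y2 = - (a * y1 + 5 * c * y5)" and "2 * c * y3 = - (5 * b * y0 + d * y4)"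
  shows "2 * (b * c * (u0 * y0 + u1 * y1 + u2 * y2 + u3 * y3 + u4 * y4 + u5 * y5)) =
    2 * b * c * (u0 * y0 + u1 * y1 + u4 * y4 + u5 * y5)
    - c * u2 * (a * y1 + 5 * c * y5) - b * u3 * (5 * b * y0 + d * y4)"
proof -
  have "2 * (b * c * (u0 * y0 + u1 * y1 + u2 * y2 + u3 * y3 + u4 * y4 + u5 * y5)) =
    2 * b * c * (u0 * y0 + u1 * y1 + u4 * y4 + u5 * y5) + c * u2 * (2 * b * y2) + b * u3 * (2 * c * y3)"
    by (simp only: distrib_left distrib_right) (simp only: ac_simps)
  then show ?thesis unfolding assms by (simp only: mult_minus_right add_uminus_conv_diff)
qed

context
  fixes f :: "nat \<Rightarrow> complex" and a b c d :: complex
  assumes f: "f 0 = a" "f 1 = b" "f 2 = 0" "f 3 = 0" "f 4 = c" "f 5 = d"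
begin

lemma slice_22:
  "val22 f 0 = 2*a*c"
    "val22 f 1 = - 3*b*c + a*d"
    "val22 f 2 = 2*b*d"
  unfolding val22_def
  by (simp_all add: tv_val_eval f,
    (simp_all add: expand)?)

lemma slice_26:
  "val26 f 0 = - 2*b^2"
    "val26 f 1 = 0"
    "val26 f 2 = 2/5*a*c"
    "val26 f 3 = 7/10*b*c + 1/10*a*d"
    "val26 f 4 = 2/5*b*d"
    "val26 f 5 = 0"
    "val26 f 6 = - 2*c^2"
  unfolding val26_def
  by (simp_all add: tv_val_eval f,
    (simp_all add: expand)?)

lemma slice_33:
  "val33 f 0 = 6*b^2*c"
    "val33 f 1 = 2*b^2*d"
    "val33 f 2 = 2*a*c^2"
    "val33 f 3 = 6*b*c^2"
  unfolding val33_def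
  by (simp_all add: tv_val_eval f slice_22,
    (simp_all add: expand)?)

lemma slice_39:
  "val39 f 0 = 2*b^3"
    "val39 f 1 = 2/9*a^2*c"
    "val39 f 2 = 11/36*a*b*c + 1/36*a^2*d"
    "val39 f 3 = 29/84*b^2*c + 1/12*a*b*d"
    "val39 f 4 = 8/63*b^2*d"
    "val39 f 5 = - 8/63*a*c^2"
    "val39 f 6 = - 29/84*b*c^2 - 1/12*a*c*d"
    "val39 f 7 = - 11/36*b*c*d - 1/36*a*d^2"
    "val39 f 8 = - 2/9*b*d^2"
    "val39 f 9 = - 2*c^3"
  unfolding val39_def
  by (simp_all add: tv_val_eval f slice_26,
    (simp_all add: expand)?)

lemma slice_40:
  "val40 f 0 = - 18*b^2*c^2 + 20*a*b*c*d - 2*a^2*d^2"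
  unfolding val40_def
  by (simp_all add: tv_val_eval f slice_22,
    (simp_all add: expand)?)

lemma slice_51:
  "val51 f 0 = 24*b^3*c*d - 4*a*b^2*d^2 + 4*a^2*c^3"
    "val51 f 1 = 4*b^3*d^2 + 24*a*b*c^3 - 4*a^2*c^2*d"
  unfolding val51_def
  by (simp_all add: tv_val_eval f slice_22 pow_val_2,
    (simp_all add: expand)?)

lemma slice_80:
  "val80 f 0 = 756/5*b^4*c^4 - 16*b^5*d^3 + 144*a*b^3*c^3*d - 432/5*a^2*b^2*c^2*d^2 - 16*a^3*c^5 + 16*a^3*b*c*d^3 - 4/5*a^4*d^4"
  unfolding val80_def
  by (simp_all add: tv_val_eval f slice_22 slice_26 pow_val_3,
    (simp_all add: expand)?)

lemma slice_F39:
  "valF39 f 0 = 2*a*b^3"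
    "valF39 f 1 = 5/7*b^4 + 1/7*a^3*c"
    "valF39 f 2 = 3/13*a^2*b*c + 1/91*a^3*d"
    "valF39 f 3 = 3/13*a*b^2*c + 3/91*a^2*b*d"
    "valF39 f 4 = 155/1001*b^3*c + 51/1001*a*b^2*d"
    "valF39 f 5 = 41/1001*b^3*d - 3/1001*a^2*c^2"
    "valF39 f 6 = - 18/1001*a*b*c^2"
    "valF39 f 7 = 0"
    "valF39 f 8 = 18/1001*b^2*c*d"
    "valF39 f 9 = 3/1001*b^2*d^2 - 41/1001*a*c^3"
    "valF39 f 10 = - 155/1001*b*c^3 - 51/1001*a*c^2*d"
    "valF39 f 11 = - 3/13*b*c^2*d - 3/91*a*c*d^2"
    "valF39 f 12 = - 3/13*b*c*d^2 - 1/91*a*d^3"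
    "valF39 f 13 = - 5/7*c^4 - 1/7*b*d^3"
    "valF39 f 14 = - 2*c^3*d"
  unfolding valF39_def
  by (simp_all add: tv_val_eval f slice_39,
    (simp_all add: expand)?)

lemma slice_U0:
  "valU0 f 0 = 12*a*b^2*c^2"
    "valU0 f 1 = - 36/5*b^3*c^2 + 24/5*a*b^2*c*d"
    "valU0 f 2 = - 12/5*b^3*c*d + 6/5*a*b^2*d^2 + 6/5*a^2*c^3"
    "valU0 f 3 = 6/5*b^3*d^2 - 12/5*a*b*c^3 + 6/5*a^2*c^2*d"
    "valU0 f 4 = - 36/5*b^2*c^3 + 24/5*a*b*c^2*d"
    "valU0 f 5 = 12*b^2*c^2*d"
  unfolding valU0_def
  by (simp_all add: tv_val_eval f slice_33 slice_22,
    (simp_all add: expand)?)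

lemma slice_V0:
  "valV0 f 0 = 96*a^2*b^3*c^3*d - 16*a^3*b^2*c^2*d^2 + 16*a^4*c^5"
    "valV0 f 1 = - 576/5*a*b^4*c^3*d + 304/5*a^2*b^3*c^2*d^2 - 32/5*a^3*b^2*c*d^3 + 16/5*a^4*c^4*d"
    "valV0 f 2 = 432/5*b^5*c^3*d - 312/5*a*b^4*c^2*d^2 - 216/5*a^2*b^2*c^5 + 96/5*a^2*b^3*c*d^3 + 112/5*a^3*b*c^4*d - 8/5*a^3*b^2*d^4 - 8/5*a^4*c^3*d^2"
    "valV0 f 3 = - 216/5*b^5*c^2*d^2 + 432/5*a*b^3*c^5 + 112/5*a*b^4*c*d^3 - 312/5*a^2*b^2*c^4*d - 8/5*a^2*b^3*d^4 + 96/5*a^3*b*c^3*d^2 - 8/5*a^4*c^2*d^3"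
    "valV0 f 4 = - 576/5*a*b^3*c^4*d + 16/5*a*b^4*d^4 + 304/5*a^2*b^2*c^3*d^2 - 32/5*a^3*b*c^2*d^3"
    "valV0 f 5 = 16*b^5*d^4 + 96*a*b^3*c^3*d^2 - 16*a^2*b^2*c^2*d^3"
  unfolding valV0_def
  by (simp_all add: tv_val_eval f slice_51 slice_22 pow_val_2,
    (simp_all add: expand)?)

lemma slice_hermite:
  "(\<Sum>i\<le>14. (- 1) ^ i * of_nat (14 choose i) * pow_val 7 (val22 f) i * valF39 f (14 - i)) = hermite_slice a b c d"
  by (simp add: hermite_slice_def atMost_nat_numeral atMost_numeral_1 choose_complex fact_numeral pow_val_7 slice_22 slice_F39)
    (simp add: expand)

lemma slice_U:
  "valU f 0 = 15*a*b^2*c^2 - 10/3*a^2*b*c*d + 1/3*a^3*d^2"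
    "valU f 1 = - 21/5*b^3*c^2 + 22/15*a*b^2*c*d + 1/3*a^2*b*d^2"
    "valU f 2 = - 12/5*b^3*c*d + 6/5*a*b^2*d^2 + 6/5*a^2*c^3"
    "valU f 3 = 6/5*b^3*d^2 - 12/5*a*b*c^3 + 6/5*a^2*c^2*d"
    "valU f 4 = - 21/5*b^2*c^3 + 22/15*a*b*c^2*d + 1/3*a^2*c*d^2"
    "valU f 5 = 15*b^2*c^2*d - 10/3*a*b*c*d^2 + 1/3*a^2*d^3"
  unfolding valU_def valU0_def[symmetric]
  by (simp_all add: slice_U0 slice_40 f)
    (simp_all add: expand)

lemma slice_V:
  "valV f 0 = 36*a*b^4*c^4 - 16/3*a*b^5*d^3 + 176*a^2*b^3*c^3*d - 592/9*a^3*b^2*c^2*d^2 + 32/3*a^4*c^5 + 80/9*a^4*b*c*d^3 - 4/9*a^5*d^4"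
    "valV f 1 = 36*b^5*c^4 - 16/3*b^6*d^3 - 176/5*a*b^4*c^3*d + 496/45*a^2*b^3*c^2*d^2 - 16/3*a^3*b*c^5 + 112/45*a^3*b^2*c*d^3 + 16/5*a^4*c^4*d - 4/9*a^4*b*d^4"
    "valV f 2 = 432/5*b^5*c^3*d - 312/5*a*b^4*c^2*d^2 - 216/5*a^2*b^2*c^5 + 96/5*a^2*b^3*c*d^3 + 112/5*a^3*b*c^4*d - 8/5*a^3*b^2*d^4 - 8/5*a^4*c^3*d^2"
    "valV f 3 = - 216/5*b^5*c^2*d^2 + 432/5*a*b^3*c^5 + 112/5*a*b^4*c*d^3 - 312/5*a^2*b^2*c^4*d - 8/5*a^2*b^3*d^4 + 96/5*a^3*b*c^3*d^2 - 8/5*a^4*c^2*d^3"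
    "valV f 4 = 36*b^4*c^5 - 16/3*b^5*c*d^3 - 176/5*a*b^3*c^4*d + 16/5*a*b^4*d^4 + 496/45*a^2*b^2*c^3*d^2 - 16/3*a^3*c^6 + 112/45*a^3*b*c^2*d^3 - 4/9*a^4*c*d^4"
    "valV f 5 = 36*b^4*c^4*d + 32/3*b^5*d^4 + 176*a*b^3*c^3*d^2 - 592/9*a^2*b^2*c^2*d^3 - 16/3*a^3*c^5*d + 80/9*a^3*b*c*d^4 - 4/9*a^4*d^5"
  unfolding valV_def valV0_def[symmetric]
  by (simp_all add: slice_V0 slice_40 slice_80 f)
    (simp_all add: expand)

context
  fixes D :: "nat \<Rightarrow> complex"
  assumes D: "D 0 = hermite_slice_d0 a b c d" "D 1 = hermite_slice_d1 a b c d"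
      "D 4 = hermite_slice_d4 a b c d" "D 5 = hermite_slice_d5 a b c d"
    and D2: "2 * b * D 2 = - (a * D 1 + 5 * c * D 5)" and D3: "2 * c * D 3 = - (5 * b * D 0 + d * D 4)"
begin

text \<open>The factor \<open>b c\<close> clears the denominators that arise when the derivatives across the slice are
  expressed by those along the slice.\<close>

lemma slice_polarization_U: "b * c * (\<Sum>k\<le>5. valU f k * D k) = 0"
proof -
  have "(\<Sum>k\<le>5. valU f k * D k) = valU f 0 * D 0 + valU f 1 * D 1 + valU f 2 * D 2 + valU f 3 * D 3 + valU f 4 * D 4 + valU f 5 * D 5"
    by (simp add: atMost_nat_numeral atMost_numeral_1 add_ac)
  then have "2 * (b * c * (\<Sum>k\<le>5. valU f k * D k)) = 2 * b * c * (valU f 0 * D 0 + valU f 1 * D 1 + valU f 4 * D 4 + valU f 5 * D 5)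
      - c * valU f 2 * (a * D 1 + 5 * c * D 5) - b * valU f 3 * (5 * b * D 0 + d * D 4)"
    by (simp only: middle_elimination[OF D2 D3])
  also have "\<dots> = 0"
    unfolding slice_U D hermite_slice_defs by (simp add: expand)
  finally show ?thesis by simp
qed

lemma slice_polarization_V: "b * c * (\<Sum>k\<le>5. valV f k * D k) = 0"
proof -
  have "(\<Sum>k\<le>5. valV f k * D k) = valV f 0 * D 0 + valV f 1 * D 1 + valV f 2 * D 2 + valV f 3 * D 3 + valV f 4 * D 4 + valV f 5 * D 5"
    by (simp add: atMost_nat_numeral atMost_numeral_1 add_ac)
  then have "2 * (b * c * (\<Sum>k\<le>5. valV f k * D k)) = 2 * b * c * (valV f 0 * D 0 + valV f 1 * D 1 + valV f 4 * D 4 + valV f 5 * D 5)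
      - c * valV f 2 * (a * D 1 + 5 * c * D 5) - b * valV f 3 * (5 * b * D 0 + d * D 4)"
    by (simp only: middle_elimination[OF D2 D3])
  also have "\<dots> = 0"
    unfolding slice_V D hermite_slice_defs by (simp add: expand)
  finally show ?thesis by simp
qed

end

end

end


section \<open>The covariants of the quintic\<close>

definition "coeff22 = tv_coeff 5 5 4 coef coef"
definition "coeff26 = tv_coeff 5 5 2 coef coef"
definition "coeff33 = tv_coeff 2 5 2 coeff22 coef"
definition "coeff39 = tv_coeff 5 6 1 coef coeff26"
definition "coeff40 = tv_coeff 2 2 2 coeff22 coeff22"
definition "coeff51 = tv_coeff 4 5 4 (pow_coeff 2 coeff22) coef"
definition "coeff80 = tv_coeff 6 6 6 (pow_coeff 3 coeff22) coeff26"

lemma \<theta>22_nform: "\<theta>22 = nform 2 coeff22"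
  by (simp add: \<theta>22_def coeff22_def quintic_nform transvectant_tv_coeff)

lemma \<theta>26_nform: "\<theta>26 = nform 6 coeff26"
  by (simp add: \<theta>26_def coeff26_def quintic_nform transvectant_tv_coeff)

lemma \<theta>33_nform: "\<theta>33 = nform 3 coeff33"
  by (simp add: \<theta>33_def coeff33_def \<theta>22_nform quintic_nform transvectant_tv_coeff)

lemma \<theta>39_nform: "\<theta>39 = nform 9 coeff39"
  by (simp add: \<theta>39_def coeff39_def \<theta>26_nform quintic_nform transvectant_tv_coeff)

lemma \<theta>40_nform: "\<theta>40 = nform 0 coeff40"
  by (simp add: \<theta>40_def coeff40_def \<theta>22_nform transvectant_tv_coeff)

lemma \<theta>51_nform: "\<theta>51 = nform 1 coeff51"
  by (simp add: \<theta>51_def coeff51_def \<theta>22_nform nform_power quintic_nform transvectant_tv_coeff)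

lemma \<theta>80_nform: "\<theta>80 = nform 0 coeff80"
  by (simp add: \<theta>80_def coeff80_def \<theta>22_nform \<theta>26_nform nform_power transvectant_tv_coeff)

lemma covariant_\<theta>:
  "covariant \<theta>22" "covariant \<theta>26" "covariant \<theta>33" "covariant \<theta>39" "covariant \<theta>40" "covariant \<theta>51" "covariant \<theta>80"
proof -
  show 22: "covariant \<theta>22" and 26: "covariant \<theta>26"
    unfolding \<theta>22_def \<theta>26_def by (intro covariant_transvectant covariant_quintic)+
  show "covariant \<theta>33" "covariant \<theta>39" "covariant \<theta>40" "covariant \<theta>51" "covariant \<theta>80"
    unfolding \<theta>33_def \<theta>39_def \<theta>40_def \<theta>51_def \<theta>80_def
    by (intro covariant_transvectant covariant_quintic covariant_power 22 26)+
qed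

lemma form_degree_\<theta>:
  "form_degree 2 \<theta>22" "form_degree 2 \<theta>26" "form_degree 3 \<theta>33" "form_degree 3 \<theta>39"
  "form_degree 4 \<theta>40" "form_degree 5 \<theta>51" "form_degree 8 \<theta>80"
proof -
  note q = form_degree_quintic
  show 22: "form_degree 2 \<theta>22" and 26: "form_degree 2 \<theta>26"
    unfolding \<theta>22_def \<theta>26_def using form_degree_transvectant[OF q q] by (simp_all del: One_nat_def)
  show "form_degree 3 \<theta>33" unfolding \<theta>33_def using form_degree_transvectant[OF 22 q] by simp
  show "form_degree 3 \<theta>39" unfolding \<theta>39_def using form_degree_transvectant[OF q 26] by (simp del: One_nat_def)
  show "form_degree 4 \<theta>40" unfolding \<theta>40_def using form_degree_transvectant[OF 22 22] by simp
  show "form_degree 5 \<theta>51"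
    unfolding \<theta>51_def using form_degree_transvectant[OF form_degree_power[OF 22, of 2] q] by simp
  show "form_degree 8 \<theta>80"
    unfolding \<theta>80_def using form_degree_transvectant[OF form_degree_power[OF 22, of 3] 26] by simp
qed


section \<open>The Hermite invariant\<close>

lemma hermite_sum:
  "hermite_invariant = (\<Sum>i\<le>14. (- 1) ^ i * of_nat (14 choose i) * pow_coeff 7 coeff22 i * tv_coeff 5 9 0 coef coeff39 (14 - i))"
  and hermite_form: "transvectant 14 14 14 (\<theta>22 ^ 7) (quintic * \<theta>39) = mconst hermite_invariant"
proof -
  let ?S = "\<Sum>i\<le>14. (- 1) ^ i * of_nat (14 choose i) * pow_coeff 7 coeff22 i * tv_coeff 5 9 0 coef coeff39 (14 - i)"
  have "transvectant 14 14 14 (\<theta>22 ^ 7) (quintic * \<theta>39) =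
      transvectant 14 14 14 (nform 14 (pow_coeff 7 coeff22)) (nform 14 (tv_coeff 5 9 0 coef coeff39))"
    by (simp add: \<theta>22_nform \<theta>39_nform quintic_nform nform_power nform_mult)
  also have "\<dots> = mconst ?S"
    unfolding transvectant_nform[OF order_refl order_refl] mconst_sum
    by (intro sum.cong refl) (simp add: nform_0 mconst_mult mconst_power mconst_uminus)
  finally have eq: "transvectant 14 14 14 (\<theta>22 ^ 7) (quintic * \<theta>39) = mconst ?S" .
  show "hermite_invariant = ?S" unfolding hermite_invariant_def eq by (simp add: mconst_def)
  then show "transvectant 14 14 14 (\<theta>22 ^ 7) (quintic * \<theta>39) = mconst hermite_invariant" using eq by simp
qed

lemma hermite_invariance: "polar lowering hermite_invariant = 0" "polar raising hermite_invariant = 0"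
  and hermite_degree: "polar coef hermite_invariant = 18 * hermite_invariant"
proof -
  have "covariant (mconst hermite_invariant)"
    unfolding hermite_form[symmetric]
    by (intro covariant_transvectant covariant_mult covariant_power covariant_\<theta> covariant_quintic)
  then have "covariant (nform 0 (\<lambda>_. hermite_invariant))" by (simp add: nform_0)
  from covariant_nformD[OF this, of 0] show "polar lowering hermite_invariant = 0" "polar raising hermite_invariant = 0" by simp_all
  have "form_degree (7 * 2 + (1 + 3)) (mconst hermite_invariant)"
    unfolding hermite_form[symmetric]
    by (intro form_degree_transvectant form_degree_mult form_degree_power form_degree_\<theta> form_degree_quintic)
  then have "form_degree 18 (nform 0 (\<lambda>_. hermite_invariant))" by (simp add: nform_0)
  from form_degree_nformD[OF this, of 0] show "polar coef hermite_invariant = 18 * hermite_invariant" by simp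
qed

definition grad :: "nat \<Rightarrow> R" where "grad k = mpderiv (of_nat k) hermite_invariant"

lemma polar_hermite: "polar c hermite_invariant = (\<Sum>k\<le>5. c k * grad k)"
  by (simp add: polar_def grad_def)

lemma mpderiv_coef: "j \<le> 5 \<Longrightarrow> k \<le> 5 \<Longrightarrow> mpderiv (of_nat k) (coef j) = (if k = j then 1 else 0)"
  by (simp add: coef_def mpderiv_mvar of_nat_index_eq_iff)

text \<open>The commutator of the Euler field with a partial derivative is minus that partial derivative.\<close>

lemma grad_degree: "polar coef (grad k) = 17 * grad k" if k: "k \<le> 5"
proof -
  have z: "derivation (\<lambda>p. - mpderiv (of_nat k) p :: R)"
    using derivation_scaled[OF derivation_mpderiv, of "- 1"] by simp
  have "polar coef (mpderiv (of_nat k) p) - mpderiv (of_nat k) (polar coef p) = - mpderiv (of_nat k) p" for p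
    by (rule derivation_R_eqI[OF derivation_commutator[OF derivation_polar derivation_mpderiv] z])
      (simp_all add: k polar_coef mpderiv_coef derivation_simps[OF derivation_mpderiv] derivation_simps[OF derivation_polar])
  from this[of hermite_invariant] show ?thesis
    by (simp add: grad_def hermite_degree derivation_simps[OF derivation_mpderiv] algebra_simps)
qed

lemma ev_hermite_slice:
  assumes "s 2 = 0" "s 3 = 0"
  shows "ev s hermite_invariant = (\<Sum>i\<le>14. (- 1) ^ i * of_nat (14 choose i) * pow_val 7 (val22 (\<lambda>i. ev s (coef i))) i *
     valF39 (\<lambda>i. ev s (coef i)) (14 - i))"
  unfolding hermite_sum
  by (simp add: ev.hom_sum ev.hom_mult ev.hom_power ev.hom_uminus ev.hom_of_nat ev_pow_coeff ev_tv_coeff val22_def valF39_def val39_def val26_def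
      coeff22_def coeff39_def coeff26_def)

lemma slice_value:
  assumes s: "s 0 = a" "s 1 = b" "s 2 = 0" "s 3 = 0" "s 4 = c" "s 5 = d"
  shows "ev s hermite_invariant = hermite_slice a b c d"
  unfolding ev_hermite_slice[OF s(3,4)] by (rule slice_hermite) (simp_all add: ev_coef s[unfolded One_nat_def])

lemma slice_derivative:
  assumes "k \<le> 5" "\<And>t. ev (s(k := t)) hermite_invariant = P t" "(P has_field_derivative D) (at (s k))"
  shows "ev s (grad k) = D"
proof -
  have "(P has_field_derivative ev s (grad k)) (at (s k))"
    using ev_has_field_derivative[OF assms(1), of s hermite_invariant "s k"] by (simp add: assms(2) grad_def)
  then show ?thesis using assms(3) DERIV_unique by blast
qed

lemma slice_gradient:
  assumes s: "s 0 = a" "s 1 = b" "s 2 = 0" "s 3 = 0" "s 4 = c" "s 5 = d"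
  shows "ev s (grad 0) = hermite_slice_d0 a b c d" "ev s (grad 1) = hermite_slice_d1 a b c d"
    "ev s (grad 4) = hermite_slice_d4 a b c d" "ev s (grad 5) = hermite_slice_d5 a b c d"
proof -
  show "ev s (grad 0) = hermite_slice_d0 a b c d"
    by (rule slice_derivative[where P = "\<lambda>t. hermite_slice t b c d"], simp, rule slice_value)
      (use s in \<open>auto intro!: derivative_eq_intros simp: hermite_slice_defs\<close>)
  show "ev s (grad 1) = hermite_slice_d1 a b c d"
    by (rule slice_derivative[where P = "\<lambda>t. hermite_slice a t c d"], simp, rule slice_value)
      (use s in \<open>auto intro!: derivative_eq_intros simp: hermite_slice_defs\<close>)
  show "ev s (grad 4) = hermite_slice_d4 a b c d"
    by (rule slice_derivative[where P = "\<lambda>t. hermite_slice a b t d"], simp, rule slice_value)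
      (use s in \<open>auto intro!: derivative_eq_intros simp: hermite_slice_defs\<close>)
  show "ev s (grad 5) = hermite_slice_d5 a b c d"
    by (rule slice_derivative[where P = "\<lambda>t. hermite_slice a b c t"], simp, rule slice_value)
      (use s in \<open>auto intro!: derivative_eq_intros simp: hermite_slice_defs\<close>)
qed

text \<open>The first relation is the invariance under the lowering field, the second under the raising field.\<close>

lemma slice_gradient_middle:
  assumes s: "s 0 = a" "s 1 = b" "s 2 = 0" "s 3 = 0" "s 4 = c" "s 5 = d"
  shows "2 * b * ev s (grad 2) = - (a * ev s (grad 1) + 5 * c * ev s (grad 5))"
    and "2 * c * ev s (grad 3) = - (5 * b * ev s (grad 0) + d * ev s (grad 4))"
proof -
  have middle: "y = - (x + z)" if "x + y + z = 0" for x y z :: complex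
  proof -
    have "y = (x + y + z) - (x + z)" by simp
    then show ?thesis unfolding that by simp
  qed
  note e = ev.hom_sum ev.hom_add ev.hom_mult ev.hom_of_nat ev.hom_numeral ev_coef s lowering_def raising_def
    atMost_nat_numeral atMost_numeral_1 One_nat_def[symmetric]
  have "ev s (polar lowering hermite_invariant) = a * ev s (grad 1) + 2 * b * ev s (grad 2) + 5 * c * ev s (grad 5)"
    unfolding polar_hermite by (simp add: e del: One_nat_def)
  then have "a * ev s (grad 1) + 2 * b * ev s (grad 2) + 5 * c * ev s (grad 5) = 0"
    unfolding hermite_invariance by simp
  then show "2 * b * ev s (grad 2) = - (a * ev s (grad 1) + 5 * c * ev s (grad 5))" by (rule middle)
  have "ev s (polar raising hermite_invariant) = 5 * b * ev s (grad 0) + 2 * c * ev s (grad 3) + d * ev s (grad 4)"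
    unfolding polar_hermite by (simp add: e del: One_nat_def)
  then have "5 * b * ev s (grad 0) + 2 * c * ev s (grad 3) + d * ev s (grad 4) = 0"
    unfolding hermite_invariance by simp
  then show "2 * c * ev s (grad 3) = - (5 * b * ev s (grad 0) + d * ev s (grad 4))" by (rule middle)
qed

definition coeffU :: "nat \<Rightarrow> R" where
  "coeffU k = tv_coeff 3 2 0 coeff33 coeff22 k - mconst (1 / 6) * coeff40 0 * coef k"

definition coeffV :: "nat \<Rightarrow> R" where
  "coeffV k = tv_coeff 1 4 0 coeff51 (pow_coeff 2 coeff22) k - mconst (2 / 45) * (coeff40 0)\<^sup>2 * coef k + mconst (1 / 3) * coeff80 0 * coef k"

lemma form_U_nform: "form_U (1 / 6) = nform 5 coeffU"
proof -
  have "form_U (1 / 6) = nform 5 (tv_coeff 3 2 0 coeff33 coeff22) - mconst (mconst (1 / 6) * coeff40 0) * nform 5 coef"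
    by (simp add: form_U_def scalar_def of_rat_divide \<theta>33_nform \<theta>22_nform \<theta>40_nform quintic_nform nform_mult nform_0 mconst_mult)
  then show ?thesis by (simp add: nform_mconst_mult nform_diff coeffU_def[abs_def])
qed

lemma form_V_nform: "form_V (2 / 45) (- 1 / 3) = nform 5 coeffV"
proof -
  have "form_V (2 / 45) (- 1 / 3) = nform 5 (tv_coeff 1 4 0 coeff51 (pow_coeff 2 coeff22)) - mconst (mconst (2 / 45) * (coeff40 0)\<^sup>2) * nform 5 coef
      + mconst (mconst (1 / 3) * coeff80 0) * nform 5 coef"
    by (simp add: form_V_def scalar_def of_rat_divide of_rat_minus \<theta>51_nform \<theta>22_nform nform_power \<theta>40_nform \<theta>80_nform quintic_nform
        nform_mult nform_0 mconst_mult mconst_power mconst_uminus)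
  then show ?thesis by (simp add: nform_mconst_mult nform_diff nform_add coeffV_def[abs_def])
qed

lemma covariant_U: "covariant (nform 5 coeffU)" and covariant_V: "covariant (nform 5 coeffV)"
  unfolding form_U_nform[symmetric] form_V_nform[symmetric] form_U_def form_V_def
  by (intro covariant_diff covariant_mult covariant_scalar covariant_\<theta> covariant_quintic covariant_power)+

lemma form_degree_U: "form_degree 5 (nform 5 coeffU)"
proof -
  have "form_degree 5 (scalar c * \<theta>40 * quintic)" for c
    using form_degree_mult[OF form_degree_mult[OF form_degree_scalar form_degree_\<theta>(5)] form_degree_quintic] by simp
  moreover have "form_degree 5 (\<theta>33 * \<theta>22)"
    using form_degree_mult[OF form_degree_\<theta>(3,1)] by simp
  ultimately show ?thesis
    unfolding form_U_nform[symmetric] form_U_def by (intro form_degree_diff)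
qed

lemma form_degree_V: "form_degree 9 (nform 5 coeffV)"
proof -
  have "form_degree 9 (scalar c * \<theta>40\<^sup>2 * quintic)" for c
    using form_degree_mult[OF form_degree_mult[OF form_degree_scalar form_degree_power[OF form_degree_\<theta>(5), of 2]] form_degree_quintic]
    by simp
  moreover have "form_degree 9 (scalar c * \<theta>80 * quintic)" for c
    using form_degree_mult[OF form_degree_mult[OF form_degree_scalar form_degree_\<theta>(7)] form_degree_quintic] by simp
  moreover have "form_degree 9 (\<theta>51 * \<theta>22\<^sup>2)"
    using form_degree_mult[OF form_degree_\<theta>(6) form_degree_power[OF form_degree_\<theta>(1), of 2]] by simp
  ultimately show ?thesis
    unfolding form_V_nform[symmetric] form_V_def by (intro form_degree_diff)
qed

lemma ev_coeffU: "ev s (coeffU k) = valU (\<lambda>i. ev s (coef i)) k"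
  by (simp add: coeffU_def ev.hom_minus ev.hom_mult ev_tv_coeff valU_def val40_def val33_def val22_def coeff33_def coeff40_def coeff22_def)

lemma ev_coeffV: "ev s (coeffV k) = valV (\<lambda>i. ev s (coef i)) k"
  by (simp add: coeffV_def ev.hom_minus ev.hom_add ev.hom_mult ev.hom_power ev_tv_coeff ev_pow_coeff valV_def val40_def val51_def val80_def val22_def
      val26_def coeff51_def coeff40_def coeff80_def coeff26_def coeff22_def)

text \<open>A priori this is an invariant of degree 22, the degree of \<open>\<theta>40\<close> times the Hermite invariant; the
  coefficient \<open>1/6\<close> of \<open>\<theta>40\<close> in \<open>\<U>\<close> makes it vanish on the slice.\<close>

lemma polarization_U: "polar coeffU hermite_invariant = 0"
proof (rule invariant_zero_if_zero_on_slice)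
  show "polar lowering (polar coeffU hermite_invariant) = 0" "polar raising (polar coeffU hermite_invariant) = 0"
    using polarization_invariant[of coeffU hermite_invariant] covariant_nformD[OF covariant_U] hermite_invariance by simp_all
  fix s :: "nat \<Rightarrow> complex" assume "s 2 = 0" "s 3 = 0"
  then have s: "s 0 = s 0" "s 1 = s 1" "s 2 = 0" "s 3 = 0" "s 4 = s 4" "s 5 = s 5" by simp_all
  have f: "ev s (coef 0) = s 0" "ev s (coef 1) = s 1" "ev s (coef 2) = 0" "ev s (coef 3) = 0" "ev s (coef 4) = s 4" "ev s (coef 5) = s 5"
    using s by (simp_all add: ev_coef)
  show "s 1 * s 4 * ev s (polar coeffU hermite_invariant) = 0"
    using slice_polarization_U[OF f, where D = "\<lambda>k. ev s (grad k)", OF slice_gradient[OF s] slice_gradient_middle[OF s]]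
    unfolding polar_hermite ev.hom_sum ev.hom_mult ev_coeffU .
qed

text \<open>The invariants of degree 26 that occur are multiples of \<open>\<theta>40\<^sup>2 H\<close> and \<open>\<theta>80 H\<close>; the two
  constants \<open>2/45\<close> and \<open>-1/3\<close> cancel them.\<close>

lemma polarization_V: "polar coeffV hermite_invariant = 0"
proof (rule invariant_zero_if_zero_on_slice)
  show "polar lowering (polar coeffV hermite_invariant) = 0" "polar raising (polar coeffV hermite_invariant) = 0"
    using polarization_invariant[of coeffV hermite_invariant] covariant_nformD[OF covariant_V] hermite_invariance by simp_all
  fix s :: "nat \<Rightarrow> complex" assume "s 2 = 0" "s 3 = 0"
  then have s: "s 0 = s 0" "s 1 = s 1" "s 2 = 0" "s 3 = 0" "s 4 = s 4" "s 5 = s 5" by simp_all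
  have f: "ev s (coef 0) = s 0" "ev s (coef 1) = s 1" "ev s (coef 2) = 0" "ev s (coef 3) = 0" "ev s (coef 4) = s 4" "ev s (coef 5) = s 5"
    using s by (simp_all add: ev_coef)
  show "s 1 * s 4 * ev s (polar coeffV hermite_invariant) = 0"
    using slice_polarization_V[OF f, where D = "\<lambda>k. ev s (grad k)", OF slice_gradient[OF s] slice_gradient_middle[OF s]]
    unfolding polar_hermite ev.hom_sum ev.hom_mult ev_coeffV .
qed


section \<open>The Jacobian ideal is the ideal of maximal minors\<close>

text \<open>The first three rows are the raising, the weight and the lowering field, with the factors that the
  transvectants of the quintic with \<open>x\<^sub>1\<^sup>2\<close>, \<open>x\<^sub>1 x\<^sub>2\<close> and \<open>x\<^sub>2\<^sup>2\<close> produce.\<close>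

definition field_rows :: "nat \<Rightarrow> nat \<Rightarrow> R" where
  "field_rows i k =
     (if i = 0 then mconst (1 / 5) * raising k
      else if i = 1 then mconst (1 / 10) * (of_int (2 * int k - 5) * coef k)
      else if i = 2 then mconst (- 1 / 5) * lowering k
      else if i = 3 then coeffU k else coeffV k)"

lemma transvectant_first: "transvectant 2 5 1 A quintic = mconst (mconst (1 / 10)) * (D1 A * D2 quintic - D2 A * D1 quintic)"
  by (simp add: transvectant_omega scalar_def fact_numeral)

lemma rows_first: "transvectant 2 5 1 (x1\<^sup>2) quintic = nform 5 (field_rows 0)"
proof -
  have "transvectant 2 5 1 (x1\<^sup>2) quintic = mconst (mconst (1 / 10)) * (of_nat 2 * (x1 * D2 quintic))"
    unfolding transvectant_first by (simp add: derivation_simps[OF derivation_D1] derivation_simps[OF derivation_D2] D_simps mult_ac)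
  also have "\<dots> = nform 5 (\<lambda>k. mconst (1 / 10) * (of_nat 2 * raising k))"
    unfolding quintic_nform x1_D2_nform of_nat_mult_nform nform_mconst_mult raising_def ..
  also have "\<dots> = nform 5 (field_rows 0)"
    by (rule nform_cong) (simp add: field_rows_def mconst_mult[symmetric] mult.assoc[symmetric] flip: mconst_numeral)
  finally show ?thesis .
qed

lemma rows_second: "transvectant 2 5 1 (x1 * x2) quintic = nform 5 (field_rows 1)"
proof -
  have "transvectant 2 5 1 (x1 * x2) quintic = mconst (mconst (1 / 10)) * (x2 * D2 quintic - x1 * D1 quintic)"
    unfolding transvectant_first by (simp add: derivation_simps[OF derivation_D1] derivation_simps[OF derivation_D2] D_simps mult_ac)
  also have "\<dots> = nform 5 (\<lambda>k. mconst (1 / 10) * (of_nat k * coef k - of_nat (5 - k) * coef k))"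
    unfolding quintic_nform x1_D1_nform x2_D2_nform nform_diff nform_mconst_mult ..
  also have "\<dots> = nform 5 (field_rows 1)"
    by (rule nform_cong) (simp add: field_rows_def of_nat_diff algebra_simps)
  finally show ?thesis .
qed

lemma rows_third: "transvectant 2 5 1 (x2\<^sup>2) quintic = nform 5 (field_rows 2)"
proof -
  have "transvectant 2 5 1 (x2\<^sup>2) quintic = mconst (mconst (- 1 / 10)) * (of_nat 2 * (x2 * D1 quintic))"
    unfolding transvectant_first
    by (simp add: derivation_simps[OF derivation_D1] derivation_simps[OF derivation_D2] D_simps mult_ac mconst_uminus)
  also have "\<dots> = nform 5 (\<lambda>k. mconst (- 1 / 10) * (of_nat 2 * lowering k))"
    unfolding quintic_nform x2_D1_nform of_nat_mult_nform nform_mconst_mult lowering_def ..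
  also have "\<dots> = nform 5 (field_rows 2)"
    by (rule nform_cong) (simp add: field_rows_def mconst_mult[symmetric] mult.assoc[symmetric] flip: mconst_numeral)
  finally show ?thesis .
qed

lemma form_Gamma_minors:
  "form_Gamma (1 / 6, 2 / 45, - 1 / 3) =
     bform 5 (\<lambda>k. mconst (- (120 ^ 5) * (- 1) ^ (5 - k)) * signed_minor 5 field_rows (5 - k))"
proof -
  have seq: "field_rows 3 = coeffU" "field_rows 4 = coeffV" by (simp_all add: field_rows_def fun_eq_iff)
  have "map (\<lambda>i. nform 5 (field_rows i)) [0..<5] =
      [nform 5 (field_rows 0), nform 5 (field_rows 1), nform 5 (field_rows 2), nform 5 coeffU, nform 5 coeffV]"
    by (simp add: seq upt_conv_Cons One_nat_def[symmetric] del: One_nat_def)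
  then show ?thesis
    unfolding wronskian_quintics[symmetric] form_Gamma_def case_prod_conv rows_first rows_second rows_third
      form_U_nform form_V_nform by simp
qed

lemma rows_grad: "i < 5 \<Longrightarrow> (\<Sum>k\<le>5. field_rows i k * grad k) = 0"
proof -
  assume "i < 5"
  then consider "i = 0" | "i = 1" | "i = 2" | "i = 3" | "i = 4" by linarith
  then show ?thesis
  proof cases
    case 1
    have "(\<Sum>k\<le>5. field_rows i k * grad k) = mconst (1 / 5) * polar raising hermite_invariant"
      by (simp add: 1 field_rows_def polar_hermite sum_distrib_left mult.assoc)
    then show ?thesis by (simp add: hermite_invariance)
  next
    case 2
    have "(\<Sum>k\<le>5. field_rows i k * grad k) = mconst (1 / 10) * (\<Sum>k\<le>5. of_int (2 * int k - 5) * coef k * mpderiv (of_nat k) hermite_invariant)"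
      unfolding sum_distrib_left by (intro sum.cong refl) (simp add: 2 field_rows_def grad_def mult.assoc)
    then show ?thesis by (simp only: weight_invariant[OF hermite_invariance] mult_zero_right)
  next
    case 3
    have "(\<Sum>k\<le>5. field_rows i k * grad k) = mconst (- 1 / 5) * polar lowering hermite_invariant"
      by (simp add: 3 field_rows_def polar_hermite sum_distrib_left mult.assoc)
    then show ?thesis by (simp add: hermite_invariance)
  next
    case 4
    then show ?thesis using polarization_U by (simp add: field_rows_def polar_hermite)
  next
    case 5
    then show ?thesis using polarization_V by (simp add: field_rows_def polar_hermite)
  qed
qed

definition row_degree :: "nat \<Rightarrow> nat" where
  "row_degree i = (if i < 3 then 1 else if i = 3 then 5 else 9)"

lemma rows_degree: "i < 5 \<Longrightarrow> k \<le> 5 \<Longrightarrow> polar coef (field_rows i k) = of_nat (row_degree i) * field_rows i k"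
proof -
  assume i: "i < 5" and k: "k \<le> 5"
  note s = derivation_simps[OF derivation_polar]
  have int: "polar coef (of_int z) = 0" for z
    by (cases z rule: int_cases2) (simp_all add: s)
  have low: "polar coef (lowering k) = lowering k" using k by (simp add: lowering_def s polar_coef)
  have rai: "polar coef (raising k) = raising k" using k by (cases "k = 5") (simp_all add: raising_def s polar_coef)
  have wt: "polar coef (mconst (1 / 10) * (of_int z * coef k)) = mconst (1 / 10) * (of_int z * coef k)" for z
    by (simp add: derivation_mult[OF derivation_polar] int polar_coef k)
  from i consider "i = 0" | "i = 1" | "i = 2" | "i = 3" | "i = 4" by linarith
  then show ?thesis
  proof cases
    case 2
    then show ?thesis
      unfolding field_rows_def row_degree_def using wt[of "2 * int k - 5"] by simp
  qed (simp_all add: field_rows_def row_degree_def derivation_mult[OF derivation_polar] low rai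
      form_degree_nformD[OF form_degree_U k] form_degree_nformD[OF form_degree_V k])
qed

lemma minor_degree: "j \<le> 5 \<Longrightarrow> polar coef (signed_minor 5 field_rows j) = 17 * signed_minor 5 field_rows j"
proof -
  let ?A = "\<lambda>i k. field_rows i (if k < j then k else Suc k)"
  have d: "polar coef (det (mat 5 5 (\<lambda>(i, k). ?A i k))) = of_nat (\<Sum>i<5. row_degree i) * det (mat 5 5 (\<lambda>(i, k). ?A i k))"
    by (rule det_euler[OF derivation_polar]) (auto intro: rows_degree)
  have n: "(\<Sum>i<5. row_degree i) = 17" by (simp add: row_degree_def lessThan_nat_numeral)
  have s: "polar coef ((- 1) ^ (5 + j) * x) = (- 1) ^ (5 + j) * polar coef x" for x
    by (simp add: derivation_simps[OF derivation_polar])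
  show ?thesis unfolding signed_minor_def s d n by (simp only: of_nat_numeral mult.left_commute)
qed

text \<open>The quintics \<open>x\<^sub>1\<^sup>5 + 5 x\<^sub>1 x\<^sub>2\<^sup>4\<close> and \<open>5 x\<^sub>1\<^sup>4 x\<^sub>2 + x\<^sub>2\<^sup>5\<close>. Their pencil lies in the slice, and on it the
  partial derivatives with respect to \<open>a\<^sub>5\<close> and \<open>a\<^sub>0\<close> are, up to a constant and a power of the
  parameter, quartics in the fourth power of the parameter.\<close>

definition pencil_dir :: "nat \<Rightarrow> complex" where "pencil_dir = (\<lambda>k. if k = 0 \<or> k = 4 then 1 else 0)"

definition pencil_base :: "nat \<Rightarrow> complex" where "pencil_base = (\<lambda>k. if k = 1 \<or> k = 5 then 1 else 0)"

lemma grad_at_origin: "k \<le> 5 \<Longrightarrow> ev (\<lambda>_. 0) (grad k) = 0"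
proof -
  assume k: "k \<le> 5"
  have "ev (\<lambda>_. 0) (polar coef (grad k)) = 0"
    by (simp add: polar_def ev.hom_sum ev.hom_mult ev_coef)
  then show ?thesis by (simp add: grad_degree[OF k] ev.hom_mult ev.hom_numeral)
qed

lemma regular_grad: "regular_sequence [grad 5, grad 0]"
proof (rule regular_sequence_homogeneous_pair[where d = 17 and f = pencil_dir and s = pencil_base])
  show "polar coef (grad 5) = of_nat 17 * grad 5" "polar coef (grad 0) = of_nat 17 * grad 0" by (simp_all add: grad_degree)
  have s: "pencil_dir 0 = 1" "pencil_dir 1 = 0" "pencil_dir 2 = 0" "pencil_dir 3 = 0" "pencil_dir 4 = 1" "pencil_dir 5 = 0" by (simp_all add: pencil_dir_def)
  show "ev pencil_dir (grad 5) \<noteq> 0" using slice_gradient(4)[OF s] by (simp add: hermite_slice_d5_def)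
  show "ideal_gen {grad 5, grad 0} \<noteq> UNIV"
    by (rule ideal_gen_proper[of _ "\<lambda>_. 0"]) (auto simp: grad_at_origin)
  let ?f = "map_poly (ev pencil_base) (taylor (point pencil_dir) (grad 5))" and ?g = "map_poly (ev pencil_base) (taylor (point pencil_dir) (grad 0))"
  have z: "pencil_base 0 + z * pencil_dir 0 = z" "pencil_base 1 + z * pencil_dir 1 = 1" "pencil_base 2 + z * pencil_dir 2 = 0" "pencil_base 3 + z * pencil_dir 3 = 0"
    "pencil_base 4 + z * pencil_dir 4 = z" "pencil_base 5 + z * pencil_dir 5 = 1" for z by (simp_all add: pencil_dir_def pencil_base_def)
  have f: "poly ?f z = 384 * z * ((z ^ 4) ^ 4 + 70 * (z ^ 4) ^ 3 + 338 * z ^ 4 + 23)" for z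
    unfolding taylor_eval slice_gradient(4)[OF z] hermite_slice_d5_def by (simp add: expand)
  have g: "poly ?g z = - 384 * (23 * (z ^ 4) ^ 4 + 338 * (z ^ 4) ^ 3 + 70 * z ^ 4 + 1)" for z
    unfolding taylor_eval slice_gradient(1)[OF z] hermite_slice_d0_def by (simp add: expand)
  show "coprime ?f ?g"
  proof (rule coprime_if_no_common_root)
    show "?f \<noteq> 0"
    proof
      assume "?f = 0"
      then have "poly ?f 1 = 0" by simp
      then show False unfolding f by simp
    qed
    fix z assume fz: "poly ?f z = 0" and gz: "poly ?g z = 0"
    define u where "u = z ^ 4"
    have B: "23 * u ^ 4 + 338 * u ^ 3 + 70 * u + 1 = 0" using gz unfolding g u_def mult_eq_0_iff by simp
    show False
    proof (cases "z = 0")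
      case True
      then show False using B by (simp add: u_def)
    next
      case False
      then have A: "u ^ 4 + 70 * u ^ 3 + 338 * u + 23 = 0" using fz unfolding f u_def by simp
      \<comment> \<open>Bezout coefficients of the two quartics in \<open>u\<close>, with denominators cleared\<close>
      have "33841152 = (1851355 - 612361 * u + 8690393 * u ^ 2 + 594205 * u ^ 3) * (u ^ 4 + 70 * u ^ 3 + 338 * u + 23) +
          (- 8740013 + 127223 * u - 1806631 * u ^ 2 - 25835 * u ^ 3) * (23 * u ^ 4 + 338 * u ^ 3 + 70 * u + 1)"
        by (simp add: expand)
      then show False unfolding A B by simp
    qed
  qed
qed simp

lemma minors_multiple_of_gradient: "\<exists>c. \<forall>k\<le>5. signed_minor 5 field_rows k = c * grad k"
proof -
  have "\<exists>c. \<forall>k\<in>{..5}. signed_minor 5 field_rows k = c * grad k"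
  proof (rule proportional_imp_multiple[OF finite_atMost regular_grad])
    show "grad 5 \<in> ideal_gen (grad ` {..5})" "grad 0 \<in> ideal_gen (grad ` {..5})" by (auto intro: ideal_gen_base)
    fix k l :: nat assume "k \<in> {..5}" "l \<in> {..5}"
    then have "grad k * signed_minor 5 field_rows l = signed_minor 5 field_rows k * grad l"
      by (intro kernel_proportional_to_minors rows_grad) auto
    then show "signed_minor 5 field_rows l * grad k = grad l * signed_minor 5 field_rows k" by (simp add: mult.commute)
  qed
  then show ?thesis by auto
qed

text \<open>At the quintic \<open>5 x\<^sub>1\<^sup>4 x\<^sub>2 + x\<^sub>2\<^sup>5\<close> the submatrix without the first column has so few nonzero entries
  that its kernel can be read off.\<close>

lemma minor_nonzero: "signed_minor 5 field_rows 0 \<noteq> 0"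
proof
  assume "signed_minor 5 field_rows 0 = 0"
  then have "det (mat 5 5 (\<lambda>(i, k). field_rows i (Suc k))) = 0" by (simp add: signed_minor_def)
  then have "ev pencil_base (det (mat 5 5 (\<lambda>(i, k). field_rows i (Suc k)))) = 0" by simp
  then have "det (map_mat (ev pencil_base) (mat 5 5 (\<lambda>(i, k). field_rows i (Suc k)))) = 0" by simp
  moreover have "map_mat (ev pencil_base) (mat 5 5 (\<lambda>(i, k). field_rows i (Suc k))) = mat 5 5 (\<lambda>(i, k). ev pencil_base (field_rows i (Suc k)))"
    by (rule eq_matI) auto
  ultimately have "det (mat 5 5 (\<lambda>(i, k). ev pencil_base (field_rows i (Suc k)))) = 0" by simp
  then obtain v where v: "v \<in> carrier_vec 5" "v \<noteq> 0\<^sub>v 5" "mat 5 5 (\<lambda>(i, k). ev pencil_base (field_rows i (Suc k))) *\<^sub>v v = 0\<^sub>v 5"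
    using det_0_iff_vec_prod_zero_field[of "mat 5 5 (\<lambda>(i, k). ev pencil_base (field_rows i (Suc k)))" 5] by auto
  have s: "pencil_base 0 = 0" "pencil_base 1 = 1" "pencil_base 2 = 0" "pencil_base 3 = 0" "pencil_base 4 = 0" "pencil_base 5 = 1" by (simp_all add: pencil_base_def)
  have f: "ev pencil_base (coef 0) = 0" "ev pencil_base (coef 1) = 1" "ev pencil_base (coef 2) = 0" "ev pencil_base (coef 3) = 0" "ev pencil_base (coef 4) = 0" "ev pencil_base (coef 5) = 1"
    by (simp_all add: ev_coef s[unfolded One_nat_def])
  have eq: "(\<Sum>k<5. ev pencil_base (field_rows i (Suc k)) * v $ k) = 0" if "i < 5" for i
  proof -
    have "(mat 5 5 (\<lambda>(i, k). ev pencil_base (field_rows i (Suc k))) *\<^sub>v v) $ i = (\<Sum>k<5. ev pencil_base (field_rows i (Suc k)) * v $ k)"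
      using that v(1) by (simp add: scalar_prod_def atLeast0LessThan)
    then show ?thesis using that by (simp add: v(3))
  qed
  have U: "ev pencil_base (coeffU 1) = 0" "ev pencil_base (coeffU 2) = 0" "ev pencil_base (coeffU 3) = 6 / 5" "ev pencil_base (coeffU 4) = 0" "ev pencil_base (coeffU 5) = 0"
    using slice_U[OF f] by (simp_all add: ev_coeffU)
  have V: "ev pencil_base (coeffV 1) = - 16 / 3" "ev pencil_base (coeffV 2) = 0" "ev pencil_base (coeffV 3) = 0" "ev pencil_base (coeffV 4) = 0" "ev pencil_base (coeffV 5) = 32 / 3"
    using slice_V[OF f] by (simp_all add: ev_coeffV)
  have l1: "{..<1::nat} = {0}" by auto
  note e = lessThan_nat_numeral l1 ev.hom_uminus field_rows_def raising_def lowering_def ev.hom_mult ev.hom_of_nat ev.hom_of_int ev.hom_numeral f U V One_nat_def[symmetric]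
  have "v $ 3 = 0" using eq[of 0] by (simp add: e del: One_nat_def)
  moreover have "v $ 1 = 0" using eq[of 2] by (simp add: e del: One_nat_def)
  moreover have "v $ 2 = 0" using eq[of 3] by (simp add: e del: One_nat_def)
  moreover have "v $ 0 = 0 \<and> v $ 4 = 0"
  proof -
    have e1: "5 * v $ 4 = 3 * v $ 0" using eq[of 1] by (simp add: e del: One_nat_def)
    have "2 * v $ 4 = v $ 0" using eq[of 4] by (simp add: e del: One_nat_def)
    then have e2: "v $ 0 = 2 * v $ 4" by (rule sym)
    from e1 have "v $ 4 = 0" unfolding e2 by simp
    then show ?thesis using e2 by simp
  qed
  ultimately have "v = 0\<^sub>v 5"
    using v(1) by (intro eq_vecI) (auto simp: less_Suc_eq numeral_eq_Suc)
  then show False using v(2) by simp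
qed

text \<open>Minors and gradient are both homogeneous of degree 17, so the factor between them is annihilated by
  the Euler field.\<close>

lemma minors_constant_multiple: "\<exists>c. c \<noteq> 0 \<and> (\<forall>k\<le>5. signed_minor 5 field_rows k = mconst c * grad k)"
proof -
  obtain c where c: "\<And>k. k \<le> 5 \<Longrightarrow> signed_minor 5 field_rows k = c * grad k" using minors_multiple_of_gradient by blast
  have g0: "grad 0 \<noteq> 0" using minor_nonzero c[of 0] by auto
  have "17 * (c * grad 0) = polar coef c * grad 0 + c * (17 * grad 0)"
    using minor_degree[of 0] by (simp add: c derivation_mult[OF derivation_polar] grad_degree)
  then have "polar coef c * grad 0 = 0" by (simp add: algebra_simps)
  then have "polar coef c = 0" using g0 by simp
  then have hom: "polar coef c = of_nat 0 * c" by simp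
  have "c = mconst (lookup c 0)"
  proof (rule poly_mapping_eqI)
    fix m
    show "lookup c m = lookup (mconst (lookup c 0)) m"
    proof (cases "m \<in> keys c")
      case True
      then have "total_degree m = 0" by (rule euler_homogeneous[OF hom])
      then have "m = 0" by (intro poly_mapping_eqI) (simp add: total_degree_def)
      then show ?thesis by (simp add: mconst_def)
    next
      case False
      then show ?thesis by (cases "m = 0") (auto simp: mconst_def lookup_single when_def in_keys_iff)
    qed
  qed
  moreover have "c \<noteq> 0" using minor_nonzero c[of 0] by auto
  ultimately show ?thesis using c by (metis mconst_0)
qed

lemma jacobian_ideal_grad: "jacobian_ideal hermite_invariant = ideal_gen (grad ` {..5})"
proof -
  have "{mpderiv i hermite_invariant | i. True} = (\<lambda>i. mpderiv i hermite_invariant) ` UNIV" by auto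
  also have "\<dots> = grad ` {..5}" unfolding UNIV_index image_image grad_def ..
  finally have "{mpderiv i hermite_invariant | i. True} = grad ` {..5}" .
  then show ?thesis by (simp add: jacobian_ideal_def)
qed

lemma ideal_gen_unit_multiples:
  fixes x y :: "nat \<Rightarrow> R"
  assumes "\<And>k. k \<in> A \<Longrightarrow> \<exists>c. c \<noteq> 0 \<and> x k = mconst c * y k"
  shows "ideal_gen (x ` A) = ideal_gen (y ` A)"
proof
  show "ideal_gen (x ` A) \<subseteq> ideal_gen (y ` A)"
  proof (rule ideal_gen_subset, rule image_subsetI)
    fix k assume "k \<in> A"
    then obtain c where c: "x k = mconst c * y k" using assms by blast
    show "x k \<in> ideal_gen (y ` A)" unfolding c by (intro ideal_gen_scale ideal_gen_base imageI \<open>k \<in> A\<close>)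
  qed
  show "ideal_gen (y ` A) \<subseteq> ideal_gen (x ` A)"
  proof (rule ideal_gen_subset, rule image_subsetI)
    fix k assume k: "k \<in> A"
    then obtain c where c: "c \<noteq> 0" "x k = mconst c * y k" using assms by blast
    then have "y k = mconst (1 / c) * x k" by (simp add: mult.assoc[symmetric] mconst_mult[symmetric])
    then show "y k \<in> ideal_gen (x ` A)" using k by (auto intro: ideal_gen_scale ideal_gen_base)
  qed
qed

lemma jacobian_ideal_minors: "jacobian_ideal hermite_invariant = ideal_gen (signed_minor 5 field_rows ` {..5})"
  unfolding jacobian_ideal_grad using minors_constant_multiple
  by (intro ideal_gen_unit_multiples[symmetric]) auto

lemma ideal_b_minors: "ideal_b (1 / 6, 2 / 45, - 1 / 3) = ideal_gen (signed_minor 5 field_rows ` {..5})"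
proof -
  let ?u = "\<lambda>k. mconst (- (120 ^ 5) * (- 1) ^ (5 - k)) * signed_minor 5 field_rows (5 - k)"
  let ?S = "{lookup (bform 5 ?u) m | m. True}"
  have "ideal_gen ?S = ideal_gen (?u ` {..5})"
  proof
    show "ideal_gen ?S \<subseteq> ideal_gen (?u ` {..5})"
    proof (rule ideal_gen_subset, clarify)
      fix m
      show "lookup (bform 5 ?u) m \<in> ideal_gen (?u ` {..5})"
        unfolding lookup_bform ideal_gen_def
        by (rule Modules.module.span_sum[OF module_ring])
          (auto simp: ideal_gen_def[symmetric] intro: ideal_gen_base ideal_gen_zero)
    qed
    show "ideal_gen (?u ` {..5}) \<subseteq> ideal_gen ?S"
    proof (rule ideal_gen_subset, rule image_subsetI)
      fix k :: nat assume "k \<in> {..5}"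
      then have "?u k = lookup (bform 5 ?u) (bmono (5 - k) k)" by (simp add: lookup_bform_bmono)
      then show "?u k \<in> ideal_gen ?S" by (intro ideal_gen_base) blast
    qed
  qed
  also have "\<dots> = ideal_gen ((\<lambda>k. signed_minor 5 field_rows (5 - k)) ` {..5})"
    by (rule ideal_gen_unit_multiples, rule exI, rule conjI[rotated], rule refl, simp)
  also have "(\<lambda>k. signed_minor 5 field_rows (5 - k)) ` {..5} = signed_minor 5 field_rows ` {..5}"
  proof -
    have "(\<lambda>k. 5 - k) ` {..5} = {..5 :: nat}"
    proof (intro equalityI subsetI)
      fix x :: nat assume "x \<in> {..5}"
      then have "x = 5 - (5 - x)" "5 - x \<in> {..5}" by auto
      then show "x \<in> (\<lambda>k. 5 - k) ` {..5}" by (rule image_eqI)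
    qed auto
    then show ?thesis by (metis image_image)
  qed
  finally show ?thesis unfolding ideal_b_def form_Gamma_minors .
qed

lemma perfect_jacobian_ideal: "perfect_ideal (jacobian_ideal hermite_invariant)"
proof -
  interpret minors_of_grade_two 5 field_rows "jacobian_ideal hermite_invariant" "grad 5" "grad 0"
  proof
    show "jacobian_ideal hermite_invariant = ideal_gen (signed_minor 5 field_rows ` {..5})" by (rule jacobian_ideal_minors)
    show "grad 5 \<in> jacobian_ideal hermite_invariant" "grad 0 \<in> jacobian_ideal hermite_invariant"
      unfolding jacobian_ideal_grad by (auto intro: ideal_gen_base)
    show "jacobian_ideal hermite_invariant \<noteq> UNIV"
      unfolding jacobian_ideal_grad by (rule ideal_gen_proper[of _ "\<lambda>_. 0"]) (auto simp: grad_at_origin)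
    show "ideal_gen (field_rows 0 ` {..5}) \<noteq> UNIV"
    proof (rule ideal_gen_proper[of _ "\<lambda>_. 0"])
      fix x assume "x \<in> field_rows 0 ` {..5}"
      then obtain k where k: "k \<le> 5" "x = field_rows 0 k" by auto
      then show "ev (\<lambda>_. 0) x = 0"
        by (cases "k = 5") (simp_all add: field_rows_def raising_def ev.hom_mult ev_coef)
    qed
  qed (simp_all add: regular_grad)
  show ?thesis by (rule perfect)
qed

theorem proposition4p2:
  shows "(\<exists>\<tau>\<in>{(0, 0, 0), (2/5, 14/75, - 2/5), (1/6, 2/45, - 1/3)}.
            ideal_b \<tau> = jacobian_ideal hermite_invariant) \<and>
         perfect_ideal (jacobian_ideal hermite_invariant)"
  using ideal_b_minors jacobian_ideal_minors perfect_jacobian_ideal by simp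

end
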